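(* Let $X$ be a Fréchet space with a Schauder basis. The space $X^{\mathbb{N}}$ satisfies the Invariant Subspace Property if and only if $X$ is finite-dimensional or isomorphic to $\omega$.
   Context: A Fréchet space $Y$ satisfies the Invariant Subspace Property if every operator $T\in L(Y)$ (i.e. every continuous linear map $T:Y\to Y$) possesses a non-trivial invariant subspace, i.e. a closed subspace $M$ of $Y$ different from $\{0\}$ and $Y$ such that $TM\subset M$. If $(X,(q_j))$ is a Fréchet space, where $(q_j)_{j\ge 1}$ is an increasing sequence of seminorms inducing the topology of $X$, then $X^{\mathbb{N}}$, the space of all sequences $(x_n)_{n\ge 1}$ of elements of $X$, is endowed with the seminorms $p_j((x_n)_n)=\max\{q_j(x_n): n\le j\}$, $j\ge 1$. The space $\omega$ is the space of all complex sequences endowed with the seminorms $p_j(x)=\max_{n\le j}|x_n|$. *)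

theory Defs
  imports "HOL-Analysis.Analysis" "HOL-Library.Function_Algebras"
begin

text \<open>
  Vector spaces are complex vector spaces on a whole type, given by their scalar multiplication
  in the sense of the locale \<open>vector_space\<close>; the vector space structure on sequences is the
  pointwise one of \<open>Function_Algebras\<close>.  All sequences are indexed from 0 instead of from 1,
  both for the seminorms and for the elements of a sequence space.
\<close>

definition seminorm :: "(complex \<Rightarrow> 'a::ab_group_add \<Rightarrow> 'a) \<Rightarrow> ('a \<Rightarrow> real) \<Rightarrow> bool" where
  "seminorm smul p \<longleftrightarrow>
     (\<forall>c x. p (smul c x) = cmod c * p x) \<and> (\<forall>x y. p (x + y) \<le> p x + p y)"

definition seminorm_topology :: "(nat \<Rightarrow> 'a::ab_group_add \<Rightarrow> real) \<Rightarrow> 'a topology" where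
  "seminorm_topology q = topology_generated_by {{y. q j (y - x) < r} | j x r. 0 < r}"

definition seminorm_Cauchy :: "(nat \<Rightarrow> 'a::ab_group_add \<Rightarrow> real) \<Rightarrow> (nat \<Rightarrow> 'a) \<Rightarrow> bool" where
  "seminorm_Cauchy q x \<longleftrightarrow>
     (\<forall>j. \<forall>r>0. \<exists>N. \<forall>m\<ge>N. \<forall>n\<ge>N. q j (x m - x n) < r)"

locale frechet_space = vector_space smul
  for smul :: "complex \<Rightarrow> 'a::ab_group_add \<Rightarrow> 'a" +
  fixes q :: "nat \<Rightarrow> 'a \<Rightarrow> real"
  assumes seminorm: "seminorm smul (q j)"
    and increasing: "j \<le> k \<Longrightarrow> q j x \<le> q k x"
    and separating: "(\<And>j. q j x = 0) \<Longrightarrow> x = 0"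
    and complete: "seminorm_Cauchy q u \<Longrightarrow>
                     \<exists>l. limitin (seminorm_topology q) u l sequentially"

text \<open>
  A Schauder basis \<open>(e\<^sub>n)\<^sub>n\<close> with \<open>n < N\<close>, where \<open>N = \<infinity>\<close> is the usual case and a finite \<open>N\<close> makes
  the notion available in finite-dimensional spaces; \<open>e n\<close> is irrelevant for \<open>n \<ge> N\<close>.
\<close>

definition schauder_basis ::
    "(complex \<Rightarrow> 'a::ab_group_add \<Rightarrow> 'a) \<Rightarrow> (nat \<Rightarrow> 'a \<Rightarrow> real) \<Rightarrow> enat \<Rightarrow> (nat \<Rightarrow> 'a) \<Rightarrow> bool" where
  "schauder_basis smul q N e \<longleftrightarrow>
     (\<forall>x. \<exists>!a :: nat \<Rightarrow> complex. (\<forall>n. N \<le> enat n \<longrightarrow> a n = 0) \<and>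
        limitin (seminorm_topology q) (\<lambda>m. \<Sum>n<m. smul (a n) (e n)) x sequentially)"

definition invariant_subspace_property ::
    "(complex \<Rightarrow> 'a::ab_group_add \<Rightarrow> 'a) \<Rightarrow> (nat \<Rightarrow> 'a \<Rightarrow> real) \<Rightarrow> bool" where
  "invariant_subspace_property smul q \<longleftrightarrow>
     (\<forall>T. Vector_Spaces.linear smul smul T \<and>
          continuous_map (seminorm_topology q) (seminorm_topology q) T \<longrightarrow>
        (\<exists>M. module.subspace smul M \<and> closedin (seminorm_topology q) M \<and>
             M \<noteq> {0} \<and> M \<noteq> UNIV \<and> T ` M \<subseteq> M))"

definition isomorphic_spaces ::
    "(complex \<Rightarrow> 'a::ab_group_add \<Rightarrow> 'a) \<Rightarrow> (nat \<Rightarrow> 'a \<Rightarrow> real) \<Rightarrow>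
     (complex \<Rightarrow> 'b::ab_group_add \<Rightarrow> 'b) \<Rightarrow> (nat \<Rightarrow> 'b \<Rightarrow> real) \<Rightarrow> bool" where
  "isomorphic_spaces smul q smul' q' \<longleftrightarrow>
     (\<exists>T. Vector_Spaces.linear smul smul' T \<and>
          homeomorphic_map (seminorm_topology q) (seminorm_topology q') T)"

definition seq_scale :: "(complex \<Rightarrow> 'a \<Rightarrow> 'a) \<Rightarrow> complex \<Rightarrow> (nat \<Rightarrow> 'a) \<Rightarrow> (nat \<Rightarrow> 'a)" where
  "seq_scale smul c x = (\<lambda>n. smul c (x n))"

definition seq_seminorm :: "(nat \<Rightarrow> 'a \<Rightarrow> real) \<Rightarrow> nat \<Rightarrow> (nat \<Rightarrow> 'a) \<Rightarrow> real" where
  "seq_seminorm q j x = Max {q j (x n) | n. n \<le> j}"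

definition omega_scale :: "complex \<Rightarrow> (nat \<Rightarrow> complex) \<Rightarrow> (nat \<Rightarrow> complex)" where
  "omega_scale c x = (\<lambda>n. c * x n)"

definition omega_seminorm :: "nat \<Rightarrow> (nat \<Rightarrow> complex) \<Rightarrow> real" where
  "omega_seminorm j x = Max {cmod (x n) | n. n \<le> j}"

end

theory Submission
  imports Defs "HOL-Computational_Algebra.Polynomial"
begin

text \<open>
  Let \<open>X\<close> be the given space with basis \<open>(e\<^sub>n)\<close>, and call \<open>X\<close> flat if every \<open>q\<^sub>j\<close> vanishes at all but
  finitely many \<open>e\<^sub>n\<close>.  If the basis is infinite and \<open>X\<close> is flat, then every sequence of scalars is
  the coefficient sequence of a vector, since the partial sums are eventually constant for each
  \<open>q\<^sub>j\<close>, and the coefficients identify \<open>X\<close> with \<open>\<omega>\<close> (\<open>isomorphic_omega_if_flat\<close>).  So the theorem says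
  that \<open>X\<^sup>\<nat>\<close> has the invariant subspace property exactly when the basis is finite or \<open>X\<close> is flat.

  If \<open>X\<close> is finite-dimensional or isomorphic to \<open>\<omega>\<close>, then \<open>X\<^sup>\<nat>\<close> is isomorphic to \<open>\<omega>\<close>.  An operator on
  \<open>\<omega>\<close> is the transpose of a linear map on the space of finitely supported sequences, that
  is, of polynomials.  A linear map on an infinite-dimensional space always has a nontrivial invariant
  subspace, and the annihilator of such a subspace is a closed invariant subspace of \<open>\<omega>\<close>
  (\<open>invariant_subspace_property_omega\<close>).

  Now suppose that the basis is infinite and \<open>q\<^sub>j\<^sub>0\<close> is nonzero at infinitely many \<open>e\<^sub>n\<close>.  Number the seminorms of \<open>X\<^sup>\<nat>\<close> from
  \<open>j\<^sub>0\<close> on as \<open>P\<^sub>0, P\<^sub>1, \<dots>\<close>, and let the level of a basis vector (\<open>e\<^sub>k\<close> in one place, \<open>0\<close> elsewhere)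
  be the first \<open>j\<close> at which \<open>P\<^sub>j\<close> does not vanish.  Each level is attained infinitely often, so the
  basis vectors can be listed as \<open>v\<^sub>0, v\<^sub>1, \<dots>\<close> with any prescribed levels that take each value
  infinitely often.  Put \<open>f\<^sub>i = \<gamma>\<^sub>i v\<^sub>i\<close> with \<open>\<gamma>\<^sub>i > 0\<close> and let \<open>T f\<^sub>i = f\<^sub>i\<^sub>+\<^sub>1\<close>, except that
  \<open>T f\<^sub>i = f\<^sub>i\<^sub>+\<^sub>1 + f\<^sub>0\<close> if \<open>i\<close> is the last index of a block.  The indices are divided into consecutive
  blocks, the \<open>\<sigma>\<close>-th of which starts at a vector of level \<open>\<sigma>\<close>; from there the levels descend slowly
  to \<open>0\<close>.  Continuity of \<open>T\<close> costs nothing at the beginning of a block, because a vector of level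
  \<open>\<sigma>\<close> is invisible to \<open>P\<^sub>j\<close> for \<open>j < \<sigma>\<close> and each remaining estimate concerns finitely many blocks.
  Hence the sizes \<open>\<gamma>\<^sub>i\<close> can be chosen as large as one likes when a new block begins.

  If \<open>T\<close> had a nontrivial closed invariant subspace, then by Hahn and Banach there would be a vector
  \<open>y \<noteq> 0\<close> and a continuous functional \<open>\<xi> \<noteq> 0\<close> with \<open>\<xi> (T\<^sup>s y) = 0\<close> for all \<open>s\<close>.  Replacing \<open>\<xi>\<close> by
  \<open>\<xi> \<circ> T\<^sup>\<beta>\<close> one may assume \<open>\<xi> (f\<^sub>0) \<noteq> 0\<close>.  Say that \<open>\<xi>\<close> is bounded by \<open>P\<^sub>k\<close>, and look at the \<open>\<sigma>\<close>-th block
  for a large \<open>\<sigma>\<close>.  Up to vectors that are invisible to \<open>\<xi>\<close> for a long time, \<open>T\<close> acts on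
  \<open>f\<^sub>0, \<dots>, f\<^sub>n\<close>, where \<open>n\<close> is the end of the block, as multiplication by \<open>t\<close> modulo a polynomial of the
  form \<open>t\<^sup>l p(t) - 1\<close>.  The functional sees only the indices before the block and the short final
  stretch of level at most \<open>k\<close>, whereas the coordinates of \<open>y\<close> on the twice as long stretch of level
  \<open>k + 1\<close> are negligible, because \<open>P\<^sub>k\<^sub>+\<^sub>1 (f\<^sub>i)\<close> is huge there.  If they were zero but the truncation of \<open>y\<close> were
  not, the values of \<open>\<xi>\<close> along an orbit would satisfy a linear recurrence whose order is at most the
  number of zeros with which they begin, and this would force \<open>\<xi> (f\<^sub>0) = 0\<close> (\<open>correlation_nonzero\<close>).  By compactness
  there is a uniform lower bound, which depends only on data chosen before the sizes of the stretch
  of level \<open>k + 1\<close> and of all later blocks (\<open>ex_uniform_correlation\<close>).  The sizes are therefore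
  chosen, block after block and backwards inside each block, so large that everything which has been
  neglected stays below this bound (\<open>ex_scaling\<close>, \<open>no_annihilating_pair\<close>).

  That \<open>T\<close> is well defined and continuous rests on the equicontinuity of the partial sums of a
  Schauder basis, proved by Baire's category argument (\<open>partial_equicontinuous\<close>).
\<close>

section \<open>Topologies given by increasing seminorms\<close>

lemma seminorm_properties:
  assumes "vector_space smul" "seminorm smul p"
  shows seminorm_smul: "p (smul c x) = cmod c * p x"
    and seminorm_triangle: "p (x + y) \<le> p x + p y"
    and seminorm_zero: "p 0 = 0"
    and seminorm_minus: "p (- x) = p x"
    and seminorm_nonneg: "0 \<le> p x"
proof -
  interpret vector_space smul by fact
  show s: "p (smul c x) = cmod c * p x" for c x using assms(2) by (simp add: seminorm_def)
  show t: "p (x + y) \<le> p x + p y" for x y using assms(2) by (simp add: seminorm_def)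
  show z: "p 0 = 0" using s[of 0 0] by simp
  show m: "p (- x) = p x" for x using s[of "-1" x] by simp
  show "0 \<le> p x" using t[of x "- x"] z m by simp
qed

text \<open>
  The first two axioms of a Frechet space suffice for all statements about the topology itself,
  and they are what is known about \<open>X\<^sup>\<nat>\<close> before its completeness is established.
\<close>

locale seminormed_space = vector_space smul
  for smul :: "complex \<Rightarrow> 'a::ab_group_add \<Rightarrow> 'a" +
  fixes q :: "nat \<Rightarrow> 'a \<Rightarrow> real"
  assumes is_seminorm: "seminorm smul (q j)"
    and mono_seminorms: "j \<le> k \<Longrightarrow> q j x \<le> q k x"
begin

lemma q_smul: "q j (smul c x) = cmod c * q j x"
  and q_triangle: "q j (x + y) \<le> q j x + q j y"
  and q_zero [simp]: "q j 0 = 0"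
  and q_minus [simp]: "q j (- x) = q j x"
  and q_nonneg [simp]: "0 \<le> q j x"
  by (rule seminorm_properties[OF vector_space_axioms is_seminorm])+

lemma q_diff_commute: "q j (x - y) = q j (y - x)"
  using q_minus[of j "x - y"] by simp

lemma q_triangle_diff: "q j (x - z) \<le> q j (x - y) + q j (y - z)"
  using q_triangle[of j "x - y" "y - z"] by simp

lemma q_diff_le: "q j (x - y) \<le> q j x + q j y"
  using q_triangle[of j x "- y"] by simp

lemma q_sum_le: "q j (\<Sum>i\<in>A. g i) \<le> (\<Sum>i\<in>A. q j (g i))"
  by (induction A rule: infinite_finite_induct) (auto intro: order.trans[OF q_triangle])

text \<open>
  The balls form a base and not only a subbase, because of two seminorms the one with the larger
  index dominates the other.
\<close>

lemma openin_iff: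
  "openin (seminorm_topology q) U \<longleftrightarrow> (\<forall>x\<in>U. \<exists>j r. 0 < r \<and> (\<forall>y. q j (y - x) < r \<longrightarrow> y \<in> U))"
    (is "_ \<longleftrightarrow> ?R U")
proof
  assume "openin (seminorm_topology q) U"
  then have "generate_topology_on {{y. q j (y - x) < r} | j x r. 0 < r} U"
    unfolding seminorm_topology_def by (rule openin_topology_generated_by)
  then show "?R U"
  proof induction
    case (Int U V)
    show ?case
    proof
      fix x assume "x \<in> U \<inter> V"
      then have "x \<in> U" "x \<in> V" by auto
      obtain j r where 1: "0 < r" "\<And>y. q j (y - x) < r \<Longrightarrow> y \<in> U" using Int.IH(1) \<open>x \<in> U\<close> by blast
      obtain k s where 2: "0 < s" "\<And>y. q k (y - x) < s \<Longrightarrow> y \<in> V" using Int.IH(2) \<open>x \<in> V\<close> by blast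
      have "y \<in> U \<inter> V" if "q (max j k) (y - x) < min r s" for y
        using that 1(2)[of y] 2(2)[of y] mono_seminorms[of j "max j k" "y - x"] mono_seminorms[of k "max j k" "y - x"] by auto
      then show "\<exists>j r. 0 < r \<and> (\<forall>y. q j (y - x) < r \<longrightarrow> y \<in> U \<inter> V)"
        using 1(1) 2(1) by (intro exI[of _ "max j k"] exI[of _ "min r s"]) auto
    qed
  next
    case (UN K)
    show ?case
    proof
      fix x assume "x \<in> \<Union>K"
      then obtain k where k: "k \<in> K" "x \<in> k" by blast
      then obtain j r where "0 < r" "\<forall>y. q j (y - x) < r \<longrightarrow> y \<in> k" using UN.IH by blast
      then show "\<exists>j r. 0 < r \<and> (\<forall>y. q j (y - x) < r \<longrightarrow> y \<in> \<Union>K)" using k by blast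
    qed
  next
    case (Basis s)
    then obtain j z r where s: "s = {y. q j (y - z) < r}" "0 < r" by blast
    show ?case
    proof
      fix x assume "x \<in> s"
      then have x: "q j (x - z) < r" using s by simp
      have "y \<in> s" if "q j (y - x) < r - q j (x - z)" for y
        using that q_triangle_diff[of j y z x] by (simp add: s)
      then show "\<exists>j r. 0 < r \<and> (\<forall>y. q j (y - x) < r \<longrightarrow> y \<in> s)"
        using x by (intro exI[of _ j] exI[of _ "r - q j (x - z)"]) auto
    qed
  qed auto
next
  assume R: "?R U"
  let ?B = "{{y. q j (y - x) < r} | j x r. 0 < r}"
  have "U = \<Union>{B \<in> ?B. B \<subseteq> U}"
  proof
    show "U \<subseteq> \<Union>{B \<in> ?B. B \<subseteq> U}"
    proof
      fix x assume "x \<in> U"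
      then obtain j r where "0 < r" "\<forall>y. q j (y - x) < r \<longrightarrow> y \<in> U" using R by blast
      then have "{y. q j (y - x) < r} \<in> ?B" and sub: "{y. q j (y - x) < r} \<subseteq> U" and x: "x \<in> {y. q j (y - x) < r}" by auto
      then have "{y. q j (y - x) < r} \<in> {B \<in> ?B. B \<subseteq> U}" by simp
      then show "x \<in> \<Union>{B \<in> ?B. B \<subseteq> U}" using x by (rule UnionI)
    qed
  qed auto
  moreover have "openin (topology_generated_by ?B) (\<Union>{B \<in> ?B. B \<subseteq> U})"
    by (rule openin_Union) (auto intro: topology_generated_by_Basis)
  ultimately show "openin (seminorm_topology q) U" unfolding seminorm_topology_def by simp
qed

lemma openin_seminorm_ball: "0 < r \<Longrightarrow> openin (seminorm_topology q) {y. q j (y - x) < r}"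
  unfolding seminorm_topology_def by (intro topology_generated_by_Basis) blast

lemma topspace_seminorm [simp]: "topspace (seminorm_topology q) = UNIV"
proof -
  have "openin (seminorm_topology q) UNIV" by (auto simp: openin_iff intro: exI[of _ 1])
  then show ?thesis using openin_subset by blast
qed

lemma limitin_iff: "limitin (seminorm_topology q) u l F \<longleftrightarrow> (\<forall>j. ((\<lambda>n. q j (u n - l)) \<longlongrightarrow> 0) F)"
proof
  assume L: "limitin (seminorm_topology q) u l F"
  show "\<forall>j. ((\<lambda>n. q j (u n - l)) \<longlongrightarrow> 0) F"
  proof (intro allI tendstoI)
    fix j and r :: real assume "0 < r"
    have "openin (seminorm_topology q) {y. q j (y - l) < r}"
      using \<open>0 < r\<close> by (rule openin_seminorm_ball)
    moreover have "l \<in> {y. q j (y - l) < r}" using \<open>0 < r\<close> by simp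
    ultimately have "eventually (\<lambda>n. u n \<in> {y. q j (y - l) < r}) F" using L unfolding limitin_def by blast
    then show "eventually (\<lambda>n. dist (q j (u n - l)) 0 < r) F" by simp
  qed
next
  assume R: "\<forall>j. ((\<lambda>n. q j (u n - l)) \<longlongrightarrow> 0) F"
  show "limitin (seminorm_topology q) u l F"
    unfolding limitin_def
  proof (intro conjI allI impI)
    fix U assume "openin (seminorm_topology q) U \<and> l \<in> U"
    then obtain j r where "0 < r" "\<forall>y. q j (y - l) < r \<longrightarrow> y \<in> U" by (auto simp: openin_iff)
    moreover have "eventually (\<lambda>n. dist (q j (u n - l)) 0 < r) F" using R \<open>0 < r\<close> by (intro tendstoD) auto
    ultimately show "eventually (\<lambda>n. u n \<in> U) F" by (auto elim: eventually_mono)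
  qed simp
qed

lemma q_limit_le:
  assumes "(\<lambda>n. q j (u n - l)) \<longlonglongrightarrow> 0" "eventually (\<lambda>n. q j (u n - x) \<le> C) sequentially"
  shows "q j (l - x) \<le> C"
proof -
  have "(\<lambda>n. q j (u n - l) + C) \<longlonglongrightarrow> 0 + C" by (intro tendsto_add assms tendsto_const)
  moreover have "eventually (\<lambda>n. q j (l - x) \<le> q j (u n - l) + C) sequentially"
    using assms(2)
  proof eventually_elim
    case (elim n)
    then show ?case using q_triangle_diff[of j l x "u n"] q_diff_commute[of j l "u n"] by simp
  qed
  ultimately have "q j (l - x) \<le> 0 + C"
    by (intro tendsto_le[OF _ _ tendsto_const[of "q j (l - x)"]]) auto
  then show ?thesis by simp
qed

lemma closedin_iff:
  "closedin (seminorm_topology q) M \<longleftrightarrow> (\<forall>x. (\<forall>j r. 0 < r \<longrightarrow> (\<exists>m\<in>M. q j (m - x) < r)) \<longrightarrow> x \<in> M)"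
proof -
  have "closedin (seminorm_topology q) M \<longleftrightarrow> (\<forall>x\<in>UNIV - M. \<exists>j r. 0 < r \<and> (\<forall>m. q j (m - x) < r \<longrightarrow> m \<in> UNIV - M))"
    by (simp only: closedin_def openin_iff topspace_seminorm subset_UNIV simp_thms)
  also have "\<dots> \<longleftrightarrow> (\<forall>x. (\<forall>j r. 0 < r \<longrightarrow> (\<exists>m\<in>M. q j (m - x) < r)) \<longrightarrow> x \<in> M)"
    by (simp only: Diff_iff UNIV_I simp_thms) blast
  finally show ?thesis .
qed

end

sublocale frechet_space \<subseteq> seminormed_space
  by unfold_locales (auto intro: seminorm increasing)

context frechet_space
begin

lemma limit_unique:
  assumes "\<And>j. (\<lambda>n. q j (u n - l)) \<longlonglongrightarrow> 0" "\<And>j. (\<lambda>n. q j (u n - l')) \<longlonglongrightarrow> 0"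
  shows "l = l'"
proof -
  have "q j (l - l') = 0" for j
  proof -
    have "(\<lambda>n. q j (u n - l) + q j (u n - l')) \<longlonglongrightarrow> 0 + 0" by (intro tendsto_add assms)
    moreover have "q j (l - l') \<le> q j (u n - l) + q j (u n - l')" for n
      using q_triangle_diff[of j l l' "u n"] by (simp add: q_diff_commute)
    ultimately have "q j (l - l') \<le> 0" by (intro LIMSEQ_le_const[of _ "0 :: real"]) auto
    then show ?thesis by (intro antisym) auto
  qed
  then have "l - l' = 0" by (rule separating)
  then show ?thesis by simp
qed

lemma Cauchy_limit:
  assumes "\<And>j r. 0 < r \<Longrightarrow> \<exists>N. \<forall>m\<ge>N. \<forall>n\<ge>N. q j (u m - u n) < r"
  obtains l where "\<And>j. (\<lambda>n. q j (u n - l)) \<longlonglongrightarrow> 0"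
  using complete[of u] assms unfolding seminorm_Cauchy_def limitin_iff by blast

end

lemma continuous_linear_iff:
  assumes "seminormed_space smul q" "seminormed_space smul' q'" and T: "Vector_Spaces.linear smul smul' T"
  shows "continuous_map (seminorm_topology q) (seminorm_topology q') T \<longleftrightarrow>
    (\<forall>k. \<exists>j C. \<forall>x. q' k (T x) \<le> C * q j x)"
proof -
  interpret X: seminormed_space smul q by fact
  interpret Y: seminormed_space smul' q' by fact
  interpret T: Vector_Spaces.linear smul smul' T by fact
  show ?thesis
  proof
    assume c: "continuous_map (seminorm_topology q) (seminorm_topology q') T"
    show "\<forall>k. \<exists>j C. \<forall>x. q' k (T x) \<le> C * q j x"
    proof
      fix k
      have "openin (seminorm_topology q') {y. q' k (y - 0) < 1}"
        by (rule Y.openin_seminorm_ball) simp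
      then have "openin (seminorm_topology q) {x \<in> topspace (seminorm_topology q). T x \<in> {y. q' k (y - 0) < 1}}"
        using c unfolding continuous_map_def by blast
      then have "openin (seminorm_topology q) {x. q' k (T x) < 1}" by simp
      moreover have "0 \<in> {x. q' k (T x) < 1}" by (simp add: T.zero)
      ultimately obtain j r where r: "0 < r" "\<And>y. q j (y - 0) < r \<Longrightarrow> y \<in> {x. q' k (T x) < 1}"
        unfolding X.openin_iff by blast
      have "q' k (T x) \<le> (2 / r) * q j x" for x
      proof (rule field_le_epsilon)
        fix e :: real assume e: "0 < e"
        define t where "t = 2 / r * q j x + e"
        have "0 \<le> 2 / r * q j x" using r by simp
        then have t: "0 < t" using e by (simp add: t_def)
        have "q j (smul (of_real (1 / t)) x) = q j x / t" using t by (simp add: X.q_smul norm_divide)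
        also have "\<dots> < r"
        proof -
          have "q j x < r * t"
          proof -
            have "r * t = 2 * q j x + r * e" using r by (simp add: t_def distrib_left)
            then show ?thesis using mult_pos_pos[OF r(1) e] X.q_nonneg[of j x] e by linarith
          qed
          then show ?thesis using t by (simp add: divide_less_eq)
        qed
        finally have "q' k (T (smul (of_real (1 / t)) x)) < 1" using r(2) by simp
        then have "q' k (T x) / t < 1" using t by (simp add: T.scale Y.q_smul norm_divide)
        then show "q' k (T x) \<le> 2 / r * q j x + e" using t by (simp add: t_def divide_less_eq)
      qed
      then show "\<exists>j C. \<forall>x. q' k (T x) \<le> C * q j x" by blast
    qed
  next
    assume b: "\<forall>k. \<exists>j C. \<forall>x. q' k (T x) \<le> C * q j x"
    show "continuous_map (seminorm_topology q) (seminorm_topology q') T"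
      unfolding continuous_map_def
    proof (intro conjI allI impI)
      fix U assume "openin (seminorm_topology q') U"
      then have U: "\<forall>x\<in>U. \<exists>j r. 0 < r \<and> (\<forall>y. q' j (y - x) < r \<longrightarrow> y \<in> U)" by (simp add: Y.openin_iff)
      have "\<exists>j r. 0 < r \<and> (\<forall>y. q j (y - x) < r \<longrightarrow> T y \<in> U)" if TxU: "T x \<in> U" for x
      proof -
        obtain k r where r: "0 < r" "\<And>y. q' k (y - T x) < r \<Longrightarrow> y \<in> U" using bspec[OF U TxU] by blast
        obtain j C where C: "\<And>x. q' k (T x) \<le> C * q j x" using b by blast
        define D where "D = \<bar>C\<bar> + 1"
        have D: "0 < D" "C \<le> D" by (auto simp: D_def)
        have "T y \<in> U" if "q j (y - x) < r / D" for y
        proof (rule r(2))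
          have "q' k (T y - T x) \<le> C * q j (y - x)" using C[of "y - x"] by (simp add: T.diff)
          also have "\<dots> \<le> D * q j (y - x)" using D by (intro mult_right_mono) auto
          also have "\<dots> < r" using that D by (simp add: field_simps)
          finally show "q' k (T y - T x) < r" .
        qed
        moreover have "0 < r / D" using r(1) D(1) by simp
        ultimately show ?thesis by blast
      qed
      then show "openin (seminorm_topology q) {x \<in> topspace (seminorm_topology q). T x \<in> U}"
        unfolding X.openin_iff X.topspace_seminorm by simp
    qed simp
  qed
qed

lemma seq_seminorm_le_iff: "seq_seminorm q j x \<le> r \<longleftrightarrow> (\<forall>n\<le>j. q j (x n) \<le> r)"
proof -
  have "{q j (x n) |n. n \<le> j} = (\<lambda>n. q j (x n)) ` {..j}" by auto
  then show ?thesis unfolding seq_seminorm_def by (auto simp: Max_le_iff)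
qed

lemma seq_seminorm_less_iff: "seq_seminorm q j x < r \<longleftrightarrow> (\<forall>n\<le>j. q j (x n) < r)"
proof -
  have "{q j (x n) |n. n \<le> j} = (\<lambda>n. q j (x n)) ` {..j}" by auto
  then show ?thesis unfolding seq_seminorm_def by (auto simp: Max_less_iff)
qed

lemma seq_seminorm_ge: "n \<le> j \<Longrightarrow> q j (x n) \<le> seq_seminorm q j x"
  using seq_seminorm_le_iff[of q j x "seq_seminorm q j x"] by auto

text \<open>
  Completeness is inherited coordinatewise: the \<open>j\<close>-th seminorm of a sequence involves only finitely
  many coordinates, so coordinatewise limits are limits.
\<close>

lemma frechet_space_seq:
  assumes "frechet_space smul q"
  shows "frechet_space (seq_scale smul) (seq_seminorm q)"
proof -
  interpret frechet_space smul q by fact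
  have vs: "vector_space (seq_scale smul)"
    by unfold_locales (auto simp: seq_scale_def fun_eq_iff scale_right_distrib scale_left_distrib)
  interpret Y: vector_space "seq_scale smul" by (fact vs)
  have sn: "seminorm (seq_scale smul) (seq_seminorm q j)" for j
    unfolding seminorm_def
  proof (intro conjI allI)
    fix c x
    show "seq_seminorm q j (seq_scale smul c x) = cmod c * seq_seminorm q j x"
    proof (rule antisym)
      show "seq_seminorm q j (seq_scale smul c x) \<le> cmod c * seq_seminorm q j x"
        unfolding seq_seminorm_le_iff by (auto simp: seq_scale_def q_smul intro!: mult_left_mono seq_seminorm_ge)
      have "seq_seminorm q j x \<le> seq_seminorm q j (seq_scale smul c x) / cmod c" if "c \<noteq> 0"
        unfolding seq_seminorm_le_iff
      proof (intro allI impI)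
        fix n assume "n \<le> j"
        then have "q j (seq_scale smul c x n) \<le> seq_seminorm q j (seq_scale smul c x)" by (rule seq_seminorm_ge)
        then show "q j (x n) \<le> seq_seminorm q j (seq_scale smul c x) / cmod c"
          using that by (simp add: seq_scale_def q_smul field_simps)
      qed
      then show "cmod c * seq_seminorm q j x \<le> seq_seminorm q j (seq_scale smul c x)"
      proof (cases "c = 0")
        case True
        have "0 \<le> q j (seq_scale smul c x 0)" by simp
        also have "\<dots> \<le> seq_seminorm q j (seq_scale smul c x)" by (rule seq_seminorm_ge) simp
        finally show ?thesis using True by simp
      qed (auto simp: field_simps)
    qed
  next
    fix x y
    show "seq_seminorm q j (x + y) \<le> seq_seminorm q j x + seq_seminorm q j y"
      unfolding seq_seminorm_le_iff
      by (auto intro!: order.trans[OF q_triangle] add_mono seq_seminorm_ge)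
  qed
  have le: "q j (x n) \<le> seq_seminorm q (max j n) x" for j n x
    using increasing[of j "max j n" "x n"] seq_seminorm_ge[of n "max j n" q x] by simp
  have inc: "seq_seminorm q j x \<le> seq_seminorm q k x" if "j \<le> k" for j k x
    unfolding seq_seminorm_le_iff
  proof (intro allI impI)
    fix n assume "n \<le> j"
    then show "q j (x n) \<le> seq_seminorm q k x"
      using increasing[OF that, of "x n"] seq_seminorm_ge[of n k q x] that by simp
  qed
  interpret S: seminormed_space "seq_scale smul" "seq_seminorm q"
    by unfold_locales (auto intro: sn inc)
  show ?thesis
  proof
    show "seminorm (seq_scale smul) (seq_seminorm q j)" for j by (rule sn)
    show "seq_seminorm q j x \<le> seq_seminorm q k x" if "j \<le> k" for j k x using that by (rule inc)
    show "x = 0" if "\<And>j. seq_seminorm q j x = 0" for x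
    proof
      fix n
      have "q j (x n) = 0" for j using le[of j x n] that by (intro antisym) auto
      then show "x n = 0 n" by (simp add: separating)
    qed
    fix u assume C: "seminorm_Cauchy (seq_seminorm q) u"
    have "\<exists>l. \<forall>j. (\<lambda>m. q j (u m n - l)) \<longlonglongrightarrow> 0" for n
    proof -
      have "\<exists>N. \<forall>a\<ge>N. \<forall>b\<ge>N. q j (u a n - u b n) < r" if "0 < r" for j r
      proof -
        obtain N where "\<forall>a\<ge>N. \<forall>b\<ge>N. seq_seminorm q (max j n) (u a - u b) < r"
          using C \<open>0 < r\<close> unfolding seminorm_Cauchy_def by blast
        moreover have "q j (u a n - u b n) \<le> seq_seminorm q (max j n) (u a - u b)" for a b
          using le[of j "u a - u b" n] by simp
        ultimately show ?thesis by (meson le_less_trans)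
      qed
      then show ?thesis using Cauchy_limit[of "\<lambda>m. u m n"] by metis
    qed
    then obtain l where l: "\<And>n j. (\<lambda>m. q j (u m n - l n)) \<longlonglongrightarrow> 0" by metis
    have "limitin (seminorm_topology (seq_seminorm q)) u l sequentially"
      unfolding S.limitin_iff
    proof (intro allI tendstoI)
      fix j and r :: real assume "0 < r"
      have "eventually (\<lambda>m. \<forall>n\<in>{..j}. q j (u m n - l n) < r) sequentially"
        by (rule eventually_ball_finite) (use order_tendstoD(2)[OF l \<open>0 < r\<close>] in auto)
      then show "eventually (\<lambda>m. dist (seq_seminorm q j (u m - l)) 0 < r) sequentially"
        by (simp add: seq_seminorm_less_iff Ball_def)
    qed
    then show "\<exists>l. limitin (seminorm_topology (seq_seminorm q)) u l sequentially" by blast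
  qed
qed

section \<open>Separation of a point from a closed subspace\<close>

text \<open>
  The graph of a real linear functional on a real subspace that is dominated by \<open>p\<close>.  Linearity and
  domination make such a set single-valued, so partial functionals can be handled as plain sets
  ordered by inclusion.
\<close>

definition dominated_graph ::
    "(complex \<Rightarrow> 'a::ab_group_add \<Rightarrow> 'a) \<Rightarrow> ('a \<Rightarrow> real) \<Rightarrow> ('a \<times> real) set \<Rightarrow> bool" where
  "dominated_graph smul p G \<longleftrightarrow> (0, 0) \<in> G \<and>
     (\<forall>x a y b. (x, a) \<in> G \<longrightarrow> (y, b) \<in> G \<longrightarrow> (x + y, a + b) \<in> G) \<and>
     (\<forall>x a t. (x, a) \<in> G \<longrightarrow> (smul (complex_of_real t) x, t * a) \<in> G) \<and>
     (\<forall>x a. (x, a) \<in> G \<longrightarrow> a \<le> p x)"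

text \<open>
  The one-dimensional step of the Hahn-Banach theorem: the value at \<open>x0\<close> must lie between
  \<open>a - p (x - x0)\<close> and \<open>p (y + x0) - b\<close> for all \<open>(x, a)\<close> and \<open>(y, b)\<close> in the graph, and the triangle
  inequality says that all these constraints are compatible.
\<close>

lemma dominated_graph_extend:
  assumes "vector_space smul" and hom: "\<And>c x. p (smul c x) = cmod c * p x" and tri: "\<And>x y. p (x + y) \<le> p x + p y"
    and G: "dominated_graph smul p G"
  shows "\<exists>G' c. dominated_graph smul p G' \<and> G \<subseteq> G' \<and> (x0, c) \<in> G'"
proof -
  interpret vector_space smul by fact
  let ?L = "(\<lambda>(x, a). a - p (x - x0)) ` G"
  have sep: "a - p (x - x0) \<le> p (y + x0) - b" if "(x, a) \<in> G" "(y, b) \<in> G" for x a y b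
  proof -
    have "(x + y, a + b) \<in> G" using G that unfolding dominated_graph_def by blast
    then have "a + b \<le> p (x + y)" using G unfolding dominated_graph_def by blast
    also have "\<dots> \<le> p (x - x0) + p (y + x0)" using tri[of "x - x0" "y + x0"] by simp
    finally show ?thesis by simp
  qed
  have G0: "(0, 0) \<in> G" using G unfolding dominated_graph_def by blast
  define c where "c = Sup ?L"
  have lower: "a - p (x - x0) \<le> c" if "(x, a) \<in> G" for x a
  proof -
    have "bdd_above ?L" using sep[OF _ G0] by (auto intro!: bdd_aboveI)
    moreover have "a - p (x - x0) \<in> ?L" using that by force
    ultimately show ?thesis unfolding c_def by (intro cSup_upper)
  qed
  have upper: "c \<le> p (y + x0) - b" if "(y, b) \<in> G" for y b
    unfolding c_def by (rule cSup_least) (use G0 sep[OF _ that] in auto)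
  define G' where "G' = {(x + smul (complex_of_real t) x0, a + t * c) | x a t. (x, a) \<in> G}"
  have dom: "a + t * c \<le> p (x + smul (complex_of_real t) x0)" if xa: "(x, a) \<in> G" for x a t
  proof -
    have scaled: "(smul (complex_of_real s) x, s * a) \<in> G" for s
      using G xa unfolding dominated_graph_def by blast
    consider "t = 0" | "0 < t" | "t < 0" by linarith
    then show ?thesis
    proof cases
      case 1
      then show ?thesis using G xa by (simp add: dominated_graph_def)
    next
      case 2
      have "c \<le> p (smul (complex_of_real (1 / t)) x + x0) - 1 / t * a" by (rule upper[OF scaled])
      then have "t * (1 / t * a + c) \<le> t * p (smul (complex_of_real (1 / t)) x + x0)" using 2 by (intro mult_left_mono) auto
      also have "\<dots> = p (smul (complex_of_real t) (smul (complex_of_real (1 / t)) x + x0))" using 2 by (simp add: hom)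
      also have "smul (complex_of_real t) (smul (complex_of_real (1 / t)) x + x0) = x + smul (complex_of_real t) x0"
        using 2 by (simp add: scale_right_distrib flip: of_real_mult)
      finally show ?thesis using 2 by (simp add: distrib_left)
    next
      case 3
      define s where "s = - t"
      have s: "0 < s" "t = - s" using 3 by (auto simp: s_def)
      have "1 / s * a - p (smul (complex_of_real (1 / s)) x - x0) \<le> c" by (rule lower[OF scaled])
      then have "s * (1 / s * a - c) \<le> s * p (smul (complex_of_real (1 / s)) x - x0)" using s by (intro mult_left_mono) auto
      also have "\<dots> = p (smul (complex_of_real s) (smul (complex_of_real (1 / s)) x - x0))" using s by (simp add: hom)
      also have "smul (complex_of_real s) (smul (complex_of_real (1 / s)) x - x0) = x + smul (complex_of_real t) x0"
        using s by (simp add: scale_right_diff_distrib flip: of_real_mult)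
      finally show ?thesis using s by (simp add: right_diff_distrib)
    qed
  qed
  have sub: "G \<subseteq> G'"
  proof
    fix z assume "z \<in> G"
    then show "z \<in> G'" unfolding G'_def by (cases z) (force intro: exI[of _ 0])
  qed
  have x0: "(x0, c) \<in> G'" unfolding G'_def using G0 by (force intro: exI[of _ 1])
  have "dominated_graph smul p G'"
    unfolding dominated_graph_def
  proof (intro conjI allI impI)
    show "(0, 0) \<in> G'" using sub G0 by blast
    fix x a assume xa: "(x, a) \<in> G'"
    then obtain x1 a1 t where 1: "x = x1 + smul (complex_of_real t) x0" "a = a1 + t * c" "(x1, a1) \<in> G" unfolding G'_def by blast
    show "a \<le> p x" using dom[OF 1(3)] 1 by simp
    show "(smul (complex_of_real s) x, s * a) \<in> G'" for s
    proof -
      have "(smul (complex_of_real s) x1, s * a1) \<in> G" using G 1(3) unfolding dominated_graph_def by blast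
      moreover have "smul (complex_of_real s) x = smul (complex_of_real s) x1 + smul (complex_of_real (s * t)) x0" "s * a = s * a1 + (s * t) * c"
        using 1 by (simp_all add: scale_right_distrib distrib_left)
      ultimately show ?thesis unfolding G'_def by blast
    qed
    fix y b assume "(y, b) \<in> G'"
    then obtain y1 b1 s where 2: "y = y1 + smul (complex_of_real s) x0" "b = b1 + s * c" "(y1, b1) \<in> G" unfolding G'_def by blast
    have "(x1 + y1, a1 + b1) \<in> G" using G 1(3) 2(3) unfolding dominated_graph_def by blast
    moreover have "x + y = (x1 + y1) + smul (complex_of_real (t + s)) x0" "a + b = (a1 + b1) + (t + s) * c"
      using 1 2 by (simp_all add: scale_left_distrib distrib_right)
    ultimately show "(x + y, a + b) \<in> G'" unfolding G'_def by blast
  qed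
  then show ?thesis using sub x0 by blast
qed

lemma dominated_graph_total:
  assumes "vector_space smul" and hom: "\<And>c x. p (smul c x) = cmod c * p x" and tri: "\<And>x y. p (x + y) \<le> p x + p y"
    and G: "dominated_graph smul p G"
  shows "\<exists>M. dominated_graph smul p M \<and> G \<subseteq> M \<and> (\<forall>x. \<exists>a. (x, a) \<in> M)"
proof -
  let ?A = "{M. dominated_graph smul p M \<and> G \<subseteq> M}"
  have "\<exists>M\<in>?A. \<forall>X\<in>?A. M \<subseteq> X \<longrightarrow> X = M"
  proof (rule subset_Zorn_nonempty)
    show "?A \<noteq> {}" using G by auto
    fix C assume C: "C \<noteq> {}" "subset.chain ?A C"
    then have CA: "dominated_graph smul p M" "G \<subseteq> M" if "M \<in> C" for M
      using that by (auto simp: subset.chain_def)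
    have two: "\<exists>M\<in>C. u \<in> M \<and> v \<in> M" if "u \<in> \<Union>C" "v \<in> \<Union>C" for u v
    proof -
      obtain M1 M2 where M: "M1 \<in> C" "M2 \<in> C" "u \<in> M1" "v \<in> M2" using \<open>u \<in> \<Union>C\<close> \<open>v \<in> \<Union>C\<close> by blast
      then have "M1 \<subseteq> M2 \<or> M2 \<subseteq> M1" using C by (auto simp: subset_chain_def)
      then show ?thesis using M by blast
    qed
    have "dominated_graph smul p (\<Union>C)"
      unfolding dominated_graph_def
    proof (intro conjI allI impI)
      show "(0, 0) \<in> \<Union>C" using C CA unfolding dominated_graph_def by blast
      fix x a assume xa: "(x, a) \<in> \<Union>C"
      then obtain M where M: "M \<in> C" "(x, a) \<in> M" by blast
      show "a \<le> p x" using CA(1)[OF M(1)] M(2) unfolding dominated_graph_def by blast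
      show "(smul (complex_of_real t) x, t * a) \<in> \<Union>C" for t using CA(1)[OF M(1)] M unfolding dominated_graph_def by blast
      fix y b assume "(y, b) \<in> \<Union>C"
      then obtain M' where M': "M' \<in> C" "(x, a) \<in> M'" "(y, b) \<in> M'" using two[OF xa] by blast
      then show "(x + y, a + b) \<in> \<Union>C" using CA(1)[OF M'(1)] unfolding dominated_graph_def by blast
    qed
    moreover have "G \<subseteq> \<Union>C" using C CA by blast
    ultimately show "\<Union>C \<in> ?A" by simp
  qed
  then obtain M where M: "dominated_graph smul p M" "G \<subseteq> M"
    and max: "\<And>X. dominated_graph smul p X \<Longrightarrow> G \<subseteq> X \<Longrightarrow> M \<subseteq> X \<Longrightarrow> X = M" by auto
  have "\<exists>a. (x, a) \<in> M" for x
  proof -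
    obtain M' c where "dominated_graph smul p M'" "M \<subseteq> M'" "(x, c) \<in> M'"
      using dominated_graph_extend[OF assms(1) hom tri M(1), where ?x0.0 = x] by blast
    then show ?thesis using max[of M'] M(2) by blast
  qed
  then show ?thesis using M by blast
qed

text \<open>
  A real functional \<open>u\<close> that is \<open>0\<close> on \<open>M\<close> and \<open>r\<close> at \<open>x0\<close> is dominated by \<open>p\<close> on the span of \<open>M\<close> and
  \<open>x0\<close>.  Its total extension is the real part of the complex functional
  \<open>x \<mapsto> u x - \<i> u (\<i> x)\<close>, which vanishes on \<open>M\<close> as \<open>M\<close> is a complex subspace.
\<close>

lemma separating_functional:
  fixes smul :: "complex \<Rightarrow> 'a::ab_group_add \<Rightarrow> 'a" and p :: "'a \<Rightarrow> real"
  assumes vs: "vector_space smul" and sn: "seminorm smul p" and M: "module.subspace smul M"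
    and r: "0 < r" "\<And>m. m \<in> M \<Longrightarrow> r \<le> p (m - x0)"
  obtains \<xi> :: "'a \<Rightarrow> complex" where "\<And>x y. \<xi> (x + y) = \<xi> x + \<xi> y" "\<And>c x. \<xi> (smul c x) = c * \<xi> x"
    "\<And>x. cmod (\<xi> x) \<le> p x" "\<And>m. m \<in> M \<Longrightarrow> \<xi> m = 0" "\<xi> x0 \<noteq> 0"
proof -
  interpret vector_space smul by fact
  have hom: "p (smul c x) = cmod c * p x" and tri: "p (x + y) \<le> p x + p y" for c x y
    using sn by (auto simp: seminorm_def)
  have zero: "p 0 = 0" using hom[of 0 0] by simp
  have minus: "p (- x) = p x" for x using hom[of "-1" x] by simp
  have nonneg: "0 \<le> p x" for x using tri[of x "- x"] zero minus by simp
  have M0: "0 \<in> M" and Madd: "\<And>x y. x \<in> M \<Longrightarrow> y \<in> M \<Longrightarrow> x + y \<in> M" and Mscale: "\<And>c x. x \<in> M \<Longrightarrow> smul c x \<in> M"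
    using M by (auto simp: subspace_def)
  define G where "G = {(m + smul (complex_of_real t) x0, t * r) | m t. m \<in> M}"
  have "dominated_graph smul p G"
    unfolding dominated_graph_def
  proof (intro conjI allI impI)
    show "(0, 0) \<in> G" unfolding G_def using M0 by (force intro: exI[of _ 0])
    fix x a assume "(x, a) \<in> G"
    then obtain m t where 1: "x = m + smul (complex_of_real t) x0" "a = t * r" "m \<in> M" unfolding G_def by blast
    show "a \<le> p x"
    proof (cases "0 < t")
      case True
      have "r \<le> p (smul (complex_of_real (- 1 / t)) m - x0)" by (intro r Mscale 1)
      then have "t * r \<le> t * p (smul (complex_of_real (- 1 / t)) m - x0)" using True by simp
      also have "\<dots> = p (smul (complex_of_real (- t)) (smul (complex_of_real (- 1 / t)) m - x0))" unfolding hom using True by simp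
      also have "smul (complex_of_real (- t)) (smul (complex_of_real (- 1 / t)) m - x0) = x"
        using True 1 by (simp add: scale_right_diff_distrib)
      finally show ?thesis using 1 by simp
    next
      case False
      then have "t * r \<le> 0" using r(1) by (simp add: mult_nonpos_nonneg)
      then show ?thesis using nonneg[of x] 1 by simp
    qed
    show "(smul (complex_of_real s) x, s * a) \<in> G" for s
    proof -
      have "smul (complex_of_real s) x = smul (complex_of_real s) m + smul (complex_of_real (s * t)) x0" "s * a = (s * t) * r"
        using 1 by (simp_all add: scale_right_distrib)
      then show ?thesis unfolding G_def using Mscale[OF 1(3)] by blast
    qed
    fix y b assume "(y, b) \<in> G"
    then obtain m' s where 2: "y = m' + smul (complex_of_real s) x0" "b = s * r" "m' \<in> M" unfolding G_def by blast
    have "x + y = (m + m') + smul (complex_of_real (t + s)) x0" "a + b = (t + s) * r"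
      using 1 2 by (simp_all add: scale_left_distrib distrib_right)
    then show "(x + y, a + b) \<in> G" unfolding G_def using Madd[OF 1(3) 2(3)] by blast
  qed
  from dominated_graph_total[OF vs hom tri this] obtain H
    where H: "dominated_graph smul p H" "G \<subseteq> H" "\<forall>x. \<exists>a. (x, a) \<in> H" by blast
  have Hadd: "(x + y, a + b) \<in> H" if "(x, a) \<in> H" "(y, b) \<in> H" for x y a b
    using H(1) that unfolding dominated_graph_def by blast
  have Hscale: "(smul (complex_of_real t) x, t * a) \<in> H" if "(x, a) \<in> H" for x a t
    using H(1) that unfolding dominated_graph_def by blast
  have Hdom: "a \<le> p x" if "(x, a) \<in> H" for x a
    using H(1) that unfolding dominated_graph_def by blast
  define u where "u = (\<lambda>x. SOME a. (x, a) \<in> H)"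
  have uH: "(x, u x) \<in> H" for x unfolding u_def by (rule someI_ex) (use H(3) in blast)
  have unique: "a = u x" if "(x, a) \<in> H" for x a
  proof -
    have "(0, t * (a - u x)) \<in> H" for t
      using Hadd[OF Hscale[OF that, of t] Hscale[OF uH[of x], of "- t"]] by (simp add: algebra_simps)
    then have "t * (a - u x) \<le> 0" for t using Hdom zero by metis
    from this[of 1] this[of "-1"] show ?thesis by simp
  qed
  have uadd: "u (x + y) = u x + u y" for x y using unique[OF Hadd[OF uH uH]] by simp
  have uscale: "u (smul (complex_of_real t) x) = t * u x" for t x using unique[OF Hscale[OF uH]] by simp
  have udom: "u x \<le> p x" for x by (rule Hdom[OF uH])
  have uM: "u m = 0" if "m \<in> M" for m
  proof -
    have "(m, 0) \<in> G" unfolding G_def using that by (force intro: exI[of _ 0])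
    then show ?thesis using unique[of m 0] H(2) by auto
  qed
  have ux0: "u x0 = r"
  proof -
    have "(x0, r) \<in> G" unfolding G_def using M0 by (force intro: exI[of _ 1])
    then show ?thesis using unique[of x0 r] H(2) by auto
  qed
  define \<xi> where "\<xi> = (\<lambda>x. Complex (u x) (- u (smul \<i> x)))"
  have xadd: "\<xi> (x + y) = \<xi> x + \<xi> y" for x y
    by (simp add: \<xi>_def complex_eq_iff uadd scale_right_distrib)
  have xscale: "\<xi> (smul c x) = c * \<xi> x" for c x
  proof -
    have "smul c x = smul (complex_of_real (Re c)) x + smul (complex_of_real (Im c)) (smul \<i> x)"
      by (simp add: complex_eq_iff flip: scale_left_distrib)
    moreover have "\<i> * c = complex_of_real (Re c) * \<i> + complex_of_real (- Im c)"
      by (simp add: complex_eq_iff)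
    then have "smul \<i> (smul c x) = smul (complex_of_real (Re c)) (smul \<i> x) + smul (complex_of_real (- Im c)) x"
      by (simp only: scale_scale scale_left_distrib)
    ultimately show ?thesis
      by (simp only: \<xi>_def uadd uscale complex_eq_iff) simp
  qed
  show ?thesis
  proof (rule that[of \<xi>])
    show "cmod (\<xi> x) \<le> p x" for x
    proof (cases "\<xi> x = 0")
      case False
      \<comment> \<open>Rotating \<open>x\<close> makes the value of the functional real, so that its real part \<open>u\<close> bounds it.\<close>
      define w where "w = cnj (\<xi> x) / cmod (\<xi> x)"
      have "\<xi> (smul w x) = complex_of_real (cmod (\<xi> x))"
        using False by (simp add: xscale w_def complex_norm_square[symmetric] mult.commute power2_eq_square)
      then have "cmod (\<xi> x) = u (smul w x)" by (simp add: \<xi>_def complex_eq_iff)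
      also have "\<dots> \<le> p (smul w x)" by (rule udom)
      also have "\<dots> = p x" using False by (simp add: hom w_def norm_divide)
      finally show ?thesis .
    qed (use nonneg in simp)
    show "\<xi> m = 0" if "m \<in> M" for m using uM[OF that] uM[OF Mscale[OF that]] by (simp add: \<xi>_def complex_eq_iff)
    show "\<xi> x0 \<noteq> 0" using ux0 r(1) by (simp add: \<xi>_def complex_eq_iff)
  qed (fact xadd xscale)+
qed

section \<open>Equicontinuity of the partial sums of a Schauder basis\<close>

lemma tendsto_zero_le:
  fixes f g :: "nat \<Rightarrow> real"
  assumes "f \<longlonglongrightarrow> 0" "\<And>n. 0 \<le> g n" "\<And>n. g n \<le> f n"
  shows "g \<longlonglongrightarrow> 0"
  by (rule tendsto_sandwich[of "\<lambda>_. 0" g sequentially f]) (simp_all add: assms)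

context frechet_space
begin

text \<open>
  Baire's theorem in terms of seminorms.  If no \<open>A n\<close> were dense in a ball, then every ball would
  contain a ball that misses \<open>A n\<close>, and the centres of a decreasing sequence of such balls would
  converge to a point outside the whole cover.
\<close>

lemma baire_cover:
  assumes cover: "\<And>x. \<exists>n::nat. x \<in> A n"
  shows "\<exists>n x0 j r. 0 < r \<and> (\<forall>x l \<eta>. q j (x - x0) < r \<longrightarrow> 0 < \<eta> \<longrightarrow> (\<exists>a\<in>A n. q l (x - a) < \<eta>))"
proof (rule ccontr)
  assume no: "\<not> ?thesis"
  have hole: "\<exists>x l \<eta>. q j (x - x0) < r \<and> 0 < \<eta> \<and> (\<forall>a\<in>A n. \<eta> \<le> q l (x - a))" if "0 < r" for n x0 j r
  proof (rule ccontr)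
    assume "\<not> ?thesis"
    then have "\<forall>x l \<eta>. q j (x - x0) < r \<longrightarrow> 0 < \<eta> \<longrightarrow> (\<exists>a\<in>A n. q l (x - a) < \<eta>)" by (meson not_le)
    then show False using no that by blast
  qed
  \<comment> \<open>A state is a ball, given by its centre, the index of its seminorm and its radius.\<close>
  define good where "good n s \<longleftrightarrow> (case s of (x :: 'a, j, r :: real) \<Rightarrow> 0 < r \<and> n \<le> j \<and> r \<le> 1 / (real n + 1))" for n :: nat and s
  define inner where "inner n s s' \<longleftrightarrow> (case (s, s') of ((x, j, r), (x', j', r')) \<Rightarrow>
      j \<le> j' \<and> q j (x' - x) + r' \<le> r \<and> (\<forall>a\<in>A n. 2 * r' \<le> q j' (x' - a)))" for n s s'
  have "\<exists>f. \<forall>n. good n (f n) \<and> inner n (f n) (f (Suc n))"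
  proof (rule dependent_nat_choice)
    show "\<exists>s. good 0 s" by (intro exI[of _ "(0, 0, 1)"]) (simp add: good_def)
    fix s n assume s: "good n s"
    obtain x j r where sx: "s = (x, j, r)" by (cases s)
    have r: "0 < r" "n \<le> j" using s sx by (auto simp: good_def)
    obtain x' l \<eta> where h: "q j (x' - x) < r" "0 < \<eta>" "\<forall>a\<in>A n. \<eta> \<le> q l (x' - a)" using hole[OF r(1)] by blast
    define j' where "j' = max (Suc n) (max j l)"
    define r' where "r' = min (1 / (real (Suc n) + 1)) (min (\<eta> / 2) (r - q j (x' - x)))"
    have "0 < r'" using h by (simp add: r'_def)
    moreover have "r' \<le> 1 / (real (Suc n) + 1)" "r' \<le> \<eta> / 2" "r' \<le> r - q j (x' - x)"
      unfolding r'_def by (simp_all only: min_le_iff_disj order.refl simp_thms)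
    then have "r' \<le> 1 / (real (Suc n) + 1)" "2 * r' \<le> \<eta>" "q j (x' - x) + r' \<le> r" by linarith+
    moreover have "\<eta> \<le> q j' (x' - a)" if "a \<in> A n" for a
      using h(3) that mono_seminorms[of l j' "x' - a"] by (force simp: j'_def)
    ultimately show "\<exists>s'. good (Suc n) s' \<and> inner n s s'"
      by (intro exI[of _ "(x', j', r')"]) (auto simp: sx j'_def good_def inner_def intro: order.trans)
  qed
  then obtain f where f: "\<And>n. good n (f n)" "\<And>n. inner n (f n) (f (Suc n))" by blast
  define x where "x n = fst (f n)" for n
  define j where "j n = fst (snd (f n))" for n
  define r where "r n = snd (snd (f n))" for n
  have fr: "f n = (x n, j n, r n)" for n by (simp add: x_def j_def r_def)
  have r: "0 < r n" "n \<le> j n" "r n \<le> 1 / (real n + 1)" for n using f(1)[of n] by (auto simp: good_def fr)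
  have step: "j n \<le> j (Suc n)" "q (j n) (x (Suc n) - x n) + r (Suc n) \<le> r n" for n using f(2)[of n] by (auto simp: inner_def fr)
  have avoid: "2 * r (Suc n) \<le> q (j (Suc n)) (x (Suc n) - a)" if "a \<in> A n" for n a using f(2)[of n] that by (auto simp: inner_def fr)
  have jmono: "j n \<le> j m" if "n \<le> m" for n m using lift_Suc_mono_le[of j, OF step(1) that] .
  have nested: "q (j n) (x m - x n) + r m \<le> r n" if "n \<le> m" for n m
    using that
  proof (induction m rule: dec_induct)
    case (step m)
    have "q (j n) (x (Suc m) - x n) \<le> q (j n) (x (Suc m) - x m) + q (j n) (x m - x n)" by (rule q_triangle_diff)
    moreover have "q (j n) (x (Suc m) - x m) \<le> q (j m) (x (Suc m) - x m)" using step by (intro mono_seminorms jmono) auto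
    ultimately show ?case using step.IH \<open>\<And>n. q (j n) (x (Suc n) - x n) + r (Suc n) \<le> r n\<close>[of m] by linarith
  qed simp
  have near: "q (j n) (x m - x n) \<le> r n" if "n \<le> m" for n m using nested[OF that] r(1)[of m] by linarith
  obtain l where l: "\<And>i. (\<lambda>n. q i (x n - l)) \<longlonglongrightarrow> 0"
  proof (rule Cauchy_limit[of x])
    fix i and s :: real assume s: "0 < s"
    obtain n0 :: nat where n0: "2 / s < real n0" using reals_Archimedean2 by blast
    define n where "n = max n0 i"
    have "2 / s < real n + 1" using n0 by (simp add: n_def)
    then have "2 * (1 / (real n + 1)) < s" using s by (simp add: field_simps)
    then have rn: "2 * r n < s" using r(3)[of n] by linarith
    show "\<exists>N. \<forall>m\<ge>N. \<forall>n\<ge>N. q i (x m - x n) < s"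
    proof (intro exI[of _ n] allI impI)
      fix m m' assume m: "n \<le> m" "n \<le> m'"
      have "q i (x m - x m') \<le> q (j n) (x m - x m')" using r(2)[of n] by (intro mono_seminorms) (simp add: n_def)
      also have "\<dots> \<le> q (j n) (x m - x n) + q (j n) (x n - x m')" by (rule q_triangle_diff)
      also have "\<dots> \<le> r n + r n" using near[OF m(1)] near[OF m(2)] q_diff_commute[of "j n" "x n"] by simp
      finally show "q i (x m - x m') < s" using rn by linarith
    qed
  qed (rule that)
  have ln: "q (j n) (l - x n) \<le> r n" for n
  proof (rule q_limit_le[OF l])
    show "eventually (\<lambda>m. q (j n) (x m - x n) \<le> r n) sequentially"
      using eventually_ge_at_top[of n] by eventually_elim (rule near)
  qed
  obtain n where "l \<in> A n" using cover by blast
  from avoid[OF this] ln[of "Suc n"] r(1)[of "Suc n"] show False by (simp add: q_diff_commute)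
qed

end

locale schauder_space = frechet_space smul q
  for smul :: "complex \<Rightarrow> 'a::ab_group_add \<Rightarrow> 'a" and q +
  fixes N :: enat and e :: "nat \<Rightarrow> 'a"
  assumes basis: "schauder_basis smul q N e"
begin

definition coef :: "'a \<Rightarrow> nat \<Rightarrow> complex" where
  "coef x = (THE a. (\<forall>n. N \<le> enat n \<longrightarrow> a n = 0) \<and>
        limitin (seminorm_topology q) (\<lambda>m. \<Sum>n<m. smul (a n) (e n)) x sequentially)"

definition partial :: "nat \<Rightarrow> 'a \<Rightarrow> 'a" where "partial m x = (\<Sum>n<m. smul (coef x n) (e n))"

lemma coef_ex1: "\<exists>!a. (\<forall>n. N \<le> enat n \<longrightarrow> a n = 0) \<and>
        limitin (seminorm_topology q) (\<lambda>m. \<Sum>n<m. smul (a n) (e n)) x sequentially"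
  using basis unfolding schauder_basis_def by blast

lemma coef_beyond: "N \<le> enat n \<Longrightarrow> coef x n = 0"
  and partial_tendsto: "(\<lambda>m. q j (partial m x - x)) \<longlonglongrightarrow> 0"
  using theI'[OF coef_ex1[of x], folded coef_def] unfolding limitin_iff partial_def by auto

lemma coef_eqI:
  assumes "\<And>n. N \<le> enat n \<Longrightarrow> a n = 0" "\<And>j. (\<lambda>m. q j ((\<Sum>n<m. smul (a n) (e n)) - x)) \<longlonglongrightarrow> 0"
  shows "coef x = a"
  unfolding coef_def by (rule the1_equality[OF coef_ex1]) (use assms in \<open>auto simp: limitin_iff\<close>)

lemma coef_add: "coef (x + y) = (\<lambda>n. coef x n + coef y n)"
proof (rule coef_eqI)
  fix j
  have lim: "(\<lambda>m. q j (partial m x - x) + q j (partial m y - y)) \<longlonglongrightarrow> 0"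
    using tendsto_add[OF partial_tendsto[of j x] partial_tendsto[of j y]] by simp
  have le: "q j ((\<Sum>n<m. smul (coef x n + coef y n) (e n)) - (x + y)) \<le> q j (partial m x - x) + q j (partial m y - y)" for m
    using q_triangle[of j "partial m x - x" "partial m y - y"] by (simp add: partial_def scale_left_distrib sum.distrib algebra_simps)
  show "(\<lambda>m. q j ((\<Sum>n<m. smul (coef x n + coef y n) (e n)) - (x + y))) \<longlonglongrightarrow> 0"
    by (rule tendsto_zero_le[OF lim q_nonneg le])
qed (simp add: coef_beyond)

lemma coef_scale: "coef (smul c x) = (\<lambda>n. c * coef x n)"
proof (rule coef_eqI)
  fix j
  have "(\<lambda>m. cmod c * q j (partial m x - x)) \<longlonglongrightarrow> cmod c * 0" by (intro tendsto_mult tendsto_const partial_tendsto)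
  moreover have "(\<Sum>n<m. smul (c * coef x n) (e n)) - smul c x = smul c (partial m x - x)" for m
    by (simp add: partial_def scale_sum_right scale_right_diff_distrib)
  ultimately show "(\<lambda>m. q j ((\<Sum>n<m. smul (c * coef x n) (e n)) - smul c x)) \<longlonglongrightarrow> 0" by (simp add: q_smul)
qed (simp add: coef_beyond)

lemma coef_minus: "coef (- x) n = - coef x n"
  using coef_scale[of "-1" x] by simp

lemma coef_diff: "coef (x - y) n = coef x n - coef y n"
  using coef_add[of x "- y"] by (simp add: coef_minus)

lemma coef_0: "coef 0 n = 0"
  using coef_scale[of 0 0] by simp

lemma partial_diff: "partial m (x - y) = partial m x - partial m y"
  by (simp add: partial_def coef_diff scale_left_diff_distrib sum_subtractf)

lemma partial_scale: "partial m (smul c x) = smul c (partial m x)"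
  by (simp add: partial_def coef_scale scale_sum_right)

lemma partial_0: "partial m 0 = 0" by (simp add: partial_def coef_0)

lemma coef_basis: "enat n < N \<Longrightarrow> coef (e n) = (\<lambda>m. if m = n then 1 else 0)"
proof (rule coef_eqI)
  fix j
  have "eventually (\<lambda>m. q j ((\<Sum>k<m. smul (if k = n then 1 else 0) (e k)) - e n) = 0) sequentially"
    using eventually_gt_at_top[of n]
  proof eventually_elim
    case (elim m)
    have "(\<Sum>k<m. smul (if k = n then 1 else 0) (e k)) = (\<Sum>k\<in>{n}. smul (if k = n then 1 else 0) (e k))"
      by (rule sum.mono_neutral_right) (use elim in auto)
    then show ?case by simp
  qed
  then show "(\<lambda>m. q j ((\<Sum>k<m. smul (if k = n then 1 else 0) (e k)) - e n)) \<longlonglongrightarrow> 0"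
    by (rule tendsto_eventually)
qed auto

lemma basis_nonzero: "enat n < N \<Longrightarrow> e n \<noteq> 0"
  using coef_basis[of n] coef_0[of n] by (metis zero_neq_one)

lemma eq_0_if_coef_0: "(\<And>n. coef x n = 0) \<Longrightarrow> x = 0"
proof -
  assume "\<And>n. coef x n = 0"
  then have "partial m x = 0" for m by (simp add: partial_def)
  then have "(\<lambda>m. q j x) \<longlonglongrightarrow> 0" for j using partial_tendsto[of j x] by simp
  then have "q j x = 0" for j using LIMSEQ_const_iff by blast
  then show "x = 0" by (rule separating)
qed

lemma partial_bounded: "\<exists>n::nat. \<forall>m. q j (partial m x) \<le> real n"
proof -
  have "Bseq (\<lambda>m. q j (partial m x - x))" using partial_tendsto convergent_imp_Bseq convergentI by blast
  then obtain K where K: "\<And>m. norm (q j (partial m x - x)) \<le> K" unfolding Bseq_def by auto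
  obtain n :: nat where n: "K + q j x < real n" using reals_Archimedean2 by blast
  have "q j (partial m x) \<le> real n" for m
    using q_triangle[of j "partial m x - x" x] K[of m] n by simp
  then show ?thesis by blast
qed

text \<open>
  Completeness of the space for the larger seminorms \<open>sup\<^sub>m q\<^sub>j (partial m x)\<close>.  For a sequence that is
  Cauchy for them the coefficients converge, uniformly in the sense of partial sums, and the series
  with the limit coefficients converges to the limit of the sequence.  By uniqueness these are the
  coefficients of the limit.
\<close>

lemma partial_converges:
  assumes lim: "\<And>j. (\<lambda>i. q j (u i - x)) \<longlonglongrightarrow> 0"
    and C: "\<And>j r. 0 < r \<Longrightarrow> \<exists>n0. \<forall>i\<ge>n0. \<forall>i'\<ge>n0. \<forall>m. q j (partial m (u i' - u i)) \<le> r"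
  shows "(\<lambda>i. q j (partial m (u i) - partial m x)) \<longlonglongrightarrow> 0"
proof -
  have "\<exists>b. (\<lambda>i. coef (u i) n) \<longlonglongrightarrow> b" for n
  proof (cases "enat n < N")
    case True
    then obtain j where j: "q j (e n) \<noteq> 0" using separating basis_nonzero by blast
    then have j: "0 < q j (e n)" by (simp add: less_le)
    have "Cauchy (\<lambda>i. coef (u i) n)"
    proof (rule metric_CauchyI)
      fix s :: real assume s: "0 < s"
      obtain n0 where n0: "\<And>i i' m. i \<ge> n0 \<Longrightarrow> i' \<ge> n0 \<Longrightarrow> q j (partial m (u i' - u i)) \<le> s * q j (e n) / 4"
        using C[of "s * q j (e n) / 4" j] s j by auto
      show "\<exists>M. \<forall>i\<ge>M. \<forall>i'\<ge>M. dist (coef (u i) n) (coef (u i') n) < s"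
      proof (intro exI[of _ n0] allI impI)
        fix i i' assume i: "n0 \<le> i" "n0 \<le> i'"
        have "smul (coef (u i - u i') n) (e n) = partial (Suc n) (u i - u i') - partial n (u i - u i')"
          by (simp add: partial_def)
        then have "cmod (coef (u i - u i') n) * q j (e n) \<le> q j (partial (Suc n) (u i - u i')) + q j (partial n (u i - u i'))"
          by (metis q_smul q_diff_le)
        also have "\<dots> \<le> s * q j (e n) / 4 + s * q j (e n) / 4" by (intro add_mono n0 i)
        also have "\<dots> < s * q j (e n)" using s j by simp
        finally show "dist (coef (u i) n) (coef (u i') n) < s" using j by (simp add: dist_norm coef_diff)
      qed
    qed
    then show ?thesis using Cauchy_convergent convergent_def by blast
  next
    case False
    then show ?thesis by (auto simp: coef_beyond)
  qed
  then obtain b where b: "\<And>n. (\<lambda>i. coef (u i) n) \<longlonglongrightarrow> b n" by metis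
  define B where "B m = (\<Sum>n<m. smul (b n) (e n))" for m
  have uB: "(\<lambda>i. q j (partial m (u i) - B m)) \<longlonglongrightarrow> 0" for m j
  proof -
    have "(\<lambda>i. cmod (coef (u i) n - b n)) \<longlonglongrightarrow> 0" for n by (rule tendsto_norm_zero[OF LIM_zero[OF b]])
    then have "(\<lambda>i. \<Sum>n<m. cmod (coef (u i) n - b n) * q j (e n)) \<longlonglongrightarrow> (\<Sum>n<m. 0 * q j (e n))"
      by (intro tendsto_sum tendsto_mult tendsto_const)
    then have lim: "(\<lambda>i. \<Sum>n<m. cmod (coef (u i) n - b n) * q j (e n)) \<longlonglongrightarrow> 0" by simp
    have le: "q j (partial m (u i) - B m) \<le> (\<Sum>n<m. cmod (coef (u i) n - b n) * q j (e n))" for i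
    proof -
      have "partial m (u i) - B m = (\<Sum>n<m. smul (coef (u i) n - b n) (e n))"
        by (simp add: partial_def B_def scale_left_diff_distrib sum_subtractf)
      then show ?thesis using q_sum_le[of j "\<lambda>n. smul (coef (u i) n - b n) (e n)" "{..<m}"] by (simp add: q_smul)
    qed
    show ?thesis by (rule tendsto_zero_le[OF lim q_nonneg le])
  qed
  have unif: "\<exists>n0. \<forall>i\<ge>n0. \<forall>m. q j (B m - partial m (u i)) \<le> r" if r: "0 < r" for j r
  proof -
    obtain n0 where n0: "\<And>i i' m. i \<ge> n0 \<Longrightarrow> i' \<ge> n0 \<Longrightarrow> q j (partial m (u i' - u i)) \<le> r" using C[OF r] by blast
    have "q j (B m - partial m (u i)) \<le> r" if "i \<ge> n0" for i m
    proof (rule q_limit_le[OF uB])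
      show "eventually (\<lambda>i'. q j (partial m (u i') - partial m (u i)) \<le> r) sequentially"
        using eventually_ge_at_top[of n0] by eventually_elim (use n0 that in \<open>simp add: partial_diff\<close>)
    qed
    then show ?thesis by blast
  qed
  have "coef x = b"
  proof (rule coef_eqI)
    show "b n = 0" if "N \<le> enat n" for n
      using b[of n] that by (simp add: coef_beyond LIMSEQ_const_iff)
    fix j
    show "(\<lambda>m. q j ((\<Sum>n<m. smul (b n) (e n)) - x)) \<longlonglongrightarrow> 0"
      unfolding B_def[symmetric]
    proof (rule tendstoI)
      fix s :: real assume s: "0 < s"
      obtain n0 where n0: "\<And>i m. i \<ge> n0 \<Longrightarrow> q j (B m - partial m (u i)) \<le> s / 4" using unif[of "s / 4" j] s by auto
      have "eventually (\<lambda>i. dist (q j (u i - x)) 0 < s / 4) sequentially" using lim s by (intro tendstoD) auto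
      then obtain M where M: "\<And>i. i \<ge> M \<Longrightarrow> dist (q j (u i - x)) 0 < s / 4" unfolding eventually_sequentially by blast
      define i where "i = max M n0"
      have i: "i \<ge> n0" "q j (u i - x) < s / 4" using M[of i] by (simp_all add: i_def)
      have "eventually (\<lambda>m. dist (q j (partial m (u i) - u i)) 0 < s / 4) sequentially" using partial_tendsto s by (intro tendstoD) auto
      then show "eventually (\<lambda>m. dist (q j (B m - x)) 0 < s) sequentially"
      proof eventually_elim
        case (elim m)
        have "q j (B m - x) \<le> q j (B m - partial m (u i)) + q j (partial m (u i) - x)" by (rule q_triangle_diff)
        also have "q j (partial m (u i) - x) \<le> q j (partial m (u i) - u i) + q j (u i - x)" by (rule q_triangle_diff)
        finally have "q j (B m - x) \<le> q j (B m - partial m (u i)) + (q j (partial m (u i) - u i) + q j (u i - x))" by simp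
        then show ?case using n0[OF i(1), of m] i(2) elim s by simp
      qed
    qed
  qed
  then have "B m = partial m x" for m by (simp add: B_def partial_def)
  then show ?thesis using uB by simp
qed

text \<open>
  The vectors whose partial sums are bounded by \<open>n\<close> in \<open>q\<^sub>j\<close> cover the space, so one of these sets is
  dense in a ball.  Differences of such vectors are dense in a ball around \<open>0\<close>, and scaling does the
  rest.
\<close>

lemma approximation:
  "\<exists>k C. 0 < C \<and> (\<forall>x \<rho> l \<eta>. q k x < \<rho> \<longrightarrow> 0 < \<eta> \<longrightarrow> (\<exists>a. (\<forall>m. q j (partial m a) \<le> C * \<rho>) \<and> q l (x - a) < \<eta>))"
proof -
  obtain n x0 k r where r: "0 < r" and dense: "\<And>x l \<eta>. q k (x - x0) < r \<Longrightarrow> 0 < \<eta> \<Longrightarrow> \<exists>a\<in>{x. \<forall>m. q j (partial m x) \<le> real n}. q l (x - a) < \<eta>"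
    using baire_cover[of "\<lambda>n. {x. \<forall>m. q j (partial m x) \<le> real n}"] partial_bounded by blast
  define C where "C = 2 * real n / r + 1"
  have C: "0 < C" using r by (simp add: C_def add_nonneg_pos)
  have "\<exists>a. (\<forall>m. q j (partial m a) \<le> C * \<rho>) \<and> q l (x - a) < \<eta>" if x: "q k x < \<rho>" and \<eta>: "0 < \<eta>" for x \<rho> l \<eta>
  proof -
    have \<rho>: "0 < \<rho>" using x q_nonneg[of k x] by linarith
    define t where "t = r / \<rho>"
    have t: "0 < t" using r \<rho> by (simp add: t_def)
    define y where "y = smul (complex_of_real t) x"
    have "q k y = t * q k x" using t by (simp add: y_def q_smul)
    also have "\<dots> < t * \<rho>" using x t by simp
    finally have "q k ((x0 + y) - x0) < r" using \<rho> by (simp add: t_def)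
    then obtain a1 where a1: "\<And>m. q j (partial m a1) \<le> real n" "q l (x0 + y - a1) < t * \<eta> / 2"
      using dense[of "x0 + y" "t * \<eta> / 2" l] t \<eta> by auto
    obtain a2 where a2: "\<And>m. q j (partial m a2) \<le> real n" "q l (x0 - a2) < t * \<eta> / 2"
      using dense[of x0 "t * \<eta> / 2" l] t \<eta> r by auto
    define a where "a = smul (complex_of_real (1 / t)) (a1 - a2)"
    have "q j (partial m a) \<le> C * \<rho>" for m
    proof -
      have "q j (partial m a) = 1 / t * q j (partial m a1 - partial m a2)"
        unfolding a_def partial_scale partial_diff q_smul using t by (simp add: norm_divide)
      also have "\<dots> \<le> 1 / t * (real n + real n)"
        using a1(1)[of m] a2(1)[of m] q_diff_le[of j "partial m a1" "partial m a2"] t by (intro mult_left_mono) auto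
      also have "\<dots> = (2 * real n / r) * \<rho>" by (simp add: t_def)
      also have "\<dots> \<le> C * \<rho>" using \<rho> by (intro mult_right_mono) (auto simp: C_def)
      finally show ?thesis .
    qed
    moreover have "q l (x - a) < \<eta>"
    proof -
      have xa: "x - a = smul (complex_of_real (1 / t)) (y - (a1 - a2))"
        using t by (simp add: a_def y_def scale_right_diff_distrib)
      have "q l (x - a) = 1 / t * q l (y - (a1 - a2))" unfolding xa q_smul using t by (simp add: norm_divide)
      moreover have diff: "y - (a1 - a2) = (x0 + y - a1) - (x0 - a2)" by simp
      have "q l (y - (a1 - a2)) < t * \<eta>"
        unfolding diff using q_diff_le[of l "x0 + y - a1" "x0 - a2"] a1(2) a2(2) by linarith
      then have "1 / t * q l (y - (a1 - a2)) < 1 / t * (t * \<eta>)" using t by (intro mult_strict_left_mono) auto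
      ultimately show ?thesis using t by simp
    qed
    ultimately show ?thesis by blast
  qed
  then show ?thesis using C by blast
qed

text \<open>
  The second half of the open mapping theorem.  A vector \<open>x\<close> in the unit ball is written as a series
  of vectors \<open>y i - y (Suc i)\<close> with small partial sums, where \<open>y i\<close> is the remainder after \<open>i\<close> steps of
  approximation; completeness for the larger seminorms transfers the bounds to \<open>x\<close>.
\<close>

lemma partial_equicontinuous: "\<exists>k C. \<forall>x m. q j (partial m x) \<le> C * q k x"
proof -
  obtain k C where C: "\<And>j. 0 < C j"
    and approx: "\<And>j x \<rho> l \<eta>. q (k j) x < \<rho> \<Longrightarrow> 0 < \<eta> \<Longrightarrow> \<exists>a. (\<forall>m. q j (partial m a) \<le> C j * \<rho>) \<and> q l (x - a) < \<eta>"
    using approximation by metis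
  have unit: "q j (partial m x) \<le> C j + 1" if x: "q (k j) x < 1" for x m
  proof -
    define \<rho> where "\<rho> i = (if i = 0 then 1 else 1 / (2 ^ i * C (j + i)))" for i :: nat
    have \<rho>: "0 < \<rho> i" for i using C by (simp add: \<rho>_def)
    \<comment> \<open>The radii shrink with the constants of the next step, so that the \<open>i\<close>-th summand has
        partial sums of size \<open>1 / 2 ^ i\<close>.\<close>
    define small where "small i z \<longleftrightarrow> q (k (j + i)) z < \<rho> i \<and> (i = 0 \<longrightarrow> z = x)" for i z
    define cut where "cut i z z' \<longleftrightarrow> (\<forall>m. q (j + i) (partial m (z - z')) \<le> C (j + i) * \<rho> i) \<and> q (Suc i) z' < 1 / 2 ^ i" for i z z'
    have "\<exists>y. \<forall>i. small i (y i) \<and> cut i (y i) (y (Suc i))"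
    proof (rule dependent_nat_choice)
      show "\<exists>y. small 0 y" using x by (simp add: small_def \<rho>_def)
      fix y i assume "small i y"
      then have y: "q (k (j + i)) y < \<rho> i" by (simp add: small_def)
      have "0 < min (\<rho> (Suc i)) (1 / 2 ^ i)" using \<rho> by simp
      from approx[OF y this, of "max (k (j + Suc i)) (Suc i)"] obtain a where a: "\<And>m. q (j + i) (partial m a) \<le> C (j + i) * \<rho> i"
        "q (max (k (j + Suc i)) (Suc i)) (y - a) < min (\<rho> (Suc i)) (1 / 2 ^ i)" by blast
      have "q (k (j + Suc i)) (y - a) < \<rho> (Suc i)" "q (Suc i) (y - a) < 1 / 2 ^ i"
        using a(2) mono_seminorms[of "k (j + Suc i)" "max (k (j + Suc i)) (Suc i)" "y - a"]
          mono_seminorms[of "Suc i" "max (k (j + Suc i)) (Suc i)" "y - a"] by simp_all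
      then show "\<exists>y'. small (Suc i) y' \<and> cut i y y'"
        using a(1) by (intro exI[of _ "y - a"]) (simp add: small_def cut_def)
    qed
    then obtain y where y: "\<And>i. small i (y i)" "\<And>i. cut i (y i) (y (Suc i))" by blast
    have y0: "y 0 = x" using y(1)[of 0] by (simp add: small_def)
    have yS: "q (j + i) (partial m (y i - y (Suc i))) \<le> C (j + i) * \<rho> i"
      and ysmall: "q (Suc i) (y (Suc i)) < 1 / 2 ^ i" for i m using y(2)[of i] by (simp_all add: cut_def)
    define u where "u i = x - y i" for i
    have lim: "(\<lambda>i. q l (u i - x)) \<longlonglongrightarrow> 0" for l
    proof (rule LIMSEQ_offset[of _ 1], rule tendsto_sandwich[of "\<lambda>_. 0"])
      show "eventually (\<lambda>i. q l (u (i + 1) - x) \<le> (1 / 2) ^ i) sequentially"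
        using eventually_ge_at_top[of l]
      proof eventually_elim
        case (elim i)
        have "q l (u (i + 1) - x) = q l (y (Suc i))" by (simp add: u_def)
        also have "\<dots> \<le> q (Suc i) (y (Suc i))" using elim by (intro mono_seminorms) simp
        also have "\<dots> \<le> (1 / 2) ^ i" using ysmall[of i] by (simp add: power_one_over)
        finally show ?case .
      qed
      show "(\<lambda>i. (1 / 2 :: real) ^ i) \<longlonglongrightarrow> 0" by (rule LIMSEQ_power_zero) simp
    qed simp_all
    have dist: "q j' (partial m (u i' - u i)) \<le> 2 / 2 ^ i - 2 / 2 ^ i'" if i: "1 \<le> i" "i \<le> i'" and j': "j' \<le> j + i" for i i' j' m
      using i(2)
    proof (induction i' rule: dec_induct)
      case base
      then show ?case by (simp add: partial_0)
    next
      case (step t)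
      have t: "1 \<le> t" using step i by simp
      have "partial m (u (Suc t) - u i) = partial m (y t - y (Suc t)) + partial m (u t - u i)"
        by (simp add: u_def partial_diff)
      then have "q j' (partial m (u (Suc t) - u i)) \<le> q j' (partial m (y t - y (Suc t))) + q j' (partial m (u t - u i))"
        by (simp add: q_triangle)
      also have "q j' (partial m (y t - y (Suc t))) \<le> q (j + t) (partial m (y t - y (Suc t)))"
        using j' step by (intro mono_seminorms) simp
      also have "\<dots> \<le> C (j + t) * \<rho> t" by (rule yS)
      also have "\<dots> = 1 / 2 ^ t" using t C[of "j + t"] by (simp add: \<rho>_def)
      finally show ?case using step.IH by simp
    qed
    have "(\<lambda>i. q j (partial m (u i) - partial m x)) \<longlonglongrightarrow> 0"
    proof (rule partial_converges[OF lim])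
      fix j' and r :: real assume r: "0 < r"
      obtain n1 where n1: "(1 / 2) ^ n1 < r / 2" using real_arch_pow_inv[of "r / 2" "1 / 2"] r by auto
      define n0 where "n0 = max (Suc n1) j'"
      have small: "2 / 2 ^ i \<le> r" if "i \<ge> n0" for i
      proof -
        have "(1 / 2 :: real) ^ i \<le> (1 / 2) ^ n1" using that by (intro power_decreasing) (auto simp: n0_def)
        then show ?thesis using n1 by (simp add: power_one_over)
      qed
      have half: "q j' (partial m (u i' - u i)) \<le> r" if "n0 \<le> i" "i \<le> i'" for i i' m
      proof -
        have "q j' (partial m (u i' - u i)) \<le> 2 / 2 ^ i - 2 / 2 ^ i'" using that by (intro dist) (auto simp: n0_def)
        also have "\<dots> \<le> r" using small[OF that(1)] by (smt (verit) divide_nonneg_nonneg zero_le_power)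
        finally show ?thesis .
      qed
      show "\<exists>n0. \<forall>i\<ge>n0. \<forall>i'\<ge>n0. \<forall>m. q j' (partial m (u i' - u i)) \<le> r"
      proof (intro exI[of _ n0] allI impI)
        fix i i' m assume "n0 \<le> i" "n0 \<le> i'"
        then show "q j' (partial m (u i' - u i)) \<le> r"
          using half[of i i' m] half[of i' i m] by (cases "i \<le> i'") (auto simp: partial_diff q_diff_commute)
      qed
    qed
    moreover have "q j (partial m (u i) - 0) \<le> C j + 1" if "1 \<le> i" for i
    proof -
      have "partial m (u i) = partial m (y 0 - y 1) + partial m (u i - u 1)" by (simp add: u_def partial_diff y0)
      then have "q j (partial m (u i)) \<le> q j (partial m (y 0 - y 1)) + q j (partial m (u i - u 1))" by (simp add: q_triangle)
      moreover have "q j (partial m (y 0 - y 1)) \<le> C j" using yS[of 0 m] by (simp add: \<rho>_def)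
      moreover have "q j (partial m (u i - u 1)) \<le> 1"
        by (rule order.trans[OF dist[of 1 i j m]]) (use that in auto)
      ultimately show ?thesis by simp
    qed
    ultimately have "q j (partial m x - 0) \<le> C j + 1"
      by (intro q_limit_le) (auto intro: eventually_mono[OF eventually_ge_at_top[of 1]])
    then show ?thesis by simp
  qed
  have "q j (partial m x) \<le> (C j + 1) * q (k j) x" for x m
  proof (rule field_le_epsilon)
    fix \<epsilon> :: real assume \<epsilon>: "0 < \<epsilon>"
    define t where "t = q (k j) x + \<epsilon> / (C j + 1)"
    have Cj: "0 < C j + 1" using C[of j] by simp
    have t: "q (k j) x < t" using \<epsilon> Cj by (simp add: t_def)
    then have t0: "0 < t" using q_nonneg[of "k j" x] by linarith
    have "q (k j) (smul (complex_of_real (1 / t)) x) < 1" unfolding q_smul using t t0 by (simp add: norm_divide)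
    then have "q j (partial m (smul (complex_of_real (1 / t)) x)) \<le> C j + 1" by (rule unit)
    then have "q j (partial m x) \<le> (C j + 1) * t" unfolding partial_scale q_smul using t0 by (simp add: norm_divide field_simps)
    also have "\<dots> = (C j + 1) * q (k j) x + \<epsilon>" using Cj by (simp add: t_def distrib_left)
    finally show "q j (partial m x) \<le> (C j + 1) * q (k j) x + \<epsilon>" .
  qed
  then show ?thesis by blast
qed

lemma coef_equicontinuous: "\<exists>k C. \<forall>x n. cmod (coef x n) * q j (e n) \<le> C * q k x"
proof -
  obtain k C where C: "\<And>x m. q j (partial m x) \<le> C * q k x" using partial_equicontinuous by blast
  have "cmod (coef x n) * q j (e n) \<le> (2 * C) * q k x" for x n
  proof -
    have "smul (coef x n) (e n) = partial (Suc n) x - partial n x" by (simp add: partial_def)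
    then have "cmod (coef x n) * q j (e n) \<le> q j (partial (Suc n) x) + q j (partial n x)" by (metis q_smul q_diff_le)
    then show ?thesis using C[of "Suc n" x] C[of n x] by linarith
  qed
  then show ?thesis by blast
qed

lemma coef_continuous: "enat n < N \<Longrightarrow> \<exists>j C. \<forall>x. cmod (coef x n) \<le> C * q j x"
proof -
  assume "enat n < N"
  then obtain j where j: "q j (e n) \<noteq> 0" using separating basis_nonzero by blast
  then have j: "0 < q j (e n)" by (simp add: less_le)
  obtain k C where C: "\<And>x n. cmod (coef x n) * q j (e n) \<le> C * q k x" using coef_equicontinuous by blast
  have "cmod (coef x n) \<le> (C / q j (e n)) * q k x" for x using C[of x n] j by (simp add: field_simps)
  then show ?thesis by blast
qed

end

section \<open>Finitely supported sequences as the dual of omega\<close>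

text \<open>
  A polynomial serves as a finitely supported sequence of scalars; these are exactly the continuous
  functionals on the space of all sequences.
\<close>

definition dual_pair :: "(nat \<Rightarrow> complex) \<Rightarrow> complex poly \<Rightarrow> complex" where
  "dual_pair x p = (\<Sum>n\<le>degree p. coeff p n * x n)"

lemma dual_pair_eq: "degree p \<le> n \<Longrightarrow> dual_pair x p = (\<Sum>s\<le>n. coeff p s * x s)"
  unfolding dual_pair_def by (rule sum.mono_neutral_left) (auto simp: coeff_eq_0)

lemma dual_pair_add: "dual_pair x (p + p') = dual_pair x p + dual_pair x p'"
proof -
  let ?n = "max (degree p) (degree p')"
  have "degree (p + p') \<le> ?n" by (rule degree_add_le_max)
  then show ?thesis by (simp add: dual_pair_eq[of _ ?n] algebra_simps sum.distrib)
qed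

lemma dual_pair_smult: "dual_pair x (smult c p) = c * dual_pair x p"
  by (simp add: dual_pair_eq[of _ "degree p"] degree_smult_le sum_distrib_left mult.assoc)

lemma dual_pair_0 [simp]: "dual_pair x 0 = 0" by (simp add: dual_pair_def)

lemma dual_pair_sum: "dual_pair x (\<Sum>i\<in>A. g i) = (\<Sum>i\<in>A. dual_pair x (g i))"
  by (induction A rule: infinite_finite_induct) (auto simp: dual_pair_add)

lemma dual_pair_monom: "dual_pair x (monom c n) = c * x n"
proof -
  have "dual_pair x (monom c n) = (\<Sum>k\<le>n. coeff (monom c n) k * x k)" by (rule dual_pair_eq) (rule degree_monom_le)
  also have "\<dots> = (\<Sum>k\<in>{n}. coeff (monom c n) k * x k)" by (rule sum.mono_neutral_right) auto
  finally show ?thesis by simp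
qed

lemma dual_pair_add_left: "dual_pair (x + y) p = dual_pair x p + dual_pair y p"
  by (simp add: dual_pair_def distrib_left sum.distrib)

lemma dual_pair_scale_left: "dual_pair (\<lambda>n. c * x n) p = c * dual_pair x p"
  by (simp add: dual_pair_def sum_distrib_left mult.left_commute)

section \<open>Invariant subspaces on omega\<close>

text \<open>
  If \<open>L x = 0\<close>, the line through \<open>x\<close> is invariant.  Otherwise the span \<open>U\<close> of \<open>L x, L\<^sup>2 x, \<dots>\<close> is a
  nonzero invariant subspace.  If it is the whole space, it contains \<open>x\<close>, and then a
  power of \<open>L\<close> applied to \<open>x\<close> lies in the span of the preceding ones; that span is a nonzero invariant
  subspace of finite dimension.
\<close>

lemma (in vector_space) exists_invariant_subspace:
  fixes x :: 'b
  assumes L: "Vector_Spaces.linear scale scale L" and inf: "\<And>B. finite B \<Longrightarrow> span B \<noteq> UNIV" and x: "x \<noteq> 0"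
  obtains U where "subspace U" "U \<noteq> {0}" "U \<noteq> UNIV" "L ` U \<subseteq> U"
proof -
  interpret L: Vector_Spaces.linear scale scale L by fact
  have inv: "L ` span S \<subseteq> span S" if "L ` S \<subseteq> span S" for S
    using that L.span_image[of S] span_minimal[OF that subspace_span] by simp
  define S where "S d = (\<lambda>n. (L ^^ n) x) ` {1..d}" for d
  define U where "U = span (\<Union>d. S d)"
  have LU: "L ` U \<subseteq> U"
    unfolding U_def
  proof (rule inv, safe)
    fix d y assume "y \<in> S d"
    then obtain n where "y = (L ^^ n) x" "n \<in> {1..d}" unfolding S_def by blast
    then have "L y \<in> S (Suc d)" unfolding S_def by (intro image_eqI[of _ _ "Suc n"]) auto
    then show "L y \<in> span (\<Union>d. S d)" by (intro span_base) blast
  qed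
  consider "L x = 0" | "L x \<noteq> 0" "U \<noteq> UNIV" | "U = UNIV" by blast
  then show ?thesis
  proof cases
    case 1
    show ?thesis
    proof (rule that[of "span {x}"])
      show "span {x} \<noteq> {0}" using x span_base[of x "{x}"] by auto
      show "span {x} \<noteq> UNIV" by (rule inf) simp
      show "L ` span {x} \<subseteq> span {x}" by (rule inv) (simp add: 1 span_zero)
    qed (rule subspace_span)
  next
    case 2
    have "L x \<in> S 1" by (simp add: S_def)
    then have "L x \<in> U" unfolding U_def by (intro span_base) blast
    then show ?thesis using 2 LU by (intro that[of U]) (auto simp: U_def)
  next
    case 3
    have "\<exists>d. x \<in> span (S d)"
    proof -
      have "x \<in> span (\<Union>d. S d)" using 3 unfolding U_def by simp
      then obtain T r where T: "finite T" "T \<subseteq> (\<Union>d. S d)" and "x = (\<Sum>a\<in>T. scale (r a) a)"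
        unfolding span_explicit by blast
      then have xT: "x \<in> span T" by (simp add: span_sum span_scale span_base)
      have mono: "S d \<subseteq> S d'" if "d \<le> d'" for d d' using that by (auto simp: S_def)
      have "\<exists>d. T \<subseteq> S d"
        using T
      proof induction
        case (insert t T)
        then obtain d d' where "T \<subseteq> S d" "t \<in> S d'" by auto
        then have "insert t T \<subseteq> S (max d d')" using mono[of d "max d d'"] mono[of d' "max d d'"] by auto
        then show ?case by blast
      qed simp
      then show ?thesis using xT span_mono by blast
    qed
    then have ex: "\<exists>d. x \<in> span (S d)" .
    define d where "d = (LEAST d. x \<in> span (S d))"
    have xd: "x \<in> span (S d)" unfolding d_def using LeastI_ex[OF ex] .
    obtain m where m: "d = Suc m"
    proof (cases d)
      case 0
      then show ?thesis using xd x by (simp add: S_def)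
    qed
    have xm: "x \<notin> span (S m)" using not_less_Least[of m "\<lambda>d. x \<in> span (S d)"] m unfolding d_def by simp
    have Sd: "S d = insert ((L ^^ d) x) (S m)" unfolding S_def m by (auto simp: atLeastAtMostSuc_conv)
    have top: "(L ^^ d) x \<in> span (insert x (S m))" using in_span_insert[OF xd[unfolded Sd] xm] .
    let ?W = "insert x (S m)"
    have W: "(\<lambda>n. (L ^^ n) x) ` {0..<d} \<subseteq> ?W"
    proof safe
      fix n assume "n \<in> {0..<d}" "(L ^^ n) x \<notin> S m"
      moreover have "(L ^^ n) x \<in> S m" if "n \<noteq> 0"
        unfolding S_def using that \<open>n \<in> {0..<d}\<close> m by (intro imageI) simp
      ultimately show "(L ^^ n) x = x" by (cases "n = 0") auto
    qed
    have "L ` ?W \<subseteq> span ?W"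
    proof (rule image_subsetI)
      fix y assume y: "y \<in> ?W"
      have "y \<in> (\<lambda>n. (L ^^ n) x) ` {0..<d}"
      proof (cases "y = x")
        case True
        then show ?thesis by (intro image_eqI[of _ _ 0]) (auto simp: m)
      next
        case False
        then show ?thesis using y unfolding S_def m by auto
      qed
      then obtain n where n: "y = (L ^^ n) x" "n < d" by auto
      have Ly: "L y = (L ^^ Suc n) x" using n by simp
      show "L y \<in> span ?W"
      proof (cases "Suc n = d")
        case True then show ?thesis using top unfolding Ly by simp
      next
        case False
        then have "Suc n \<in> {0..<d}" using n by simp
        then have "(L ^^ Suc n) x \<in> ?W" using W by blast
        then show ?thesis unfolding Ly by (rule span_base)
      qed
    qed
    then have LW: "L ` span ?W \<subseteq> span ?W" by (rule inv)
    show ?thesis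
    proof (rule that[of "span ?W"])
      show "span ?W \<noteq> {0}" using x span_base[of x ?W] by auto
      show "span ?W \<noteq> UNIV" by (rule inf) (simp add: S_def)
    qed (use LW in auto)
  qed
qed

lemma vector_space_smult: "vector_space (smult :: complex \<Rightarrow> complex poly \<Rightarrow> complex poly)"
  by unfold_locales (auto simp: smult_add_right smult_add_left)

lemma poly_infinite_dimensional:
  assumes "finite B" shows "module.span smult B \<noteq> (UNIV :: complex poly set)"
proof
  interpret vector_space "smult :: complex \<Rightarrow> complex poly \<Rightarrow> complex poly" by (rule vector_space_smult)
  define m where "m = Max (insert 0 (degree ` B))"
  have "subspace {p :: complex poly. degree p \<le> m}"
    by (rule subspaceI) (auto intro: degree_add_le order.trans[OF degree_smult_le])
  moreover have "B \<subseteq> {p. degree p \<le> m}" using assms by (auto simp: m_def)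
  ultimately have "span B \<subseteq> {p. degree p \<le> m}" by (intro span_minimal)
  moreover assume "span B = UNIV"
  ultimately have "degree (monom (1::complex) (Suc m)) \<le> m" by blast
  then show False by (simp add: degree_monom_eq)
qed

text \<open>
  Any linear functional on polynomials is the pairing with a sequence, namely with its values at the
  monomials; so a functional that vanishes on \<open>U\<close> but not everywhere is such a sequence.
\<close>

lemma annihilator_nonzero:
  assumes U: "module.subspace smult U" "U \<noteq> (UNIV :: complex poly set)"
  obtains x where "x \<noteq> (\<lambda>n. 0)" "\<And>p. p \<in> U \<Longrightarrow> dual_pair x p = 0"
proof -
  interpret P: vector_space "smult :: complex \<Rightarrow> complex poly \<Rightarrow> complex poly" by (rule vector_space_smult)
  interpret vector_space_pair "smult :: complex \<Rightarrow> complex poly \<Rightarrow> complex poly" "(*) :: complex \<Rightarrow> complex \<Rightarrow> complex"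
    by unfold_locales (auto simp: algebra_simps)
  obtain p0 where p0: "p0 \<notin> U" using U(2) by blast
  obtain B where B: "B \<subseteq> U" "P.independent B" "U \<subseteq> P.span B" by (rule P.maximal_independent_subset)
  have "P.span B = U" using B(3) P.span_minimal[OF B(1) U(1)] by blast
  then have "P.independent (insert p0 B)" using p0 B(2) by (intro P.independent_insertI) auto
  then obtain \<phi> where \<phi>: "Vector_Spaces.linear smult (*) \<phi>" "\<forall>p\<in>insert p0 B. \<phi> p = (if p = p0 then 1 else 0)"
    using linear_independent_extend[of "insert p0 B" "\<lambda>p. if p = p0 then 1 else 0"] by blast
  interpret \<phi>: Vector_Spaces.linear "smult :: complex \<Rightarrow> complex poly \<Rightarrow> complex poly" "(*) :: complex \<Rightarrow> complex \<Rightarrow> complex" \<phi> by fact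
  have rep: "dual_pair (\<lambda>n. \<phi> (monom 1 n)) p = \<phi> p" for p
  proof -
    have "\<phi> p = \<phi> (\<Sum>n\<le>degree p. smult (coeff p n) (monom 1 n))" by (simp add: smult_monom poly_as_sum_of_monoms)
    also have "\<dots> = (\<Sum>n\<le>degree p. coeff p n * \<phi> (monom 1 n))" by (simp only: \<phi>.sum \<phi>.scale)
    finally show ?thesis by (simp add: dual_pair_def)
  qed
  show ?thesis
  proof (rule that)
    show "(\<lambda>n. \<phi> (monom 1 n)) \<noteq> (\<lambda>n. 0)"
    proof
      assume "(\<lambda>n. \<phi> (monom 1 n)) = (\<lambda>n. 0)"
      then have "\<phi> p0 = 0" using rep[of p0] by (simp add: dual_pair_def)
      then show False using \<phi>(2) by simp
    qed
    fix p assume "p \<in> U"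
    then have "p \<in> P.span B" using B(3) by blast
    moreover have "\<phi> b = 0" if "b \<in> B" for b using \<phi>(2) that p0 B(1) by auto
    ultimately have "\<phi> p = 0" using \<phi>.eq_0_on_span by blast
    then show "dual_pair (\<lambda>n. \<phi> (monom 1 n)) p = 0" by (simp add: rep)
  qed
qed

lemma omega_scale_eq: "omega_scale = seq_scale (*)"
  by (simp add: omega_scale_def seq_scale_def fun_eq_iff)

lemma omega_seminorm_eq: "omega_seminorm = seq_seminorm (\<lambda>_. cmod)"
  by (simp add: omega_seminorm_def seq_seminorm_def fun_eq_iff)

lemma frechet_space_complex: "frechet_space (*) (\<lambda>_. cmod)"
proof -
  interpret seminormed_space "(*) :: complex \<Rightarrow> complex \<Rightarrow> complex" "\<lambda>_. cmod"
    by unfold_locales (auto simp: seminorm_def norm_mult norm_triangle_ineq algebra_simps)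
  show ?thesis
  proof
    fix u assume "seminorm_Cauchy (\<lambda>_. cmod) u"
    then have "Cauchy u" unfolding seminorm_Cauchy_def by (simp add: Cauchy_iff)
    then obtain l where "u \<longlonglongrightarrow> l" using Cauchy_convergent convergent_def by blast
    then have "limitin (seminorm_topology (\<lambda>_. cmod)) u l sequentially"
      unfolding limitin_iff using tendsto_norm_zero[OF LIM_zero] by blast
    then show "\<exists>l. limitin (seminorm_topology (\<lambda>_. cmod)) u l sequentially" by blast
  qed (auto simp: seminorm_def norm_mult norm_triangle_ineq)
qed

lemma frechet_space_omega: "frechet_space omega_scale omega_seminorm"
  unfolding omega_scale_eq omega_seminorm_eq by (rule frechet_space_seq[OF frechet_space_complex])

lemma omega_seminorm_le_iff: "omega_seminorm j x \<le> r \<longleftrightarrow> (\<forall>n\<le>j. cmod (x n) \<le> r)"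
  unfolding omega_seminorm_eq by (rule seq_seminorm_le_iff)

lemma omega_seminorm_ge: "n \<le> j \<Longrightarrow> cmod (x n) \<le> omega_seminorm j x"
  using omega_seminorm_le_iff[of j x "omega_seminorm j x"] by auto

text \<open>
  By continuity each coordinate of \<open>T x\<close> depends on finitely many coordinates of \<open>x\<close>, so it is the
  pairing of \<open>x\<close> with a polynomial.  This defines the transposed map \<open>L\<close>, and the annihilator of an
  invariant subspace of \<open>L\<close> is invariant under \<open>T\<close>.
\<close>

theorem invariant_subspace_property_omega: "invariant_subspace_property omega_scale omega_seminorm"
  unfolding invariant_subspace_property_def
proof (intro allI impI)
  interpret O: frechet_space omega_scale omega_seminorm by (rule frechet_space_omega)
  interpret P: vector_space "smult :: complex \<Rightarrow> complex poly \<Rightarrow> complex poly" by (rule vector_space_smult)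
  fix T assume "Vector_Spaces.linear omega_scale omega_scale T \<and>
     continuous_map (seminorm_topology omega_seminorm) (seminorm_topology omega_seminorm) T"
  then have lin: "Vector_Spaces.linear omega_scale omega_scale T"
    and cont: "\<exists>j C. \<forall>x. omega_seminorm k (T x) \<le> C * omega_seminorm j x" for k
    using continuous_linear_iff[OF O.seminormed_space_axioms O.seminormed_space_axioms, of T] by auto
  interpret T: Vector_Spaces.linear omega_scale omega_scale T by fact
  define \<delta> where "\<delta> n = (\<lambda>i. if i = n then 1 else 0 :: complex)" for n :: nat
  have "\<exists>p. \<forall>x. T x i = dual_pair x p" for i
  proof -
    obtain j C where C: "\<And>x. omega_seminorm i (T x) \<le> C * omega_seminorm j x" using cont by blast
    have "T x i = dual_pair x (\<Sum>n\<le>j. monom (T (\<delta> n) i) n)" for x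
    proof -
      define z where "z = (\<Sum>n\<le>j. omega_scale (x n) (\<delta> n))"
      have fun_sum: "(\<Sum>n\<in>A. h n) m = (\<Sum>n\<in>A. h n m)" for A :: "nat set" and h :: "nat \<Rightarrow> nat \<Rightarrow> complex" and m
        by (induction A rule: infinite_finite_induct) auto
      have z: "z m = x m" if "m \<le> j" for m
      proof -
        have "z m = (\<Sum>n\<le>j. if n = m then x n else 0)"
          unfolding z_def fun_sum by (intro sum.cong) (auto simp: omega_scale_def \<delta>_def)
        then show ?thesis using that by simp
      qed
      then have "omega_seminorm j (x - z) \<le> 0" by (simp add: omega_seminorm_le_iff)
      then have "omega_seminorm j (x - z) = 0" by (intro antisym) auto
      then have "omega_seminorm i (T (x - z)) \<le> 0" using C[of "x - z"] by simp
      then have "cmod (T (x - z) i) \<le> 0" using omega_seminorm_ge[of i i "T (x - z)"] by linarith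
      then have "T x i = T z i" by (simp add: T.diff)
      also have "\<dots> = (\<Sum>n\<le>j. x n * T (\<delta> n) i)"
        unfolding z_def T.sum T.scale fun_sum by (simp add: omega_scale_def)
      finally show ?thesis by (simp add: dual_pair_sum dual_pair_monom mult.commute)
    qed
    then show ?thesis by blast
  qed
  then obtain \<tau> where \<tau>: "\<And>i x. T x i = dual_pair x (\<tau> i)" by metis
  define L where "L p = (\<Sum>i\<le>degree p. smult (coeff p i) (\<tau> i))" for p
  have L_eq: "L p = (\<Sum>i\<le>n. smult (coeff p i) (\<tau> i))" if "degree p \<le> n" for p n
    unfolding L_def using that by (intro sum.mono_neutral_left) (auto simp: coeff_eq_0)
  have L_pair: "dual_pair x (L p) = dual_pair (T x) p" for x p
    by (simp add: L_def dual_pair_sum dual_pair_smult \<tau> dual_pair_def[of "T x"])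
  have linL: "Vector_Spaces.linear smult smult L"
    unfolding Vector_Spaces.linear_iff
  proof (intro conjI allI vector_space_smult)
    show "L (p + p') = L p + L p'" for p p'
    proof -
      let ?n = "max (degree p) (degree p')"
      have "degree (p + p') \<le> ?n" by (rule degree_add_le_max)
      then show ?thesis by (simp add: L_eq[of _ ?n] smult_add_left sum.distrib)
    qed
    show "L (smult c p) = smult c (L p)" for c p
    proof -
      have "L (smult c p) = (\<Sum>i\<le>degree p. smult (coeff (smult c p) i) (\<tau> i))" by (rule L_eq) (rule degree_smult_le)
      also have "\<dots> = smult c (L p)" unfolding L_def P.scale_sum_right by (intro sum.cong) auto
      finally show ?thesis .
    qed
  qed
  obtain U where U: "P.subspace U" "U \<noteq> {0}" "U \<noteq> UNIV" "L ` U \<subseteq> U"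
    using P.exists_invariant_subspace[OF linL poly_infinite_dimensional one_neq_zero] by blast
  define M where "M = {x. \<forall>p\<in>U. dual_pair x p = 0}"
  show "\<exists>M. module.subspace omega_scale M \<and> closedin (seminorm_topology omega_seminorm) M \<and>
             M \<noteq> {0} \<and> M \<noteq> UNIV \<and> T ` M \<subseteq> M"
  proof (intro exI[of _ M] conjI)
    show "O.subspace M"
      by (rule O.subspaceI) (auto simp: M_def dual_pair_add_left dual_pair_scale_left omega_scale_def, simp add: dual_pair_def)
    show "closedin (seminorm_topology omega_seminorm) M"
      unfolding O.closedin_iff
    proof (intro allI impI)
      fix x assume x: "\<forall>j r. 0 < r \<longrightarrow> (\<exists>m\<in>M. omega_seminorm j (m - x) < r)"
      have "dual_pair x p = 0" if p: "p \<in> U" for p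
      proof -
        define K where "K = (\<Sum>n\<le>degree p. cmod (coeff p n))"
        have "cmod (dual_pair x p) \<le> 0 + \<epsilon>" if \<epsilon>: "0 < \<epsilon>" for \<epsilon>
        proof -
          have K: "0 \<le> K" by (simp add: K_def sum_nonneg)
          have "0 < \<epsilon> / (K + 1)" using \<epsilon> K by (intro divide_pos_pos) auto
          then obtain m where m: "m \<in> M" "omega_seminorm (degree p) (m - x) < \<epsilon> / (K + 1)" using x by blast
          have "dual_pair (m - x) p + dual_pair x p = dual_pair m p" by (simp flip: dual_pair_add_left)
          then have "dual_pair (m - x) p = - dual_pair x p" using m(1) p by (simp add: M_def add_eq_0_iff)
          then have "cmod (dual_pair x p) = cmod (dual_pair (m - x) p)" by simp
          also have "\<dots> \<le> (\<Sum>n\<le>degree p. cmod (coeff p n) * omega_seminorm (degree p) (m - x))"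
            unfolding dual_pair_def
            by (rule sum_norm_le) (auto simp: norm_mult intro!: mult_left_mono omega_seminorm_ge simp del: minus_apply)
          also have "\<dots> = K * omega_seminorm (degree p) (m - x)" by (simp add: K_def sum_distrib_right)
          also have "\<dots> \<le> (K + 1) * (\<epsilon> / (K + 1))" using m(2) K by (intro mult_mono) auto
          also have "\<dots> = \<epsilon>" using K by simp
          finally show ?thesis by simp
        qed
        then have "cmod (dual_pair x p) \<le> 0" by (rule field_le_epsilon)
        then show ?thesis by simp
      qed
      then show "x \<in> M" by (simp add: M_def)
    qed
    obtain x where "x \<noteq> (\<lambda>n. 0)" "\<And>p. p \<in> U \<Longrightarrow> dual_pair x p = 0" using annihilator_nonzero[OF U(1,3)] by blast
    then have "x \<in> M" "x \<noteq> 0" by (simp_all add: M_def zero_fun_def)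
    then show "M \<noteq> {0}" by blast
    obtain p where p: "p \<in> U" "p \<noteq> 0" using U(2) P.subspace_0[OF U(1)] by blast
    have "dual_pair (\<delta> (degree p)) p = (\<Sum>n\<in>{degree p}. coeff p n * \<delta> (degree p) n)"
      unfolding dual_pair_def by (rule sum.mono_neutral_right) (auto simp: \<delta>_def)
    then have "dual_pair (\<delta> (degree p)) p \<noteq> 0" using p(2) by (simp add: \<delta>_def)
    then show "M \<noteq> UNIV" using p(1) by (auto simp: M_def)
    show "T ` M \<subseteq> M" using U(4) by (auto simp: M_def simp flip: L_pair)
  qed
qed

section \<open>Spaces isomorphic to omega\<close>

lemma invariant_subspace_property_isomorphic:
  assumes X: "seminormed_space smul q" and Y: "seminormed_space smul' q'"
    and iso: "isomorphic_spaces smul q smul' q'" and isp: "invariant_subspace_property smul' q'"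
  shows "invariant_subspace_property smul q"
  unfolding invariant_subspace_property_def
proof (intro allI impI)
  interpret X: seminormed_space smul q by fact
  interpret Y: seminormed_space smul' q' by fact
  obtain S where linS: "Vector_Spaces.linear smul smul' S"
    and "homeomorphic_map (seminorm_topology q) (seminorm_topology q') S"
    using iso unfolding isomorphic_spaces_def by blast
  then obtain R where R: "continuous_map (seminorm_topology q) (seminorm_topology q') S"
    "continuous_map (seminorm_topology q') (seminorm_topology q) R" "\<And>x. R (S x) = x" "\<And>y. S (R y) = y"
    by (auto simp: homeomorphic_map_maps homeomorphic_maps_def)
  interpret S: Vector_Spaces.linear smul smul' S by fact
  have linR: "Vector_Spaces.linear smul' smul R"
    unfolding Vector_Spaces.linear_iff
    using X.vector_space_axioms Y.vector_space_axioms R(3,4) by (metis S.add S.scale)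
  fix T assume T: "Vector_Spaces.linear smul smul T \<and> continuous_map (seminorm_topology q) (seminorm_topology q) T"
  have "Vector_Spaces.linear smul' smul' (S \<circ> (T \<circ> R))"
    using T linR linS by (intro Vector_Spaces.linear_compose) auto
  moreover have "continuous_map (seminorm_topology q') (seminorm_topology q') (S \<circ> (T \<circ> R))"
    using T R by (intro continuous_map_compose) auto
  ultimately obtain M where M: "Y.subspace M" "closedin (seminorm_topology q') M" "M \<noteq> {0}" "M \<noteq> UNIV"
    "(S \<circ> (T \<circ> R)) ` M \<subseteq> M"
    using isp unfolding invariant_subspace_property_def by blast
  show "\<exists>M. X.subspace M \<and> closedin (seminorm_topology q) M \<and> M \<noteq> {0} \<and> M \<noteq> UNIV \<and> T ` M \<subseteq> M"
  proof (intro exI[of _ "{x. S x \<in> M}"] conjI)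
    show "X.subspace {x. S x \<in> M}"
      using M(1) by (intro X.subspaceI) (auto simp: S.zero S.add S.scale Y.subspace_0 Y.subspace_add Y.subspace_scale)
    show "closedin (seminorm_topology q) {x. S x \<in> M}"
      using closedin_continuous_map_preimage[OF R(1) M(2)] by simp
    obtain y where "y \<in> M" "y \<noteq> 0" using M(3) Y.subspace_0[OF M(1)] by blast
    then have "S (R y) \<in> M" "R y \<noteq> 0" using R(4)[of y] S.zero by auto
    then show "{x. S x \<in> M} \<noteq> {0}" by blast
    obtain z where "z \<notin> M" using M(4) by blast
    then show "{x. S x \<in> M} \<noteq> UNIV" using R(4)[of z] by (metis UNIV_I mem_Collect_eq)
    have "S (T x) \<in> M" if "S x \<in> M" for x
    proof -
      have "(S \<circ> (T \<circ> R)) (S x) \<in> M" using M(5) that by blast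
      then show ?thesis by (simp add: R(3))
    qed
    then show "T ` {x. S x \<in> M} \<subseteq> {x. S x \<in> M}" by blast
  qed
qed

lemma isomorphic_omegaI:
  assumes X: "seminormed_space smul q"
    and c_add: "\<And>x y i. c (x + y) i = c x i + c y i" and c_scale: "\<And>a x i. c (smul a x) i = a * c x i"
    and inj: "\<And>x. (\<And>i. c x i = 0) \<Longrightarrow> x = 0" and surj: "\<And>a. \<exists>x. \<forall>i. c x i = a i"
    and c_bound: "\<And>i. \<exists>j C. \<forall>x. cmod (c x i) \<le> C * q j x"
    and q_bound: "\<And>j. \<exists>m C. \<forall>x. q j x \<le> C * omega_seminorm m (c x)"
  shows "isomorphic_spaces smul q omega_scale omega_seminorm"
proof -
  interpret X: seminormed_space smul q by fact
  interpret O: frechet_space omega_scale omega_seminorm by (rule frechet_space_omega)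
  have lin: "Vector_Spaces.linear smul omega_scale c"
    unfolding Vector_Spaces.linear_iff
    using X.vector_space_axioms O.vector_space_axioms by (auto simp: fun_eq_iff c_add c_scale omega_scale_def)
  interpret c: Vector_Spaces.linear smul omega_scale c by fact
  have "inj c" unfolding c.inj_iff_eq_0 using inj by (auto simp: fun_eq_iff)
  moreover have "surj c" using surj by (metis ext surjI)
  ultimately have bij: "bij c" by (rule bijI)
  define R where "R = inv c"
  have R: "R (c x) = x" "c (R y) = y" for x y
    using bij by (simp_all add: R_def bij_is_inj bij_is_surj surj_f_inv_f)
  have linR: "Vector_Spaces.linear omega_scale smul R"
    unfolding Vector_Spaces.linear_iff
    using X.vector_space_axioms O.vector_space_axioms R by (metis c.add c.scale)
  have "continuous_map (seminorm_topology q) (seminorm_topology omega_seminorm) c"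
    unfolding continuous_linear_iff[OF X O.seminormed_space_axioms lin]
  proof
    fix k
    obtain j C where C: "\<And>i x. cmod (c x i) \<le> C i * q (j i) x" using c_bound by metis
    define J where "J = Max (j ` {..k})"
    define D where "D = (\<Sum>i\<le>k. \<bar>C i\<bar>)"
    have "omega_seminorm k (c x) \<le> D * q J x" for x
      unfolding omega_seminorm_le_iff
    proof (intro allI impI)
      fix i assume i: "i \<le> k"
      have "cmod (c x i) \<le> C i * q (j i) x" by (rule C)
      also have "\<dots> \<le> D * q J x"
      proof (intro mult_mono)
        have "C i \<le> \<bar>C i\<bar>" by simp
        also have "\<dots> \<le> D" unfolding D_def using i by (intro member_le_sum) auto
        finally show "C i \<le> D" .
        show "q (j i) x \<le> q J x" using i by (intro X.mono_seminorms) (simp add: J_def)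
        show "0 \<le> D" by (simp add: D_def sum_nonneg)
      qed simp
      finally show "cmod (c x i) \<le> D * q J x" .
    qed
    then show "\<exists>j C. \<forall>x. omega_seminorm k (c x) \<le> C * q j x" by blast
  qed
  moreover have "continuous_map (seminorm_topology omega_seminorm) (seminorm_topology q) R"
    unfolding continuous_linear_iff[OF O.seminormed_space_axioms X linR]
  proof
    fix j
    obtain m C where "\<And>x. q j x \<le> C * omega_seminorm m (c x)" using q_bound by blast
    then have "q j (R y) \<le> C * omega_seminorm m y" for y using R(2)[of y] by metis
    then show "\<exists>m C. \<forall>y. q j (R y) \<le> C * omega_seminorm m y" by blast
  qed
  ultimately have "homeomorphic_maps (seminorm_topology q) (seminorm_topology omega_seminorm) c R"
    using R by (simp add: homeomorphic_maps_def)
  then show ?thesis unfolding isomorphic_spaces_def homeomorphic_map_maps using lin by blast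
qed

lemma isomorphic_omegaD:
  assumes X: "seminormed_space smul q" and iso: "isomorphic_spaces smul q omega_scale omega_seminorm"
  obtains s where "\<And>x y i. s (x + y) i = s x i + s y i" "\<And>a x i. s (smul a x) i = a * s x i"
    "\<And>x. s x = (\<lambda>i. 0) \<Longrightarrow> x = 0" "\<And>a. \<exists>x. \<forall>i. s x i = a i"
    "\<And>i. \<exists>j C. \<forall>x. cmod (s x i) \<le> C * q j x" "\<And>j. \<exists>m C. \<forall>x. q j x \<le> C * omega_seminorm m (s x)"
proof -
  interpret X: seminormed_space smul q by fact
  interpret O: frechet_space omega_scale omega_seminorm by (rule frechet_space_omega)
  obtain s where lin: "Vector_Spaces.linear smul omega_scale s"
    and "homeomorphic_map (seminorm_topology q) (seminorm_topology omega_seminorm) s"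
    using iso unfolding isomorphic_spaces_def by blast
  then obtain R where R: "continuous_map (seminorm_topology q) (seminorm_topology omega_seminorm) s"
    "continuous_map (seminorm_topology omega_seminorm) (seminorm_topology q) R" "\<And>x. R (s x) = x" "\<And>y. s (R y) = y"
    by (auto simp: homeomorphic_map_maps homeomorphic_maps_def)
  interpret s: Vector_Spaces.linear smul omega_scale s by fact
  have linR: "Vector_Spaces.linear omega_scale smul R"
    unfolding Vector_Spaces.linear_iff
    using X.vector_space_axioms O.vector_space_axioms R(3,4) by (metis s.add s.scale)
  interpret R: Vector_Spaces.linear omega_scale smul R by fact
  show ?thesis
  proof (rule that[of s])
    show "s (x + y) i = s x i + s y i" for x y i by (simp add: s.add)
    show "s (smul a x) i = a * s x i" for a x i by (simp add: s.scale omega_scale_def)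
    show "x = 0" if "s x = (\<lambda>i. 0)" for x
    proof -
      have "s x = 0" using that by (simp add: zero_fun_def)
      then have "R (s x) = 0" by (simp only: R.zero)
      then show ?thesis by (simp add: R(3))
    qed
    show "\<exists>x. \<forall>i. s x i = a i" for a using R(4)[of a] by metis
    show "\<exists>j C. \<forall>x. cmod (s x i) \<le> C * q j x" for i
    proof -
      obtain j C where "\<And>x. omega_seminorm i (s x) \<le> C * q j x"
        using R(1) unfolding continuous_linear_iff[OF X O.seminormed_space_axioms lin] by blast
      then have "cmod (s x i) \<le> C * q j x" for x using omega_seminorm_ge[of i i "s x"] order.trans by blast
      then show ?thesis by blast
    qed
    show "\<exists>m C. \<forall>x. q j x \<le> C * omega_seminorm m (s x)" for j
    proof -
      obtain m C where "\<And>y. q j (R y) \<le> C * omega_seminorm m y"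
        using R(2) unfolding continuous_linear_iff[OF O.seminormed_space_axioms X linR] by blast
      then have "q j x \<le> C * omega_seminorm m (s x)" for x using R(3)[of x] by metis
      then show ?thesis by blast
    qed
  qed
qed

text \<open>
  The coordinates \<open>s x k\<close>, \<open>k \<in> K\<close>, describe the space as \<open>\<complex>\<^sup>K\<close> topologically.  The coordinates
  of a sequence are then indexed by the countably infinite set \<open>\<nat> \<times> K\<close>, so an enumeration of this set
  gives the isomorphism.  A finite \<open>K\<close> covers finite-dimensional spaces.
\<close>

lemma seq_isomorphic_omega:
  fixes K :: "nat set"
  assumes X: "frechet_space smul q" and K: "K \<noteq> {}"
    and s_add: "\<And>x y k. s (x + y) k = s x k + s y k" and s_scale: "\<And>a x k. s (smul a x) k = a * s x k"
    and inj: "\<And>x. (\<And>k. k \<in> K \<Longrightarrow> s x k = 0) \<Longrightarrow> x = 0" and surj: "\<And>a. \<exists>x. \<forall>k\<in>K. s x k = a k"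
    and s_bound: "\<And>k. k \<in> K \<Longrightarrow> \<exists>j C. \<forall>x. cmod (s x k) \<le> C * q j x"
    and q_bound: "\<And>j. \<exists>m C. \<forall>x r. (\<forall>k\<in>K. k \<le> m \<longrightarrow> cmod (s x k) \<le> r) \<longrightarrow> 0 \<le> r \<longrightarrow> q j x \<le> C * r"
  shows "isomorphic_spaces (seq_scale smul) (seq_seminorm q) omega_scale omega_seminorm"
proof -
  interpret X: frechet_space smul q by fact
  interpret Y: frechet_space "seq_scale smul" "seq_seminorm q" by (rule frechet_space_seq[OF X])
  have "infinite ((UNIV :: nat set) \<times> K)" using K by (simp add: finite_cartesian_product_iff)
  then have "bij_betw (from_nat_into ((UNIV :: nat set) \<times> K)) UNIV (UNIV \<times> K)"
    by (rule bij_betw_from_nat_into[OF countableI_type])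
  then obtain u where u: "bij_betw u (UNIV :: nat set) ((UNIV :: nat set) \<times> K)" by (rule that)
  have uK: "snd (u i) \<in> K" for i using bij_betwE[OF u] by (cases "u i") (auto dest: spec[of _ i])
  define v where "v = inv_into UNIV u"
  have uv: "u (v p) = p" if "snd p \<in> K" for p
  proof -
    have "p \<in> UNIV \<times> K" using that by (cases p) auto
    then show ?thesis unfolding v_def using u by (metis bij_betw_imp_surj_on f_inv_into_f)
  qed
  define c where "c y i = s (y (fst (u i))) (snd (u i))" for y i
  show ?thesis
  proof (rule isomorphic_omegaI[of _ _ c])
    show "seminormed_space (seq_scale smul) (seq_seminorm q)" by (rule Y.seminormed_space_axioms)
    show "c (x + y) i = c x i + c y i" for x y i by (simp add: c_def s_add)
    show "c (seq_scale smul a x) i = a * c x i" for a x i by (simp add: c_def seq_scale_def s_scale)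
    show "y = 0" if c0: "\<And>i. c y i = 0" for y
    proof
      fix n
      have "s (y n) k = 0" if "k \<in> K" for k using c0[of "v (n, k)"] uv[of "(n, k)"] that by (simp add: c_def)
      then show "y n = 0 n" by (simp add: inj)
    qed
    show "\<exists>y. \<forall>i. c y i = a i" for a
    proof -
      have "\<exists>x. \<forall>k\<in>K. s x k = a (v (n, k))" for n by (rule surj)
      then obtain y where y: "\<And>n k. k \<in> K \<Longrightarrow> s (y n) k = a (v (n, k))" by metis
      have "v (u i) = i" for i unfolding v_def using u by (metis UNIV_I bij_betw_imp_inj_on inv_into_f_f)
      then have "c y i = a i" for i using y[OF uK[of i], of "fst (u i)"] by (simp add: c_def)
      then show ?thesis by blast
    qed
    show "\<exists>j C. \<forall>y. cmod (c y i) \<le> C * seq_seminorm q j y" for i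
    proof -
      obtain j C where C: "\<And>x. cmod (s x (snd (u i))) \<le> C * q j x" using s_bound[OF uK[of i]] by blast
      let ?J = "max j (fst (u i))"
      have "cmod (c y i) \<le> \<bar>C\<bar> * seq_seminorm q ?J y" for y
      proof -
        have "cmod (c y i) \<le> C * q j (y (fst (u i)))" unfolding c_def by (rule C)
        also have "\<dots> \<le> \<bar>C\<bar> * q ?J (y (fst (u i)))" by (intro mult_mono X.mono_seminorms) auto
        also have "\<dots> \<le> \<bar>C\<bar> * seq_seminorm q ?J y" by (intro mult_left_mono seq_seminorm_ge) auto
        finally show ?thesis .
      qed
      then show ?thesis by blast
    qed
    show "\<exists>m C. \<forall>y. seq_seminorm q j y \<le> C * omega_seminorm m (c y)" for j
    proof -
      obtain m C where C: "\<And>x r. (\<forall>k\<in>K. k \<le> m \<longrightarrow> cmod (s x k) \<le> r) \<Longrightarrow> 0 \<le> r \<Longrightarrow> q j x \<le> C * r" using q_bound by blast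
      define M where "M = Max (v ` ({..j} \<times> {..m}))"
      have "seq_seminorm q j y \<le> C * omega_seminorm M (c y)" for y
        unfolding seq_seminorm_le_iff
      proof (intro allI impI C ballI)
        fix n k assume n: "n \<le> j" and k: "k \<in> K" "k \<le> m"
        have "v (n, k) \<le> M" unfolding M_def using n k by (intro Max_ge) auto
        then have "cmod (c y (v (n, k))) \<le> omega_seminorm M (c y)" by (rule omega_seminorm_ge)
        then show "cmod (s (y n) k) \<le> omega_seminorm M (c y)" using uv[of "(n, k)"] k by (simp add: c_def)
      next
        show "0 \<le> omega_seminorm M (c y)" by (rule order.trans[OF norm_ge_zero omega_seminorm_ge[of 0]]) simp
      qed
      then show ?thesis by blast
    qed
  qed
qed

context schauder_space
begin

lemma coef_finite_sum:
  assumes "\<And>n. n < m \<Longrightarrow> enat n < N"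
  shows "coef (\<Sum>n<m. smul (a n) (e n)) = (\<lambda>n. if n < m then a n else 0)"
proof (rule coef_eqI)
  show "(if n < m then a n else 0) = 0" if "N \<le> enat n" for n using assms[of n] that by (auto simp: not_less[symmetric])
  fix j
  have "eventually (\<lambda>l. q j ((\<Sum>n<l. smul (if n < m then a n else 0) (e n)) - (\<Sum>n<m. smul (a n) (e n))) = 0) sequentially"
    using eventually_ge_at_top[of m]
  proof eventually_elim
    case (elim l)
    have "(\<Sum>n<l. smul (if n < m then a n else 0) (e n)) = (\<Sum>n<m. smul (if n < m then a n else 0) (e n))"
      by (rule sum.mono_neutral_right) (use elim in auto)
    then show ?case by simp
  qed
  then show "(\<lambda>l. q j ((\<Sum>n<l. smul (if n < m then a n else 0) (e n)) - (\<Sum>n<m. smul (a n) (e n)))) \<longlonglongrightarrow> 0"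
    by (rule tendsto_eventually)
qed

lemma partial_full:
  assumes "N = enat d"
  shows "partial d x = x"
proof -
  have c0: "coef x i = 0" if "d \<le> i" for i by (rule coef_beyond) (simp add: assms that)
  have const: "partial m x = partial d x" if "d \<le> m" for m
    unfolding partial_def
  proof (rule sum.mono_neutral_right)
    show "\<forall>i\<in>{..<m} - {..<d}. smul (coef x i) (e i) = 0"
    proof
      fix i assume "i \<in> {..<m} - {..<d}"
      then have "d \<le> i" by simp
      then show "smul (coef x i) (e i) = 0" by (simp only: c0 scale_zero_left)
    qed
  qed (use that in simp_all)
  have "q j (partial d x - x) = 0" for j
  proof -
    have "eventually (\<lambda>m. q j (partial m x - x) = q j (partial d x - x)) sequentially"
    proof (rule eventually_mono[OF eventually_ge_at_top[of d]])
      fix m assume "d \<le> m"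
      show "q j (partial m x - x) = q j (partial d x - x)" unfolding const[OF \<open>d \<le> m\<close>] ..
    qed
    then have "(\<lambda>m. q j (partial m x - x)) \<longlonglongrightarrow> q j (partial d x - x)"
      by (rule tendsto_eventually)
    then show ?thesis using partial_tendsto[of j x] by (rule LIMSEQ_unique)
  qed
  then have "partial d x - x = 0" by (rule separating)
  then show ?thesis by simp
qed

lemma finite_dimensional_if_finite_basis:
  assumes "N = enat d"
  shows "\<exists>B. finite_dimensional_vector_space smul B"
proof -
  obtain B where B: "B \<subseteq> e ` {..<d}" "independent B" "e ` {..<d} \<subseteq> span B" by (rule maximal_independent_subset)
  have "x \<in> span B" for x
  proof -
    have "partial d x \<in> span B" unfolding partial_def
      by (intro span_sum span_scale) (use B(3) in auto)
    then show ?thesis by (simp add: partial_full[OF assms])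
  qed
  then have "finite_dimensional_vector_space smul B"
    using B(1,2) finite_subset[OF B(1)] by unfold_locales auto
  then show ?thesis by blast
qed

text \<open>
  A Schauder basis is linearly independent, as its coefficient functionals show.
\<close>

lemma finite_basis_if_finite_dimensional:
  assumes "finite_dimensional_vector_space smul B"
  obtains d where "N = enat d"
proof (cases N)
  case infinity
  interpret V: finite_dimensional_vector_space smul B by fact
  have cb: "coef (e n) = (\<lambda>m. if m = n then 1 else 0)" for n by (rule coef_basis) (simp add: infinity)
  have "inj e"
  proof (rule injI)
    fix m n assume "e m = e n"
    then have "coef (e m) m = coef (e n) m" by simp
    then show "m = n" by (simp add: cb split: if_splits)
  qed
  moreover have "independent (range e)"
    unfolding dependent_def
  proof
    assume "\<exists>a\<in>range e. a \<in> span (range e - {a})"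
    then obtain n where n: "e n \<in> span (range e - {e n})" by blast
    have "subspace {x. coef x n = 0}" by (rule subspaceI) (auto simp: coef_0 coef_add coef_scale)
    moreover have "range e - {e n} \<subseteq> {x. coef x n = 0}" by (auto simp: cb)
    ultimately have "span (range e - {e n}) \<subseteq> {x. coef x n = 0}" by (intro span_minimal)
    then show False using n by (auto simp: cb)
  qed
  ultimately have False using V.finiteI_independent finite_imageD[of e UNIV] by blast
  then show ?thesis ..
qed (rule that)

lemma seq_isomorphic_omega_if_finite_basis:
  assumes d: "N = enat d" and "\<exists>x::'a. x \<noteq> 0"
  shows "isomorphic_spaces (seq_scale smul) (seq_seminorm q) omega_scale omega_seminorm"
proof (rule seq_isomorphic_omega[of _ _ "{..<d}" coef])
  show "frechet_space smul q" by (rule frechet_space_axioms)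
  show "{..<d} \<noteq> {}"
  proof
    assume "{..<d} = {}"
    then have "d = 0" by auto
    then have "x = 0" for x :: 'a using partial_full[OF d, of x] by (simp add: partial_def)
    then show False using assms(2) by blast
  qed
  show "coef (x + y) k = coef x k + coef y k" for x y k by (simp add: coef_add)
  show "coef (smul a x) k = a * coef x k" for a x k by (simp add: coef_scale)
  show "x = 0" if "\<And>k. k \<in> {..<d} \<Longrightarrow> coef x k = 0" for x
    using partial_full[OF d, of x] that by (simp add: partial_def)
  show "\<exists>x. \<forall>k\<in>{..<d}. coef x k = a k" for a
    using coef_finite_sum[of d a] d by (intro exI[of _ "\<Sum>n<d. smul (a n) (e n)"]) simp
  show "\<exists>j C. \<forall>x. cmod (coef x k) \<le> C * q j x" if "k \<in> {..<d}" for k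
    using that d by (intro coef_continuous) simp
  show "\<exists>m C. \<forall>x r. (\<forall>k\<in>{..<d}. k \<le> m \<longrightarrow> cmod (coef x k) \<le> r) \<longrightarrow> 0 \<le> r \<longrightarrow> q j x \<le> C * r" for j
  proof (intro exI[of _ d] exI[of _ "\<Sum>k<d. q j (e k)"] allI impI)
    fix x r assume r: "\<forall>k\<in>{..<d}. k \<le> d \<longrightarrow> cmod (coef x k) \<le> r" "0 \<le> (r::real)"
    have "q j x = q j (\<Sum>k<d. smul (coef x k) (e k))" using partial_full[OF d, of x] by (simp add: partial_def)
    also have "\<dots> \<le> (\<Sum>k<d. q j (smul (coef x k) (e k)))" by (rule q_sum_le)
    also have "\<dots> \<le> (\<Sum>k<d. r * q j (e k))" unfolding q_smul using r by (intro sum_mono mult_right_mono) auto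
    finally show "q j x \<le> (\<Sum>k<d. q j (e k)) * r" by (simp add: sum_distrib_left mult.commute)
  qed
qed

text \<open>
  For each seminorm only finitely many terms of a series \<open>\<Sum> a\<^sub>n e\<^sub>n\<close> are visible.  So every such series
  converges, and each seminorm is controlled by finitely many coefficients.
\<close>

lemma isomorphic_omega_if_flat:
  assumes N: "N = \<infinity>" and flat: "\<And>j. finite {n. q j (e n) \<noteq> 0}"
  shows "isomorphic_spaces smul q omega_scale omega_seminorm"
proof (rule isomorphic_omegaI[of _ _ coef])
  show "seminormed_space smul q" by (rule seminormed_space_axioms)
  show "coef (x + y) k = coef x k + coef y k" for x y k by (simp add: coef_add)
  show "coef (smul a x) k = a * coef x k" for a x k by (simp add: coef_scale)
  show "x = 0" if "\<And>k. coef x k = 0" for x using that by (rule eq_0_if_coef_0)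
  show "\<exists>j C. \<forall>x. cmod (coef x k) \<le> C * q j x" for k by (rule coef_continuous) (simp add: N)
  have "\<exists>M. \<forall>n\<ge>M. q j (e n) = 0" for j
  proof -
    obtain M where "\<forall>n\<in>{n. q j (e n) \<noteq> 0}. n < M" using flat finite_nat_set_iff_bounded by blast
    then show ?thesis by (intro exI[of _ M]) force
  qed
  then obtain M where M: "\<And>j n. M j \<le> n \<Longrightarrow> q j (e n) = 0" by metis
  have stable: "q j ((\<Sum>n<l. smul (a n) (e n)) - (\<Sum>n<M j. smul (a n) (e n))) = 0" if "M j \<le> l" for a l j
    using that
  proof (induction l rule: dec_induct)
    case (step l)
    have "q j ((\<Sum>n<Suc l. smul (a n) (e n)) - (\<Sum>n<M j. smul (a n) (e n)))
        \<le> q j ((\<Sum>n<l. smul (a n) (e n)) - (\<Sum>n<M j. smul (a n) (e n))) + q j (smul (a l) (e l))"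
      using q_triangle[of j "(\<Sum>n<l. smul (a n) (e n)) - (\<Sum>n<M j. smul (a n) (e n))" "smul (a l) (e l)"]
      by (simp add: algebra_simps)
    also have "\<dots> = 0" using step M[of j l] by (simp add: q_smul)
    finally show ?case by (intro antisym) auto
  qed simp
  show "\<exists>x. \<forall>i. coef x i = a i" for a
  proof -
    have "\<exists>L. \<forall>l\<ge>L. \<forall>l'\<ge>L. q j ((\<Sum>n<l. smul (a n) (e n)) - (\<Sum>n<l'. smul (a n) (e n))) < r" if "0 < r" for j r
    proof (intro exI[of _ "M j"] allI impI)
      fix l l' assume l: "l \<ge> M j" "l' \<ge> M j"
      let ?s = "\<lambda>l. \<Sum>n<l. smul (a n) (e n)"
      have "q j (?s l - ?s l') \<le> q j (?s l - ?s (M j)) + q j (?s (M j) - ?s l')" by (rule q_triangle_diff)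
      also have "\<dots> = 0" using stable[OF l(1), of a] stable[OF l(2), of a] q_diff_commute[of j "?s (M j)" "?s l'"] by simp
      finally show "q j (?s l - ?s l') < r" using that by simp
    qed
    then obtain x where "\<And>j. (\<lambda>m. q j ((\<Sum>n<m. smul (a n) (e n)) - x)) \<longlonglongrightarrow> 0"
      using Cauchy_limit[of "\<lambda>l. \<Sum>n<l. smul (a n) (e n)"] by blast
    then have "coef x = a" by (intro coef_eqI) (auto simp: N)
    then show ?thesis by blast
  qed
  show "\<exists>m C. \<forall>x. q j x \<le> C * omega_seminorm m (coef x)" for j
  proof (intro exI[of _ "M j"] exI[of _ "\<Sum>k<M j. q j (e k)"] allI)
    fix x
    let ?r = "omega_seminorm (M j) (coef x)"
    have "q j (x - partial (M j) x) \<le> 0"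
    proof (rule q_limit_le[OF partial_tendsto])
      show "eventually (\<lambda>m. q j (partial m x - partial (M j) x) \<le> 0) sequentially"
        using eventually_ge_at_top[of "M j"]
      proof eventually_elim
        case (elim m)
        then show ?case using stable[OF elim, of "coef x"] by (simp add: partial_def)
      qed
    qed
    then have "q j x \<le> q j (partial (M j) x)" using q_triangle[of j "x - partial (M j) x" "partial (M j) x"] by simp
    also have "\<dots> \<le> (\<Sum>k<M j. q j (smul (coef x k) (e k)))" unfolding partial_def by (rule q_sum_le)
    also have "\<dots> \<le> (\<Sum>k<M j. ?r * q j (e k))"
      unfolding q_smul by (intro sum_mono mult_right_mono omega_seminorm_ge) auto
    finally show "q j x \<le> (\<Sum>k<M j. q j (e k)) * ?r" by (simp add: sum_distrib_left mult.commute)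
  qed
qed

end

lemma seq_isomorphic_omega_if_omega:
  assumes X: "frechet_space smul q" and iso: "isomorphic_spaces smul q omega_scale omega_seminorm"
  shows "isomorphic_spaces (seq_scale smul) (seq_seminorm q) omega_scale omega_seminorm"
proof -
  interpret frechet_space smul q by fact
  obtain s where s: "\<And>x y i. s (x + y) i = s x i + s y i" "\<And>a x i. s (smul a x) i = a * s x i"
    "\<And>x. s x = (\<lambda>i. 0) \<Longrightarrow> x = 0" "\<And>a. \<exists>x. \<forall>i. s x i = a i"
    "\<And>i. \<exists>j C. \<forall>x. cmod (s x i) \<le> C * q j x" "\<And>j. \<exists>m C. \<forall>x. q j x \<le> C * omega_seminorm m (s x)"
    by (rule isomorphic_omegaD[OF seminormed_space_axioms iso]) (rule that)
  show ?thesis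
  proof (rule seq_isomorphic_omega[OF X, of UNIV s])
    show "s (x + y) k = s x k + s y k" "s (smul a x) k = a * s x k" for x y a k by (rule s(1) s(2))+
    show "x = 0" if "\<And>k. k \<in> UNIV \<Longrightarrow> s x k = 0" for x using that by (intro s(3) ext) simp
    show "\<exists>x. \<forall>k\<in>UNIV. s x k = a k" for a using s(4)[of a] by simp
    show "\<exists>j C. \<forall>x. cmod (s x k) \<le> C * q j x" for k by (rule s(5))
    show "\<exists>m C. \<forall>x r. (\<forall>k\<in>UNIV. k \<le> m \<longrightarrow> cmod (s x k) \<le> r) \<longrightarrow> 0 \<le> r \<longrightarrow> q j x \<le> C * r" for j
    proof -
      obtain m C where C: "\<And>x. q j x \<le> C * omega_seminorm m (s x)" using s(6) by blast
      have "q j x \<le> \<bar>C\<bar> * r" if "\<forall>k\<in>UNIV. k \<le> m \<longrightarrow> cmod (s x k) \<le> r" "0 \<le> r" for x r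
      proof -
        have om: "omega_seminorm m (s x) \<le> r" using that by (simp add: omega_seminorm_le_iff)
        have om0: "0 \<le> omega_seminorm m (s x)" by (rule order.trans[OF norm_ge_zero omega_seminorm_ge[of 0]]) simp
        have "q j x \<le> C * omega_seminorm m (s x)" by (rule C)
        also have "\<dots> \<le> \<bar>C\<bar> * r" using om om0 by (intro mult_mono) auto
        finally show ?thesis .
      qed
      then show ?thesis by blast
    qed
  qed simp
qed

section \<open>Blocks, levels and the transposed shift\<close>

text \<open>
  Block \<open>\<sigma>\<close> consists of the indices from \<open>b = block_start \<sigma>\<close> to \<open>b + b 3\<^sup>\<sigma> - 1\<close>, and its last \<open>b 3\<^sup>k\<close>
  indices are those of level at most \<open>k\<close>.  The factor \<open>3\<close> makes the stretch of level \<open>k + 1\<close> twice as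
  long as the stretch of level at most \<open>k\<close>, and the stretch of level \<open>0\<close> is as long as everything
  before the block; both are used in the comparison of degrees.  Index \<open>0\<close> precedes block
  \<open>0\<close> and has level \<open>0\<close>.
\<close>

primrec block_start :: "nat \<Rightarrow> nat" where
  "block_start 0 = 1"
| "block_start (Suc \<sigma>) = block_start \<sigma> * (1 + 3 ^ \<sigma>)"

definition block_of :: "nat \<Rightarrow> nat" where
  "block_of i = (LEAST \<sigma>. i < block_start (Suc \<sigma>))"

definition level :: "nat \<Rightarrow> nat" where
  "level i = (if i = 0 then 0 else
     LEAST k. block_start (Suc (block_of i)) - i \<le> block_start (block_of i) * 3 ^ k)"

definition block_end :: "nat \<Rightarrow> bool" where
  "block_end i \<longleftrightarrow> (\<exists>\<sigma>. Suc i = block_start (Suc \<sigma>))"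

text \<open>
  The transpose of the operator \<open>T\<close>: if \<open>x i = \<xi> (f\<^sub>i)\<close>, then \<open>adj x i = \<xi> (T f\<^sub>i)\<close>.  It is applied to
  complex sequences and, for estimates, to nonnegative real ones.
\<close>

definition adj :: "(nat \<Rightarrow> 'b::comm_monoid_add) \<Rightarrow> nat \<Rightarrow> 'b" where
  "adj x i = x (Suc i) + (if block_end i then x 0 else 0)"

lemma block_start_pos [simp]: "0 < block_start \<sigma>"
  by (induction \<sigma>) auto

lemma block_start_double: "2 * block_start \<sigma> \<le> block_start (Suc \<sigma>)"
proof -
  have "(2::nat) \<le> 1 + 3 ^ \<sigma>" by simp
  then have "block_start \<sigma> * 2 \<le> block_start \<sigma> * (1 + 3 ^ \<sigma>)" by (rule mult_le_mono2)
  then show ?thesis by (simp del: One_nat_def add: mult.commute)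
qed

lemma block_start_strict_mono: "strict_mono block_start"
proof (rule strict_mono_Suc_iff[THEN iffD2], rule allI)
  fix \<sigma> show "block_start \<sigma> < block_start (Suc \<sigma>)"
    using block_start_double[of \<sigma>] block_start_pos[of \<sigma>] by linarith
qed

declare block_start.simps(2) [simp del]

lemma block_start_mono: "\<sigma> \<le> \<tau> \<Longrightarrow> block_start \<sigma> \<le> block_start \<tau>"
  using block_start_strict_mono by (simp add: strict_mono_less_eq)

lemma block_start_gt: "\<sigma> < block_start \<sigma>"
proof (induction \<sigma>)
  case (Suc \<sigma>)
  then show ?case using block_start_strict_mono strict_mono_Suc_iff[of block_start] by (metis Suc_leI le_less_trans)
qed auto

lemma block_ofI: "block_start \<sigma> \<le> i \<Longrightarrow> i < block_start (Suc \<sigma>) \<Longrightarrow> block_of i = \<sigma>"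
  unfolding block_of_def
proof (rule Least_equality)
  fix \<tau> assume a: "block_start \<sigma> \<le> i" "i < block_start (Suc \<tau>)"
  then have "block_start \<sigma> < block_start (Suc \<tau>)" by simp
  then show "\<sigma> \<le> \<tau>" using block_start_strict_mono by (simp add: strict_mono_less)
qed

lemma block_of_less: "i < block_start (Suc (block_of i))"
proof -
  have "i < block_start (Suc i)" using block_start_gt[of "Suc i"] by linarith
  then show ?thesis unfolding block_of_def by (rule LeastI)
qed

lemma block_of_ge: "0 < i \<Longrightarrow> block_start (block_of i) \<le> i"
proof (rule ccontr)
  assume i: "0 < i" and "\<not> block_start (block_of i) \<le> i"
  then have l: "i < block_start (block_of i)" by simp
  then obtain \<tau> where t: "block_of i = Suc \<tau>" using i by (cases "block_of i") auto
  then have "block_of i \<le> \<tau>" using l unfolding block_of_def by (metis Least_le t)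
  then show False using t by simp
qed

lemma block_of_mono: "i \<le> j \<Longrightarrow> block_of i \<le> block_of j"
  unfolding block_of_def[of i] by (rule Least_le) (use block_of_less[of j] in simp)

lemma block_of_0 [simp]: "block_of 0 = 0"
  unfolding block_of_def by (rule Least_equality) auto

lemma level_0 [simp]: "level 0 = 0" by (simp add: level_def)

lemma level_le_iff:
  assumes "0 < i"
  shows "level i \<le> k \<longleftrightarrow> block_start (Suc (block_of i)) \<le> i + block_start (block_of i) * 3 ^ k"
proof -
  let ?P = "\<lambda>k. block_start (Suc (block_of i)) - i \<le> block_start (block_of i) * 3 ^ k"
  have P: "?P (block_of i)" using block_of_ge[OF assms] by (simp add: algebra_simps block_start.simps)
  have lev: "level i = (LEAST k. ?P k)" using assms by (simp add: level_def)
  have "?P (level i)" unfolding lev by (rule LeastI[of ?P, OF P])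
  moreover have "?P k \<Longrightarrow> level i \<le> k" unfolding lev by (rule Least_le)
  moreover have "?P k \<Longrightarrow> k \<le> l \<Longrightarrow> ?P l" for k l
    by (meson le_trans mult_le_mono2 power_increasing one_le_numeral)
  ultimately have "level i \<le> k \<longleftrightarrow> ?P k" by blast
  then show ?thesis by linarith
qed

lemma level_le_block: "level i \<le> block_of i"
proof (cases "i = 0")
  case False then show ?thesis using level_le_iff[of i "block_of i"] block_of_ge[of i] by (simp add: algebra_simps block_start.simps)
qed auto

lemma level_le_in_block:
  assumes "block_start \<sigma> \<le> i" "i < block_start (Suc \<sigma>)"
  shows "level i \<le> k \<longleftrightarrow> block_start (Suc \<sigma>) \<le> i + block_start \<sigma> * 3 ^ k"
proof -
  have "0 < i" using assms(1) block_start_pos[of \<sigma>] by linarith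
  then show ?thesis using level_le_iff[of i k] block_ofI[OF assms] by simp
qed

lemma not_block_end: "block_start \<sigma> \<le> i \<Longrightarrow> Suc i < block_start (Suc \<sigma>) \<Longrightarrow> \<not> block_end i"
proof
  assume a: "block_start \<sigma> \<le> i" "Suc i < block_start (Suc \<sigma>)" "block_end i"
  then obtain \<tau> where t: "Suc i = block_start (Suc \<tau>)" unfolding block_end_def by blast
  then have "block_start \<sigma> < block_start (Suc \<tau>)" "block_start (Suc \<tau>) < block_start (Suc \<sigma>)" using a by auto
  then show False using block_start_strict_mono by (simp add: strict_mono_less)
qed

lemma adj_funpow_Suc:
  "(adj ^^ Suc s) x i = (adj ^^ s) x (Suc i) + (if block_end i then (adj ^^ s) x 0 else 0)"
  by (simp add: adj_def[of "(adj ^^ s) x"])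

lemma adj_funpow_cong:
  "(\<And>j. j \<le> i + s \<Longrightarrow> x j = x' j) \<Longrightarrow> (adj ^^ s) x i = (adj ^^ s) x' i"
proof (induction s arbitrary: i)
  case (Suc s)
  have "(adj ^^ s) x (Suc i) = (adj ^^ s) x' (Suc i)" "(adj ^^ s) x 0 = (adj ^^ s) x' 0"
    by (rule Suc.IH; use Suc.prems in force)+
  then show ?case unfolding adj_funpow_Suc by simp
qed auto

text \<open>
  After at least one step \<open>i\<close> itself has been left; what can be reached are the indices after \<open>i\<close> and,
  through a return to \<open>0\<close>, those below \<open>s\<close>.
\<close>

lemma adj_funpow_cong':
  assumes "0 < s" "\<And>j. j < s \<Longrightarrow> x j = x' j" "\<And>j. i < j \<Longrightarrow> j \<le> i + s \<Longrightarrow> x j = x' j"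
  shows "(adj ^^ s) x i = (adj ^^ s) x' i"
  using assms
proof (induction s arbitrary: i)
  case (Suc s)
  have 1: "(adj ^^ s) x (Suc i) = (adj ^^ s) x' (Suc i)"
  proof (cases "s = 0")
    case True then show ?thesis using Suc.prems by simp
  next
    case False show ?thesis by (rule Suc.IH; use Suc.prems False in force)
  qed
  have 2: "(adj ^^ s) x 0 = (adj ^^ s) x' 0" by (rule adj_funpow_cong) (use Suc.prems in auto)
  show ?case using 1 2 unfolding adj_funpow_Suc by simp
qed auto

lemma adj_funpow_straight:
  "(\<And>j. i \<le> j \<Longrightarrow> j < i + s \<Longrightarrow> \<not> block_end j) \<Longrightarrow> (adj ^^ s) x i = x (i + s)"
proof (induction s arbitrary: i)
  case (Suc s)
  have "(adj ^^ s) x (Suc i) = x (Suc i + s)" by (rule Suc.IH) (use Suc.prems in auto)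
  then show ?case using Suc.prems[of i] unfolding adj_funpow_Suc by simp
qed auto

lemma adj_funpow_norm_le:
  fixes x :: "nat \<Rightarrow> complex" and r :: "nat \<Rightarrow> real"
  assumes "\<And>i. cmod (x i) \<le> r i"
  shows "cmod ((adj ^^ s) x i) \<le> (adj ^^ s) r i"
  using assms
proof (induction s arbitrary: i)
  case (Suc s)
  then show ?case unfolding adj_funpow_Suc by (auto intro!: order.trans[OF norm_triangle_ineq] add_mono)
qed auto

lemma adj_funpow_cmult:
  fixes x :: "nat \<Rightarrow> complex"
  shows "(adj ^^ s) (\<lambda>i. c * x i) i = c * (adj ^^ s) x i"
  by (induction s arbitrary: i) (simp_all add: adj_funpow_Suc algebra_simps del: funpow.simps(2))

text \<open>
  \<open>bpoly i\<close> is the polynomial \<open>p\<close> with \<open>p(T) f\<^sub>0 = f\<^sub>i\<close>, so that \<open>T\<close> becomes multiplication by the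
  variable.
\<close>

primrec bpoly :: "nat \<Rightarrow> complex poly" where
  "bpoly 0 = 1"
| "bpoly (Suc i) = monom 1 1 * bpoly i - (if block_end i then 1 else 0)"

text \<open>
  The value \<open>\<xi> (p(T) f\<^sub>0)\<close> of the functional with \<open>\<xi> (f\<^sub>i) = x i\<close>.
\<close>

definition pairing :: "(nat \<Rightarrow> complex) \<Rightarrow> complex poly \<Rightarrow> complex" where
  "pairing x = dual_pair (\<lambda>s. (adj ^^ s) x 0)"

lemma pairing_add: "pairing x (p + p') = pairing x p + pairing x p'"
  and pairing_smult: "pairing x (smult c p) = c * pairing x p"
  and pairing_sum: "pairing x (\<Sum>i\<in>A. h i) = (\<Sum>i\<in>A. pairing x (h i))"
  and pairing_monom: "pairing x (monom 1 s) = (adj ^^ s) x 0"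
  by (simp_all add: pairing_def dual_pair_add dual_pair_smult dual_pair_sum dual_pair_monom)

lemma pairing_0 [simp]: "pairing x 0 = 0"
  by (simp add: pairing_def)

lemma pairing_diff: "pairing x (p - p') = pairing x p - pairing x p'"
  using pairing_add[of x "p - p'" p'] by simp

lemma pairing_bpoly: "pairing x (monom 1 s * bpoly i) = (adj ^^ s) x i"
proof (induction i arbitrary: s)
  case (Suc i)
  have "monom 1 s * bpoly (Suc i) = monom 1 (Suc s) * bpoly i - (if block_end i then monom 1 s else 0)"
    by (simp add: algebra_simps mult_monom flip: mult.assoc)
  then show ?case by (simp add: pairing_diff Suc pairing_monom adj_funpow_Suc del: funpow.simps(2))
qed (simp add: pairing_monom)

lemma degree_bpoly_le: "degree (bpoly i) \<le> i"
proof (induction i)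
  case (Suc i)
  have "degree (monom 1 1 * bpoly i) \<le> Suc i"
    by (rule order.trans[OF degree_mult_le]) (use Suc degree_monom_le[of "1::complex" 1] in linarith)
  then show ?case by (auto intro!: degree_diff_le)
qed auto

lemma lead_coeff_bpoly: "coeff (bpoly i) i = 1"
  by (induction i) (auto simp: monom_Suc one_pCons coeff_pCons)

lemma bpoly_straight: "(\<And>j. i \<le> j \<Longrightarrow> j < i + s \<Longrightarrow> \<not> block_end j) \<Longrightarrow> bpoly (i + s) = monom 1 s * bpoly i"
proof (induction s)
  case (Suc s)
  then show ?case by (simp add: mult_monom flip: mult.assoc)
qed auto

lemma recurrence_zero:
  fixes z :: "nat \<Rightarrow> complex" and p :: "complex poly"
  assumes "p \<noteq> 0" "\<And>j. j < degree p \<Longrightarrow> z j = 0"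
    and "\<And>s. s + degree p \<le> n \<Longrightarrow> (\<Sum>i\<le>degree p. coeff p i * z (i + s)) = 0"
  shows "j \<le> n \<Longrightarrow> z j = 0"
proof (induction j rule: less_induct)
  case (less j)
  show ?case
  proof (cases "j < degree p")
    case True then show ?thesis using assms by simp
  next
    case False
    define s where "s = j - degree p"
    have s: "j = degree p + s" using False by (simp add: s_def)
    have "0 = (\<Sum>i\<le>degree p. coeff p i * z (i + s))" using assms(3)[of s] less.prems s by simp
    also have "\<dots> = (\<Sum>i\<in>{degree p}. coeff p i * z (i + s))"
      by (rule sum.mono_neutral_right) (use less s in auto)
    finally show ?thesis using assms(1) s by simp
  qed
qed

section \<open>A finite shift with one return has no annihilating pair\<close>

lemma pairing_monom_mult_sum:
  "pairing x (monom 1 s * (\<Sum>i\<in>A. smult (y i) (bpoly i))) = (\<Sum>i\<in>A. y i * (adj ^^ s) x i)"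
  by (simp add: sum_distrib_left pairing_sum pairing_smult pairing_bpoly)

lemma pairing_mult_eq_0:
  assumes "\<And>l. l \<le> degree p \<Longrightarrow> pairing x (monom 1 l * r) = 0"
  shows "pairing x (p * r) = 0"
proof -
  have "p * r = (\<Sum>l\<le>degree p. monom (coeff p l) l) * r" by (simp add: poly_as_sum_of_monoms)
  also have "\<dots> = (\<Sum>l\<le>degree p. smult (coeff p l) (monom 1 l * r))"
    by (simp add: sum_distrib_right smult_monom flip: mult_smult_left)
  finally show ?thesis using assms by (simp add: pairing_sum pairing_smult)
qed

text \<open>
  Here \<open>x i\<close> stands for \<open>\<xi> (f\<^sub>i)\<close> and \<open>y\<close> for the coordinates of a vector, both cut off after block \<open>\<sigma>\<close>.
  Suppose that all the sums vanish.  Modulo \<open>bpoly b' = t^(b' - b) bpoly b - 1\<close>, multiplication by \<open>t\<^sup>h\<close> turns the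
  last \<open>h\<close> vectors of the block into \<open>1, t, \<dots>\<close>, so \<open>t\<^sup>h\<close> times the vector is represented by a
  polynomial \<open>Y'\<close> of degree less than \<open>b' - 2 h\<close>.  The values of the functional along the orbit of
  \<open>f\<^sub>b\<close> satisfy the linear recurrence with characteristic polynomial \<open>Y'\<close>.  They begin with
  \<open>b' - b - h\<close> zeros, at least as many as the degree of \<open>Y'\<close>, and hence remain zero; but after
  \<open>b' - b\<close> steps the value is \<open>x 0\<close>.
\<close>

lemma correlation_nonzero:
  fixes x y :: "nat \<Rightarrow> complex" and \<sigma> k :: nat
  defines "b \<equiv> block_start \<sigma>" and "b' \<equiv> block_start (Suc \<sigma>)" 
  defines "h \<equiv> b * 3 ^ k"
  assumes k: "k < \<sigma>"
    and x0: "x 0 \<noteq> 0" and xgap: "\<And>i. b \<le> i \<Longrightarrow> i < b' - h \<Longrightarrow> x i = 0" and xend: "\<And>i. b' \<le> i \<Longrightarrow> x i = 0"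
    and y: "i0 < b'" "y i0 \<noteq> 0" and ygap: "\<And>i. b' - 3 * h \<le> i \<Longrightarrow> i < b' - h \<Longrightarrow> y i = 0"
  shows "\<exists>s\<in>{1..2 * b'}. (\<Sum>i<b'. y i * (adj ^^ s) x i) \<noteq> 0"
proof (rule ccontr)
  assume "\<not> ?thesis"
  then have vanish: "(\<Sum>i<b'. y i * (adj ^^ s) x i) = 0" if "1 \<le> s" "s \<le> 2 * b'" for s
    using that by auto
  have b: "0 < b" by (simp add: b_def)
  have b': "b' = b + b * 3 ^ \<sigma>" by (simp add: b_def b'_def block_start.simps algebra_simps)
  have h: "b \<le> h" by (simp add: h_def)
  have "b * 3 ^ Suc k \<le> b * 3 ^ \<sigma>" using k by (intro mult_le_mono2 power_increasing) auto
  then have h3: "3 * h + b \<le> b'" by (simp add: b' h_def)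
  define t where "t = (\<lambda>s. monom (1::complex) s)"
  have tt: "t s * t r = t (s + r)" for s r by (simp add: t_def mult_monom)
  have ttl: "t s * (t r * p) = t (s + r) * p" for s r p by (simp add: tt flip: mult.assoc)
  define Y where "Y = (\<Sum>i<b'. smult (y i) (bpoly i))"
  \<comment> \<open>The last \<open>h\<close> coordinates of the block, which multiplication by \<open>t h\<close> carries to \<open>1, t, \<dots>\<close>.\<close>
  define R where "R = (\<Sum>j<h. smult (y (b' - h + j)) (t j))"
  define Y' where "Y' = t h * (\<Sum>i<b' - 3 * h. smult (y i) (bpoly i)) + R"
  have inblock: "bpoly (b + j) = t j * bpoly b" if "b + j < b'" for j
    unfolding t_def by (rule bpoly_straight) (use that not_block_end[of \<sigma>] in \<open>auto simp: b_def b'_def\<close>)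
  have last: "bpoly b' = t (b' - b) * bpoly b - 1"
  proof -
    obtain n where n: "b' = Suc n" using h3 h b by (cases b') auto
    have n': "b \<le> n" using n h3 h b by linarith
    from n have "block_end n" unfolding block_end_def b'_def by (intro exI[of _ \<sigma>]) simp
    then have "bpoly b' = t 1 * bpoly n - 1" by (simp add: n t_def)
    also have "bpoly n = t (n - b) * bpoly b" using inblock[of "n - b"] n n' by simp
    finally show ?thesis using n n' by (simp add: ttl Suc_diff_le)
  qed
  have key: "t h * Y = Y' + R * bpoly b'"
  proof -
    have "Y = (\<Sum>i<b' - 3 * h. smult (y i) (bpoly i)) + (\<Sum>i\<in>{b' - 3 * h..<b'}. smult (y i) (bpoly i))"
      unfolding Y_def by (subst sum.union_disjoint[symmetric]) (auto intro!: sum.cong simp: ivl_disj_un)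
    also have "(\<Sum>i\<in>{b' - 3 * h..<b'}. smult (y i) (bpoly i)) = (\<Sum>i\<in>{b' - h..<b'}. smult (y i) (bpoly i))"
      by (rule sum.mono_neutral_right) (use ygap h3 in auto)
    also have "\<dots> = (\<Sum>j<h. smult (y (b' - h + j)) (bpoly (b' - h + j)))"
    proof -
      have "b' - (b' - h) = h" using h3 by simp
      then show ?thesis
        by (subst sum.atLeastLessThan_shift_0) (simp add: lessThan_atLeast0 del: diff_diff_cancel)
    qed
    finally have Y: "Y = (\<Sum>i<b' - 3 * h. smult (y i) (bpoly i)) + (\<Sum>j<h. smult (y (b' - h + j)) (bpoly (b' - h + j)))" .
    have "t h * bpoly (b' - h + j) = t j * (bpoly b' + 1)" if "j < h" for j
    proof -
      have "b' - h + j = b + (b' - b - h + j)" using h3 by simp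
      then have "bpoly (b' - h + j) = t (b' - b - h + j) * bpoly b" using inblock[of "b' - b - h + j"] that h3 by simp
      then have "t h * bpoly (b' - h + j) = t (h + (b' - b - h + j)) * bpoly b" by (simp only: ttl)
      also have "h + (b' - b - h + j) = j + (b' - b)" using h3 by simp
      finally show ?thesis unfolding last by (simp add: ttl)
    qed
    then have "(\<Sum>j<h. smult (y (b' - h + j)) (t h * bpoly (b' - h + j))) = R * bpoly b' + R"
      unfolding R_def sum_distrib_right by (simp add: algebra_simps smult_add_right sum.distrib)
    then show ?thesis unfolding Y Y'_def by (simp add: algebra_simps sum_distrib_left)
  qed
  have xs: "(adj ^^ s) x b' = 0" if "s \<le> 2 * b'" for s
  proof -
    have "2 * b' < block_start (Suc (Suc \<sigma>)) - b'"
    proof -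
      have "(3::nat) \<le> 3 ^ Suc \<sigma>" by simp
      then have "b' * 3 \<le> b' * 3 ^ Suc \<sigma>" by (rule mult_le_mono2)
      then show ?thesis using b b' by (simp add: block_start.simps(2)[of "Suc \<sigma>"] flip: b'_def)
    qed
    then have "(adj ^^ s) x b' = x (b' + s)"
      by (intro adj_funpow_straight not_block_end[of "Suc \<sigma>"]) (use that in \<open>auto simp: b'_def\<close>)
    then show ?thesis using xend by simp
  qed
  have pY: "pairing x (t s * Y) = 0" if "1 \<le> s" "s \<le> 2 * b'" for s
    unfolding Y_def t_def pairing_monom_mult_sum by (rule vanish[OF that])
  have degR: "degree R < h"
    unfolding R_def t_def using h b
    by (intro degree_sum_less) (auto intro!: le_less_trans[OF degree_smult_le] le_less_trans[OF degree_monom_le])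
  \<comment> \<open>The functional along the orbit of the first vector of the block.\<close>
  define z where "z = (\<lambda>j. pairing x (t j * bpoly b))"
  have z: "z j = (adj ^^ j) x b" for j by (simp add: z_def t_def pairing_bpoly)
  have rec: "pairing x (t s * (Y' * bpoly b)) = 0" if s: "s \<le> b' - b" for s
  proof -
    have Y'eq: "Y' = t h * Y - R * bpoly b'" using key by simp
    have "t s * (Y' * bpoly b) = bpoly b * (t (s + h) * Y) - (t s * R * bpoly b) * bpoly b'"
      unfolding Y'eq tt[symmetric] by (simp only: algebra_simps)
    moreover have "pairing x (bpoly b * (t (s + h) * Y)) = 0"
    proof (rule pairing_mult_eq_0)
      fix l assume "l \<le> degree (bpoly b)"
      then have "l \<le> b" using degree_bpoly_le[of b] by simp
      then have "pairing x (t (l + (s + h)) * Y) = 0" by (intro pY) (use s h h3 b in auto)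
      then show "pairing x (monom 1 l * (t (s + h) * Y)) = 0" by (simp add: ttl flip: t_def)
    qed
    moreover have "pairing x ((t s * R * bpoly b) * bpoly b') = 0"
    proof (rule pairing_mult_eq_0)
      fix l assume l: "l \<le> degree (t s * R * bpoly b)"
      have "degree (t s * R * bpoly b) \<le> degree (t s) + degree R + degree (bpoly b)"
        by (meson add_le_mono1 degree_mult_le le_trans)
      then have "l \<le> s + h + b" using l degR degree_bpoly_le[of b] degree_monom_le[of "1::complex" s] by (simp add: t_def)
      then have "l \<le> 2 * b'" using s h3 by simp
      then show "pairing x (monom 1 l * bpoly b') = 0" using xs by (simp add: pairing_bpoly)
    qed
    ultimately show ?thesis by (simp add: pairing_diff)
  qed
  have degY': "degree Y' < b' - 2 * h"
    unfolding Y'_def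
  proof (rule degree_add_less)
    have "degree (\<Sum>i<b' - 3 * h. smult (y i) (bpoly i)) < b' - 3 * h"
      by (rule degree_sum_less) (use h3 b in \<open>auto intro!: le_less_trans[OF degree_smult_le] le_less_trans[OF degree_bpoly_le]\<close>)
    then show "degree (t h * (\<Sum>i<b' - 3 * h. smult (y i) (bpoly i))) < b' - 2 * h"
      using degree_mult_le[of "t h" "\<Sum>i<b' - 3 * h. smult (y i) (bpoly i)"] degree_monom_le[of "1::complex" h] h3
      by (simp add: t_def)
    show "degree R < b' - 2 * h" using degR h3 b by simp
  qed
  have Y'nz: "Y' \<noteq> 0"
  proof
    assume Y0: "Y' = 0"
    have R0: "R = 0"
    proof (rule poly_eqI)
      fix n
      show "coeff R n = coeff 0 n"
      proof (cases "n < h")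
        case True
        then have "coeff Y' n = coeff R n" by (simp add: Y'_def t_def coeff_monom_mult)
        then show ?thesis using Y0 by simp
      qed (use degR in \<open>simp add: coeff_eq_0\<close>)
    qed
    have "\<forall>i<n. y i = 0" if "(\<Sum>i<n. smult (y i) (bpoly i)) = 0" for n
      using that
    proof (induction n)
      case (Suc n)
      have "0 = coeff (\<Sum>i<Suc n. smult (y i) (bpoly i)) n" using Suc.prems by simp
      also have "\<dots> = (\<Sum>i<Suc n. y i * coeff (bpoly i) n)" by (simp add: coeff_sum)
      also have "\<dots> = (\<Sum>i\<in>{n}. y i * coeff (bpoly i) n)"
        by (rule sum.mono_neutral_right) (auto intro!: coeff_eq_0 le_less_trans[OF degree_bpoly_le])
      finally have "y n = 0" by (simp add: lead_coeff_bpoly)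
      then show ?case using Suc by (auto simp: less_Suc_eq)
    qed auto
    moreover have "(\<Sum>i<b'. smult (y i) (bpoly i)) = 0" using key Y0 R0 by (simp add: Y_def t_def)
    ultimately show False using y by blast
  qed
  have z0: "z j = 0" if j: "j < b' - b - h" for j
  proof -
    have "(adj ^^ j) x b = x (b + j)"
      by (intro adj_funpow_straight not_block_end[of \<sigma>]) (use j in \<open>auto simp: b_def b'_def\<close>)
    then show ?thesis using xgap[of "b + j"] j by (simp add: z)
  qed
  have "z (b' - b) = 0"
  proof (rule recurrence_zero[of Y' z "b' - b"])
    show "z j = 0" if "j < degree Y'" for j using z0[of j] that degY' h h3 by simp
    fix s assume "s + degree Y' \<le> b' - b"
    then have "0 = pairing x (t s * (Y' * bpoly b))" using rec by simp
    also have "t s * (Y' * bpoly b) = (\<Sum>i\<le>degree Y'. smult (coeff Y' i) (t (i + s) * bpoly b))"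
    proof -
      have "Y' = (\<Sum>i\<le>degree Y'. smult (coeff Y' i) (t i))"
        by (simp add: t_def smult_monom poly_as_sum_of_monoms)
      then have "t s * (Y' * bpoly b) = t s * ((\<Sum>i\<le>degree Y'. smult (coeff Y' i) (t i)) * bpoly b)" by simp
      then show ?thesis by (simp add: sum_distrib_right sum_distrib_left ttl add.commute)
    qed
    also have "pairing x \<dots> = (\<Sum>i\<le>degree Y'. coeff Y' i * z (i + s))"
      by (simp add: pairing_sum pairing_smult z_def)
    finally show "(\<Sum>i\<le>degree Y'. coeff Y' i * z (i + s)) = 0" by simp
  qed (use Y'nz in auto)
  moreover have "z (b' - b) = x 0"
  proof -
    have "z (b' - b) = pairing x (monom 1 0 * bpoly b' + monom 1 0 * bpoly 0)" unfolding z_def using last by (simp add: one_pCons monom_0)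
    also have "\<dots> = x b' + x 0" unfolding pairing_add pairing_bpoly by simp
    finally show ?thesis using xend by simp
  qed
  ultimately show False using x0 by simp
qed

section \<open>Choice of the sizes\<close>

lemma continuous_adj_funpow: "continuous_on S (\<lambda>x :: nat \<Rightarrow> complex. (adj ^^ s) x i)"
proof (induction s arbitrary: i)
  case 0
  have "continuous_on S (\<lambda>x :: nat \<Rightarrow> complex. x i)"
    by (rule continuous_on_subset[OF continuous_on_product_coordinates]) simp
  then show ?case by simp
next
  case (Suc s)
  show ?case
  proof (cases "block_end i")
    case True
    then show ?thesis unfolding adj_funpow_Suc using continuous_on_add[OF Suc.IH[of "Suc i"] Suc.IH[of 0]] by simp
  next
    case False
    then show ?thesis unfolding adj_funpow_Suc using Suc.IH[of "Suc i"] by simp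
  qed
qed

lemma compact_product_of_compact:
  fixes S :: "nat \<Rightarrow> complex set"
  assumes "\<And>i. compact (S i)"
  shows "compact {x. \<forall>i. x i \<in> S i}"
proof -
  have "compactin (product_topology (\<lambda>i. euclidean) UNIV) (Pi\<^sub>E UNIV S)"
    using assms by (simp add: compactin_PiE)
  then show ?thesis by (simp add: euclidean_product_topology PiE_UNIV_domain Pi_def)
qed

text \<open>
  The quantitative form of \<open>correlation_nonzero\<close> for functionals bounded by \<open>r\<close> and normalized
  vectors.  The constant depends on \<open>r\<close>, that is, on sizes at levels at most \<open>k\<close> only.
\<close>

definition uniform_correlation :: "nat \<Rightarrow> nat \<Rightarrow> (nat \<Rightarrow> real) \<Rightarrow> real \<Rightarrow> bool" where
  "uniform_correlation \<sigma> k r c \<longleftrightarrow> 0 < c \<and> (\<forall>x y :: nat \<Rightarrow> complex.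
     (\<forall>i. cmod (x i) \<le> r i) \<longrightarrow> (\<forall>i\<ge>block_start (Suc \<sigma>). x i = 0) \<longrightarrow> 1 / (real \<sigma> + 1) \<le> cmod (x 0) \<longrightarrow>
     (\<forall>i. cmod (y i) \<le> 1) \<longrightarrow> (\<forall>i\<ge>block_start (Suc \<sigma>). y i = 0) \<longrightarrow>
     (\<forall>i. block_start \<sigma> \<le> i \<longrightarrow> i < block_start (Suc \<sigma>) \<longrightarrow> level i = Suc k \<longrightarrow> y i = 0) \<longrightarrow>
     (\<exists>i. cmod (y i) = 1) \<longrightarrow>
     (\<exists>s\<in>{1..2 * block_start (Suc \<sigma>)}. c \<le> cmod (\<Sum>i<block_start (Suc \<sigma>). y i * (adj ^^ s) x i)))"

text \<open>
  The admissible pairs \<open>(x, y)\<close> form a compact subset of a countable product, on which the sum of the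
  finitely many correlations is continuous and positive.
\<close>

lemma ex_uniform_correlation:
  assumes k: "k < \<sigma>" and r: "\<And>i. block_start \<sigma> \<le> i \<Longrightarrow> i < block_start (Suc \<sigma>) \<Longrightarrow> k < level i \<Longrightarrow> r i = 0"
  shows "\<exists>c. uniform_correlation \<sigma> k r c"
proof -
  define b b' where "b = block_start \<sigma>" and "b' = block_start (Suc \<sigma>)"
  define X where "X = {x. \<forall>i. x i \<in> (if i < b' then cball 0 (r i) else {0::complex})} \<inter> {x. 1 / (real \<sigma> + 1) \<le> cmod (x 0)}"
  define Y where "Y = {y. \<forall>i. y i \<in> (if i < b' \<and> \<not> (b \<le> i \<and> level i = Suc k) then cball 0 1 else {0::complex})} \<inter> (\<Union>i<b'. {y. cmod (y i) = 1})"
  define F where "F = (\<lambda>(x, y). \<Sum>s\<in>{1..2 * b'}. cmod (\<Sum>i<b'. y i * (adj ^^ s) x i))"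
  have coord: "continuous_on UNIV (\<lambda>x::nat \<Rightarrow> complex. x i)" for i
    by (rule continuous_on_product_coordinates)
  have closed_coord: "closed {y :: nat \<Rightarrow> complex. cmod (y i) = 1}" for i
    by (rule closed_Collect_eq) (intro continuous_intros coord)+
  have "compact X" unfolding X_def
    by (intro compact_Int_closed compact_product_of_compact closed_Collect_le continuous_intros coord) auto
  moreover have "compact Y" unfolding Y_def
    by (intro compact_Int_closed compact_product_of_compact closed_UN closed_coord) (auto simp: closed_coord)
  ultimately have cpt: "compact (X \<times> Y)" by (rule compact_Times)
  have "continuous_on (X \<times> Y) (\<lambda>z. (adj ^^ s) (fst z) i)" for s i
    by (rule continuous_on_compose2[OF continuous_adj_funpow[of UNIV] continuous_on_fst[OF continuous_on_id]]) auto
  moreover have "continuous_on (X \<times> Y) (\<lambda>z. snd z i)" for i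
    by (rule continuous_on_compose2[OF coord continuous_on_snd[OF continuous_on_id]]) auto
  ultimately have cont: "continuous_on (X \<times> Y) F"
    unfolding F_def case_prod_beta
    by (intro continuous_on_sum continuous_on_norm continuous_on_mult)
  have pos: "0 < F (x, y)" if xy: "x \<in> X" "y \<in> Y" for x y
  proof -
    obtain i0 where i0: "i0 < b'" "cmod (y i0) = 1" using xy(2) by (auto simp: Y_def)
    have "cmod (x 0) > 0" using xy(1) by (auto simp: X_def intro: less_le_trans[of _ "1 / (real \<sigma> + 1)"])
    have xb: "x i \<in> (if i < b' then cball 0 (r i) else {0})" for i using xy(1) by (simp add: X_def)
    have yb: "y i \<in> (if i < b' \<and> \<not> (b \<le> i \<and> level i = Suc k) then cball 0 1 else {0})" for i using xy(2) by (simp add: Y_def)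
    have b'eq: "b' = b + b * 3 ^ \<sigma>" by (simp add: b_def b'_def block_start.simps algebra_simps)
    have "\<exists>s\<in>{1..2 * b'}. (\<Sum>i<b'. y i * (adj ^^ s) x i) \<noteq> 0"
      unfolding b'_def
    proof (rule correlation_nonzero[OF k])
      show "x 0 \<noteq> 0" using \<open>cmod (x 0) > 0\<close> by auto
      show "x i = 0" if "block_start \<sigma> \<le> i" "i < block_start (Suc \<sigma>) - block_start \<sigma> * 3 ^ k" for i
      proof -
        have "k < level i" using level_le_in_block[of \<sigma> i k] that by linarith
        moreover have "i < block_start (Suc \<sigma>)" using that by linarith
        ultimately show ?thesis using r[of i] xb[of i] that by (simp add: b'_def)
      qed
      show "x i = 0" if "block_start (Suc \<sigma>) \<le> i" for i using xb[of i] that by (simp add: b'_def)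
      show "i0 < block_start (Suc \<sigma>)" "y i0 \<noteq> 0" using i0 by (auto simp: b'_def)
      show "y i = 0" if "block_start (Suc \<sigma>) - 3 * (block_start \<sigma> * 3 ^ k) \<le> i" "i < block_start (Suc \<sigma>) - block_start \<sigma> * 3 ^ k" for i
      proof -
        have "b * 3 ^ Suc k \<le> b * 3 ^ \<sigma>" using k by (intro mult_le_mono2 power_increasing) auto
        moreover have "b * 3 ^ Suc k = 3 * (b * 3 ^ k)" by simp
        ultimately have "3 * (b * 3 ^ k) \<le> b * 3 ^ \<sigma>" by metis
        then have "b \<le> i" using that(1) b'eq unfolding b'_def[symmetric] b_def[symmetric] by linarith
        moreover have "i < block_start (Suc \<sigma>)" using that(2) by linarith
        moreover have "block_start \<sigma> * 3 ^ Suc k = 3 * (block_start \<sigma> * 3 ^ k)" by simp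
        ultimately have "k < level i \<and> level i \<le> Suc k"
          using level_le_in_block[of \<sigma> i k] level_le_in_block[of \<sigma> i "Suc k"] that \<open>b \<le> i\<close>
          unfolding b_def by linarith
        then show ?thesis using yb[of i] \<open>b \<le> i\<close> by simp
      qed
    qed
    then obtain s where "s \<in> {1..2 * b'}" "(\<Sum>i<b'. y i * (adj ^^ s) x i) \<noteq> 0" by blast
    then show ?thesis unfolding F_def by (auto intro!: sum_pos2[of _ s])
  qed
  have "\<exists>m>0. \<forall>z\<in>X \<times> Y. m \<le> F z"
  proof (cases "X \<times> Y = {}")
    case False
    then obtain z where "z \<in> X \<times> Y" "\<forall>w\<in>X \<times> Y. F z \<le> F w" using continuous_attains_inf[OF cpt _ cont] by blast
    moreover have "0 < F z" using pos[of "fst z" "snd z"] \<open>z \<in> X \<times> Y\<close> by auto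
    ultimately show ?thesis by blast
  qed (auto intro: exI[of _ 1])
  then obtain m where m: "m > 0" "\<And>x y. x \<in> X \<Longrightarrow> y \<in> Y \<Longrightarrow> m \<le> F (x, y)" by blast
  have b'0: "b' > 0" by (simp add: b'_def)
  have "uniform_correlation \<sigma> k r (m / (2 * b'))"
    unfolding uniform_correlation_def b'_def[symmetric] b_def[symmetric]
  proof (intro conjI allI impI)
    show "0 < m / (2 * b')" using m(1) b'0 by simp
    fix x y :: "nat \<Rightarrow> complex"
    assume x: "\<forall>i. cmod (x i) \<le> r i" "\<forall>i\<ge>b'. x i = 0" "1 / (real \<sigma> + 1) \<le> cmod (x 0)"
      and y: "\<forall>i. cmod (y i) \<le> 1" "\<forall>i\<ge>b'. y i = 0" "\<forall>i\<ge>b. i < b' \<longrightarrow> level i = Suc k \<longrightarrow> y i = 0"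
        "\<exists>i. cmod (y i) = 1"
    have "x \<in> X" using x by (auto simp: X_def)
    moreover have "y \<in> Y"
    proof -
      obtain i where "cmod (y i) = 1" using y(4) by blast
      moreover from this have "i < b'" using y(2) by (metis norm_zero not_le zero_neq_one)
      ultimately show ?thesis using y by (auto simp: Y_def)
    qed
    ultimately have F: "m \<le> F (x, y)" by (rule m)
    show "\<exists>s\<in>{1..2 * b'}. m / (2 * b') \<le> cmod (\<Sum>i<b'. y i * (adj ^^ s) x i)"
    proof (rule ccontr)
      assume "\<not> ?thesis"
      then have "cmod (\<Sum>i<b'. y i * (adj ^^ s) x i) < m / (2 * b')" if "s \<in> {1..2 * b'}" for s
        using that not_le by blast
      then have "F (x, y) < (\<Sum>s\<in>{1..2 * b'}. m / (2 * b'))"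
        unfolding F_def prod.case using b'0 by (intro sum_strict_mono) simp_all
      also have "\<dots> = m" using b'0 by simp
      finally show False using F by simp
    qed
  qed
  then show ?thesis by blast
qed

lemma level_next_block:
  assumes "block_start (Suc \<sigma>) \<le> i" "i < 3 * block_start (Suc \<sigma>)" "k \<le> \<sigma>"
  shows "k < level i"
proof -
  let ?b = "block_start (Suc \<sigma>)"
  have e: "block_start (Suc (Suc \<sigma>)) = ?b + ?b * 3 ^ Suc \<sigma>" by (subst block_start.simps) (simp add: algebra_simps)
  have "3 * 3 ^ k \<le> (3::nat) ^ Suc \<sigma>" using assms(3) by (simp add: power_increasing)
  moreover have "(1::nat) \<le> 3 ^ k" by simp
  ultimately have "2 + 3 ^ k \<le> (3::nat) ^ Suc \<sigma>" by linarith
  then have "?b * (2 + 3 ^ k) \<le> ?b * 3 ^ Suc \<sigma>" by (rule mult_le_mono2)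
  then have l: "i + ?b * 3 ^ k < block_start (Suc (Suc \<sigma>))" using assms(2) e by (simp add: algebra_simps)
  then have "i < block_start (Suc (Suc \<sigma>))" by simp
  from level_le_in_block[OF assms(1) this, of k] l show ?thesis by simp
qed

lemma level_block_beginning:
  assumes "block_start \<sigma> \<le> i" "i < 2 * block_start \<sigma>" "k < \<sigma>"
  shows "k < level i"
proof -
  obtain \<tau> where "\<sigma> = Suc \<tau>" using assms(3) by (cases \<sigma>) auto
  then show ?thesis using level_next_block[of \<tau> i k] assms by simp
qed

lemma level_antimono:
  assumes "0 < i" "i \<le> j" "block_of i = block_of j"
  shows "level j \<le> level i"
  using level_le_iff[of i "level i"] level_le_iff[of j "level i"] assms by simp

text \<open>
  Cutting \<open>r\<close> off after the block makes the chosen constant a function of the sizes up to that block,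
  as the recursive choice of sizes requires.
\<close>

definition correlation_const :: "nat \<Rightarrow> nat \<Rightarrow> (nat \<Rightarrow> real) \<Rightarrow> real" where
  "correlation_const \<sigma> k r = (SOME c. uniform_correlation \<sigma> k (\<lambda>j. if j < block_start (Suc \<sigma>) then r j else 0) c)"

text \<open>
  \<open>\<rho> k i\<close> is the value of the \<open>k\<close>-th seminorm at the unscaled vector \<open>v\<^sub>i\<close>, and \<open>g i * \<rho> k i\<close> is its
  value at \<open>f\<^sub>i\<close> if \<open>g i\<close> is the size \<open>\<gamma>\<^sub>i\<close>.
\<close>

locale leveled_weights =
  fixes \<rho> :: "nat \<Rightarrow> nat \<Rightarrow> real"
  assumes nonneg: "0 \<le> \<rho> k i" and zero_iff: "\<rho> k i = 0 \<longleftrightarrow> k < level i"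
begin

lemma correlation_const:
  assumes "k < \<sigma>"
  shows "uniform_correlation \<sigma> k (\<lambda>j. if j < block_start (Suc \<sigma>) then g j * \<rho> k j else 0) (correlation_const \<sigma> k (\<lambda>j. g j * \<rho> k j))"
proof -
  have "\<exists>c. uniform_correlation \<sigma> k (\<lambda>j. if j < block_start (Suc \<sigma>) then g j * \<rho> k j else 0) c"
    by (rule ex_uniform_correlation[OF assms]) (simp add: zero_iff)
  then show ?thesis unfolding correlation_const_def by (rule someI_ex)
qed

text \<open>
  The smallest of the correlation constants that the size of index \<open>i\<close> must respect: those of all
  earlier blocks and, if \<open>i\<close> has level \<open>k + 1\<close>, the one of its own block for \<open>k\<close>.
\<close>

definition margin :: "(nat \<Rightarrow> real) \<Rightarrow> nat \<Rightarrow> real" where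
  "margin g i = Min (insert 1 ((\<lambda>(\<sigma>, k). correlation_const \<sigma> k (\<lambda>j. g j * \<rho> k j)) `
     {(\<sigma>, k). k < \<sigma> \<and> (\<sigma> < block_of i \<or> (\<sigma> = block_of i \<and> level i = Suc k))}))"

definition weight :: "nat \<Rightarrow> real" where "weight i = 4 * 2 ^ i * (real i + 1)\<^sup>2"

text \<open>
  The pairs of a seminorm and a number of steps for which \<open>T\<^sup>s f\<^sub>i\<close> has to be small.  Powers up to twice
  the start of the block are those used at earlier blocks; up to twice the end of the block they
  are used at this block, where only the stretch of level \<open>k + 1\<close> is an error term.
\<close>

definition demands :: "nat \<Rightarrow> (nat \<times> nat) set" where
  "demands i = {(k, s). k < block_of i \<and> level i \<le> Suc k \<and> 0 < s \<and>
     (s \<le> 2 * block_start (block_of i) \<or> (level i = Suc k \<and> s \<le> 2 * block_start (Suc (block_of i))))}"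

text \<open>
  The maximum with \<open>1\<close> makes \<open>f\<^sub>i\<close> itself large, so that the coordinates of a fixed vector at \<open>i\<close> are
  small.
\<close>

definition demand :: "(nat \<Rightarrow> real) \<Rightarrow> nat \<Rightarrow> real \<Rightarrow> bool" where
  "demand g i v \<longleftrightarrow> 0 < v \<and> (\<forall>(k, s)\<in>demands i.
     weight i * max 1 ((adj ^^ s) (\<lambda>j. g j * \<rho> k j) i) \<le> margin g i * (v * \<rho> (Suc k) i))"

lemma finite_index: "finite {(\<sigma>, k). k < \<sigma> \<and> (\<sigma> < n \<or> (\<sigma> = n \<and> Q k))}" for n :: nat
  by (rule finite_subset[of _ "{..n} \<times> {..n}"]) auto

lemma margin_pos: "0 < margin g i"
proof -
  have "0 < correlation_const \<sigma> k (\<lambda>j. g j * \<rho> k j)" if "k < \<sigma>" for \<sigma> k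
    using correlation_const[OF that, of g] by (simp add: uniform_correlation_def)
  then show ?thesis unfolding margin_def by (subst Min_gr_iff) (auto simp: finite_index)
qed

lemma margin_le:
  "k < \<sigma> \<Longrightarrow> \<sigma> < block_of i \<or> (\<sigma> = block_of i \<and> level i = Suc k) \<Longrightarrow>
    margin g i \<le> correlation_const \<sigma> k (\<lambda>j. g j * \<rho> k j)"
  unfolding margin_def by (intro Min_le) (auto simp: finite_index)

lemma margin_le_1: "margin g i \<le> 1"
  unfolding margin_def by (intro Min_le) (auto simp: finite_index)

lemma finite_demands: "finite (demands i)"
proof (rule finite_subset)
  show "demands i \<subseteq> {..block_of i} \<times> {..2 * block_start (Suc (block_of i))}"
    using block_start_mono[of "block_of i" "Suc (block_of i)"] by (auto simp: demands_def)
qed simp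

lemma demand_satisfiable: "\<exists>v. demand g i v"
proof -
  define A where "A t = weight i * max 1 ((adj ^^ snd t) (\<lambda>j. g j * \<rho> (fst t) j) i)" for t :: "nat \<times> nat"
  define B where "B t = margin g i * \<rho> (Suc (fst t)) i" for t :: "nat \<times> nat"
  have B: "0 < B t" if "t \<in> demands i" for t
  proof -
    have "level i \<le> Suc (fst t)" using that by (auto simp: demands_def)
    then have "0 < \<rho> (Suc (fst t)) i"
      using zero_iff[of "Suc (fst t)" i] nonneg[of "Suc (fst t)" i] by linarith
    then show ?thesis unfolding B_def by (intro mult_pos_pos margin_pos)
  qed
  define v where "v = 1 + (\<Sum>t\<in>demands i. \<bar>A t\<bar> / B t)"
  have v: "1 \<le> v" unfolding v_def using B by (simp add: sum_nonneg divide_nonneg_pos)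
  have "A t \<le> v * B t" if t: "t \<in> demands i" for t
  proof -
    have "\<bar>A t\<bar> / B t \<le> (\<Sum>t\<in>demands i. \<bar>A t\<bar> / B t)"
      using t B finite_demands by (intro member_le_sum) (auto intro: divide_nonneg_pos)
    then have "\<bar>A t\<bar> / B t \<le> v" by (simp add: v_def)
    then have "\<bar>A t\<bar> \<le> v * B t" using B[OF t] by (simp add: pos_divide_le_eq)
    then show ?thesis by simp
  qed
  then have "weight i * max 1 ((adj ^^ s) (\<lambda>j. g j * \<rho> k j) i) \<le> margin g i * (v * \<rho> (Suc k) i)"
    if "(k, s) \<in> demands i" for k s
    using that by (fastforce simp: A_def B_def mult.left_commute)
  then have "demand g i v" using v unfolding demand_def by auto
  then show ?thesis by blast
qed

text \<open>
  The order in which sizes are chosen: block after block, and backwards inside a block, because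
  \<open>T\<close> moves forwards and a vector has to dominate its images.
\<close>

definition prior :: "(nat \<times> nat) set" where
  "prior = inv_image (less_than <*lex*> less_than) (\<lambda>i. (block_of i, block_start (Suc (block_of i)) - i))"

lemma wf_prior: "wf prior" by (simp add: prior_def wf_inv_image wf_lex_prod)

lemma prior_iff: "(j, i) \<in> prior \<longleftrightarrow> block_of j < block_of i \<or> (block_of j = block_of i \<and> i < j)"
  using block_of_less[of i] block_of_less[of j] by (auto simp: prior_def)

definition restrict_prior :: "(nat \<Rightarrow> real) \<Rightarrow> nat \<Rightarrow> nat \<Rightarrow> real" where
  "restrict_prior g i j = (if (j, i) \<in> prior then g j else 0)"

text \<open>
  A constant of an earlier block depends on earlier blocks only.  The constant of the own block for
  \<open>k\<close> depends on the sizes at levels at most \<open>k\<close>, and inside the block these come after every index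
  of level \<open>k + 1\<close>.
\<close>

lemma margin_restrict_prior: "margin (restrict_prior g i) i = margin g i"
proof -
  have "correlation_const \<sigma> k (\<lambda>j. restrict_prior g i j * \<rho> k j) = correlation_const \<sigma> k (\<lambda>j. g j * \<rho> k j)"
    if sk: "k < \<sigma>" "\<sigma> < block_of i \<or> (\<sigma> = block_of i \<and> level i = Suc k)" for \<sigma> k
  proof -
    have eq: "restrict_prior g i j * \<rho> k j = g j * \<rho> k j" if j: "j < block_start (Suc \<sigma>)" for j
    proof (cases "(j, i) \<in> prior")
      case False
      have "block_of j \<le> \<sigma>" using j unfolding block_of_def by (rule Least_le)
      then have eq: "\<sigma> = block_of i" "block_of j = block_of i" "level i = Suc k" "j \<le> i"
        using False sk by (auto simp: prior_iff)
      then have "0 < j" using sk by (cases j) auto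
      then have "k < level j" using level_antimono[of j i] eq by simp
      then show ?thesis using zero_iff[of k j] by simp
    qed (simp add: restrict_prior_def)
    have "(\<lambda>j. if j < block_start (Suc \<sigma>) then restrict_prior g i j * \<rho> k j else 0) =
        (\<lambda>j. if j < block_start (Suc \<sigma>) then g j * \<rho> k j else 0)"
      by (intro ext if_cong refl eq)
    then show ?thesis unfolding correlation_const_def by (rule arg_cong)
  qed
  then have "(\<lambda>(\<sigma>, k). correlation_const \<sigma> k (\<lambda>j. restrict_prior g i j * \<rho> k j)) `
        {(\<sigma>, k). k < \<sigma> \<and> (\<sigma> < block_of i \<or> (\<sigma> = block_of i \<and> level i = Suc k))} =
      (\<lambda>(\<sigma>, k). correlation_const \<sigma> k (\<lambda>j. g j * \<rho> k j)) `
        {(\<sigma>, k). k < \<sigma> \<and> (\<sigma> < block_of i \<or> (\<sigma> = block_of i \<and> level i = Suc k))}"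
    by (intro image_cong refl) (simp only: mem_Collect_eq split_beta)
  then show ?thesis unfolding margin_def by (rule arg_cong)
qed

text \<open>
  The images \<open>T\<^sup>s f\<^sub>i\<close> involve later indices of the block and, after a return, indices from \<open>0\<close> on.  Every
  index reached whose size is not yet chosen has a level above \<open>k\<close>.
\<close>

lemma adj_restrict_prior:
  assumes "(k, s) \<in> demands i"
  shows "(adj ^^ s) (\<lambda>j. restrict_prior g i j * \<rho> k j) i = (adj ^^ s) (\<lambda>j. g j * \<rho> k j) i"
proof -
  define \<sigma> where "\<sigma> = block_of i"
  have ks: "k < \<sigma>" "level i \<le> Suc k" "0 < s" "s \<le> 2 * block_start \<sigma> \<or> (level i = Suc k \<and> s \<le> 2 * block_start (Suc \<sigma>))"
    using assms by (auto simp: demands_def \<sigma>_def)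
  then have i0: "0 < i" by (cases i) (auto simp: \<sigma>_def)
  have i: "block_start \<sigma> \<le> i" "i < block_start (Suc \<sigma>)" using block_of_ge[OF i0] block_of_less[of i] by (auto simp: \<sigma>_def)
  have before: "restrict_prior g i j * \<rho> k j = g j * \<rho> k j" if "j < block_start \<sigma>" for j
  proof -
    have "block_of j < \<sigma>"
    proof (rule ccontr)
      assume "\<not> block_of j < \<sigma>"
      then have "0 < j" using ks(1) by (cases j) auto
      then have "block_start \<sigma> \<le> j" using block_of_ge[of j] block_start_mono[of \<sigma> "block_of j"] \<open>\<not> block_of j < \<sigma>\<close> by simp
      then show False using that by simp
    qed
    then show ?thesis by (simp add: restrict_prior_def prior_iff \<sigma>_def)
  qed
  have after: "restrict_prior g i j * \<rho> k j = g j * \<rho> k j" if "i < j" "j < 3 * block_start (Suc \<sigma>)" for j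
  proof (cases "j < block_start (Suc \<sigma>)")
    case True
    then have "block_of j = \<sigma>" using i that by (intro block_ofI) auto
    then show ?thesis using that by (simp add: restrict_prior_def prior_iff \<sigma>_def)
  next
    case False
    then have "k < level j" using level_next_block[of \<sigma> j k] that ks by simp
    then show ?thesis using zero_iff[of k j] by simp
  qed
  show ?thesis
  proof (cases "level i = Suc k")
    case True
    have s: "s \<le> 2 * block_start (Suc \<sigma>)" using ks(4) block_start_double[of \<sigma>] by auto
    have inside: "restrict_prior g i j * \<rho> k j = g j * \<rho> k j" if "block_start \<sigma> \<le> j" "j \<le> i" for j
    proof -
      have "0 < j" using that block_start_pos[of \<sigma>] by linarith
      moreover have "block_of j = block_of i" using that i block_ofI[of \<sigma> j] by (simp add: \<sigma>_def)
      ultimately have "k < level j" using level_antimono[of j i] that True by simp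
      then show ?thesis using zero_iff[of k j] by simp
    qed
    show ?thesis
    proof (rule adj_funpow_cong)
      fix j assume "j \<le> i + s"
      then have "j < 3 * block_start (Suc \<sigma>)" using s i by simp
      then show "restrict_prior g i j * \<rho> k j = g j * \<rho> k j" using before[of j] inside[of j] after[of j] by linarith
    qed
  next
    case False
    then have s: "s \<le> 2 * block_start \<sigma>" using ks(4) by simp
    show ?thesis
    proof (rule adj_funpow_cong'[OF ks(3)])
      fix j assume "j < s"
      show "restrict_prior g i j * \<rho> k j = g j * \<rho> k j"
      proof (cases "j < block_start \<sigma>")
        case False
        then have "k < level j" using level_block_beginning[of \<sigma> j k] \<open>j < s\<close> s ks by simp
        then show ?thesis using zero_iff[of k j] by simp
      qed (rule before)
    next
      fix j assume "i < j" "j \<le> i + s"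
      then show "restrict_prior g i j * \<rho> k j = g j * \<rho> k j" using after[of j] i s block_start_double[of \<sigma>] by simp
    qed
  qed
qed

lemma demand_restrict_prior: "demand (restrict_prior g i) i v \<longleftrightarrow> demand g i v"
  unfolding demand_def margin_restrict_prior
proof (rule conj_cong[OF refl ball_cong[OF refl]])
  fix t assume "t \<in> demands i"
  then show "(case t of (k, s) \<Rightarrow> weight i * max 1 ((adj ^^ s) (\<lambda>j. restrict_prior g i j * \<rho> k j) i) \<le> margin g i * (v * \<rho> (Suc k) i)) =
      (case t of (k, s) \<Rightarrow> weight i * max 1 ((adj ^^ s) (\<lambda>j. g j * \<rho> k j) i) \<le> margin g i * (v * \<rho> (Suc k) i))"
    by (cases t) (simp only: prod.case adj_restrict_prior)
qed

lemma ex_scaling: "\<exists>g. \<forall>i. demand g i (g i)"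
proof -
  have "\<exists>g. \<forall>i. demand (restrict_prior g i) i (g i)"
  proof (rule dependent_wf_choice[OF wf_prior])
    fix f g :: "nat \<Rightarrow> real" and i v
    assume "\<And>j. (j, i) \<in> prior \<Longrightarrow> f j = g j"
    then have "restrict_prior f i = restrict_prior g i" by (auto simp: restrict_prior_def)
    then show "demand (restrict_prior f i) i v = demand (restrict_prior g i) i v" by simp
  qed (rule demand_satisfiable)
  then show ?thesis by (simp only: demand_restrict_prior)
qed

text \<open>
  In a block that starts at \<open>b\<close> the stretch of level \<open>k + 1\<close> has at least \<open>2 b\<close> indices, so \<open>2 b\<close> steps
  cannot lead from a level above \<open>k + 1\<close> to a level of at most \<open>k\<close>, nor to the end of the block.
\<close>

lemma level_drop_slow:
  assumes s: "s \<le> 2 * block_start (block_of i)" and "0 < i" and k: "Suc k < level i"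
    and r: "\<And>j. k < level j \<Longrightarrow> r j = 0"
  shows "(adj ^^ s) r i = (0::real)"
proof -
  define \<sigma> where "\<sigma> = block_of i"
  let ?b = "block_start \<sigma>"
  have i: "?b \<le> i" "i < block_start (Suc \<sigma>)" using block_of_ge[OF \<open>0 < i\<close>] block_of_less[of i] by (auto simp: \<sigma>_def)
  have "i + ?b * 3 ^ Suc k < block_start (Suc \<sigma>)" using level_le_in_block[OF i, of "Suc k"] k by linarith
  moreover have "?b * 3 ^ Suc k = 3 * (?b * 3 ^ k)" by simp
  ultimately have far: "i + 3 * (?b * 3 ^ k) < block_start (Suc \<sigma>)" by metis
  have "?b \<le> ?b * 3 ^ k" by simp
  then have far': "i + s + ?b * 3 ^ k < block_start (Suc \<sigma>)" using far s unfolding \<sigma>_def[symmetric] by linarith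
  then have "(adj ^^ s) r i = r (i + s)"
    by (intro adj_funpow_straight not_block_end[of \<sigma>]) (use i in auto)
  moreover have "k < level (i + s)" using level_le_in_block[of \<sigma> "i + s" k] far' i by linarith
  ultimately show ?thesis using r by simp
qed

lemma adj_funpow_truncate:
  assumes "i < block_start (Suc \<sigma>)" "s \<le> 2 * block_start (Suc \<sigma>)" "k \<le> \<sigma>" "\<And>j. k < level j \<Longrightarrow> x j = 0"
  shows "(adj ^^ s) (\<lambda>j. if j < block_start (Suc \<sigma>) then x j else 0) i = (adj ^^ s) x i"
proof (rule adj_funpow_cong)
  fix j assume "j \<le> i + s"
  then show "(if j < block_start (Suc \<sigma>) then x j else 0) = x j"
    using level_next_block[of \<sigma> j k] assms by auto
qed

text \<open>
  Normalize \<open>y\<close> to maximum \<open>1\<close> on the indices up to the end of block \<open>\<sigma>\<close>, for \<open>\<sigma>\<close> so large that the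
  fixed data \<open>M\<close>, \<open>x 0\<close> and a nonzero coordinate of \<open>y\<close> are harmless compared with \<open>\<sigma>\<close>.  Omitting the
  stretch of level \<open>k + 1\<close> and all later blocks leaves, for some \<open>s\<close>, a sum of at least the
  correlation constant \<open>c\<close>.  By the choice of sizes the omitted terms add up to at most \<open>c / 2\<close>, so
  the whole sum cannot vanish.
\<close>

theorem no_annihilating_pair:
  fixes x y :: "nat \<Rightarrow> complex"
  assumes g: "\<And>i. demand g i (g i)"
    and x: "\<And>i. cmod (x i) \<le> g i * \<rho> k i" "x 0 \<noteq> 0"
    and y: "\<And>i. cmod (y i) * (g i * \<rho> (Suc k) i) \<le> M"
    and sums: "\<And>s. 0 < s \<Longrightarrow> (\<lambda>i. y i * (adj ^^ s) x i) sums 0"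
  shows "y = (\<lambda>i. 0)"
proof (rule ccontr)
  assume "y \<noteq> (\<lambda>i. 0)"
  then obtain i0 where i0: "y i0 \<noteq> 0" by auto
  obtain \<sigma>' :: nat where "M + 1 / cmod (x 0) + 1 / cmod (y i0) + \<bar>M\<bar> < real \<sigma>'" using reals_Archimedean2 by blast
  define \<sigma> where "\<sigma> = \<sigma>' + Suc k + i0"
  have big: "M + 1 / cmod (x 0) + 1 / cmod (y i0) + \<bar>M\<bar> < real \<sigma> + 1"
    using \<open>_ < real \<sigma>'\<close> by (simp add: \<sigma>_def)
  have pos: "0 < 1 / cmod (x 0)" "0 < 1 / cmod (y i0)" using x(2) i0 by auto
  have k: "k < \<sigma>" by (simp add: \<sigma>_def)
  define b b' where "b = block_start \<sigma>" and "b' = block_start (Suc \<sigma>)"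
  have b: "\<sigma> < b" "b < b'" using block_start_gt block_start_strict_mono by (auto simp: b_def b'_def strict_mono_less)
  have M: "M \<le> real \<sigma> + 1" using big pos by linarith
  have x0: "1 / (real \<sigma> + 1) \<le> cmod (x 0)"
  proof -
    have "1 / cmod (x 0) \<le> real \<sigma> + 1" using big pos by linarith
    then show ?thesis using x(2) by (simp add: field_simps)
  qed
  have i0b: "i0 < b'" using b by (simp add: \<sigma>_def)
  define \<mu> where "\<mu> = Max ((\<lambda>i. cmod (y i)) ` {..<b'})"
  have \<mu>le: "cmod (y i) \<le> \<mu>" if "i < b'" for i unfolding \<mu>_def using that by (intro Max_ge) auto
  have "\<mu> \<in> (\<lambda>i. cmod (y i)) ` {..<b'}" unfolding \<mu>_def using i0b by (intro Max_in) auto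
  then obtain i1 where i1: "i1 < b'" "cmod (y i1) = \<mu>" by auto
  have \<mu>: "0 < \<mu>" using \<mu>le[OF i0b] i0 by (metis less_le_trans zero_less_norm_iff)
  have inv\<mu>: "1 / \<mu> \<le> real \<sigma> + 1"
  proof -
    have "1 / \<mu> \<le> 1 / cmod (y i0)" using \<mu>le[OF i0b] \<mu> i0 by (intro divide_left_mono) auto
    then show ?thesis using big pos by linarith
  qed
  define a where "a = (\<lambda>i. y i / \<mu>)"
  have a: "cmod (a i) * (g i * \<rho> (Suc k) i) \<le> (real \<sigma> + 1)\<^sup>2" for i
  proof -
    have "cmod (a i) * (g i * \<rho> (Suc k) i) = (1 / \<mu>) * (cmod (y i) * (g i * \<rho> (Suc k) i))"
      using \<mu> by (simp add: a_def norm_divide)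
    also have "\<dots> \<le> (1 / \<mu>) * (real \<sigma> + 1)" using y[of i] M \<mu> by (intro mult_left_mono) auto
    also have "\<dots> \<le> (real \<sigma> + 1) * (real \<sigma> + 1)" using inv\<mu> by (intro mult_right_mono) auto
    finally show ?thesis by (simp add: power2_eq_square)
  qed
  define c where "c = correlation_const \<sigma> k (\<lambda>j. g j * \<rho> k j)"
  have uc: "uniform_correlation \<sigma> k (\<lambda>j. if j < b' then g j * \<rho> k j else 0) c"
    unfolding c_def b'_def by (rule correlation_const[OF k])
  then have c: "0 < c" by (simp add: uniform_correlation_def)
  have gp: "0 < g i" for i using g[of i] by (simp add: demand_def)
  have \<rho>x: "x j = 0" if "k < level j" for j using x(1)[of j] zero_iff[of k j] that by simp
  \<comment> \<open>The stretch of level \<open>k + 1\<close>, where \<open>f\<^sub>i\<close> is so large that the coordinates are negligible.\<close>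
  define region where "region = {i. b \<le> i \<and> i < b' \<and> level i = Suc k}"
  \<comment> \<open>The main part, to which the uniform lower bound applies.\<close>
  define a' where "a' = (\<lambda>i. if i < b' \<and> i \<notin> region then a i else 0)"
  have estimate: "weight i \<le> g i * \<rho> (Suc k) i \<and> cmod ((adj ^^ s) x i) * weight i \<le> c * (g i * \<rho> (Suc k) i)"
    if i: "i \<in> region \<or> b' \<le> i \<and> level i \<le> Suc k" and s: "0 < s" "s \<le> 2 * b'" for i s
  proof -
    have i_block: "\<sigma> < block_of i \<or> (\<sigma> = block_of i \<and> level i = Suc k)"
    proof (cases "i \<in> region")
      case True
      then show ?thesis using block_ofI[of \<sigma> i] by (auto simp: region_def b_def b'_def)
    next
      case False
      then have "b' \<le> i" using i by simp
      then show ?thesis using block_of_mono[of b' i] block_ofI[of "Suc \<sigma>" b'] block_start_strict_mono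
        by (auto simp: b'_def strict_mono_less)
    qed
    have "(k, s) \<in> demands i"
      using i_block s k i block_start_mono[of "Suc \<sigma>" "block_of i"]
      by (auto simp: demands_def b'_def region_def)
    then have d: "weight i * max 1 ((adj ^^ s) (\<lambda>j. g j * \<rho> k j) i) \<le> margin g i * (g i * \<rho> (Suc k) i)"
      using g[of i] by (auto simp: demand_def)
    have w: "0 < weight i" by (simp add: weight_def)
    have p: "0 \<le> g i * \<rho> (Suc k) i" using gp[of i] nonneg[of "Suc k" i] by simp
    have "weight i * 1 \<le> weight i * max 1 ((adj ^^ s) (\<lambda>j. g j * \<rho> k j) i)" using w by (intro mult_left_mono) auto
    also note d
    also have "margin g i * (g i * \<rho> (Suc k) i) \<le> 1 * (g i * \<rho> (Suc k) i)" using margin_le_1 p by (rule mult_right_mono)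
    finally have 1: "weight i \<le> g i * \<rho> (Suc k) i" by simp
    have "cmod ((adj ^^ s) x i) \<le> max 1 ((adj ^^ s) (\<lambda>j. g j * \<rho> k j) i)"
      using adj_funpow_norm_le[of x "\<lambda>j. g j * \<rho> k j" s i] x(1) by auto
    then have "weight i * cmod ((adj ^^ s) x i) \<le> weight i * max 1 ((adj ^^ s) (\<lambda>j. g j * \<rho> k j) i)" using w by (intro mult_left_mono) auto
    also note d
    also have "margin g i * (g i * \<rho> (Suc k) i) \<le> c * (g i * \<rho> (Suc k) i)"
      using margin_le[OF k i_block, of g] p unfolding c_def by (rule mult_right_mono)
    finally show ?thesis using 1 by (simp add: mult.commute)
  qed
  have large: "(real \<sigma> + 1)\<^sup>2 * (4 * 2 ^ i) \<le> weight i" if "b \<le> i" for i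
  proof -
    have "(real \<sigma> + 1)\<^sup>2 \<le> (real i + 1)\<^sup>2" using that b(1) by (intro power_mono) auto
    then show ?thesis by (simp add: weight_def)
  qed
  have err: "cmod ((a i - a' i) * (adj ^^ s) x i) \<le> c / 4 * (1 / 2) ^ i" if s: "0 < s" "s \<le> 2 * b'" for i s
  proof (cases "i < b' \<and> i \<notin> region")
    case True then show ?thesis using c by (simp add: a'_def)
  next
    case False
    then have bi: "b \<le> i" using b(2) by (auto simp: region_def)
    then have i0': "0 < i" using b(1) by simp
    have aa: "a i - a' i = a i" using False by (auto simp: a'_def)
    show ?thesis
    proof (cases "level i \<le> Suc k")
      case True
      then have e: "weight i \<le> g i * \<rho> (Suc k) i" "cmod ((adj ^^ s) x i) * weight i \<le> c * (g i * \<rho> (Suc k) i)"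
        using estimate[of i s] False s by auto
      let ?p = "g i * \<rho> (Suc k) i" let ?X = "cmod ((adj ^^ s) x i)"
      have w: "0 < weight i" by (simp add: weight_def)
      have "cmod (a i) * ?X * weight i \<le> cmod (a i) * (c * ?p)" using mult_left_mono[OF e(2), of "cmod (a i)"] by (simp add: mult.assoc)
      also have "\<dots> \<le> c * (real \<sigma> + 1)\<^sup>2" using mult_left_mono[OF a[of i], of c] c by (simp add: mult_ac)
      finally have fin: "cmod (a i) * ?X * weight i \<le> c * (real \<sigma> + 1)\<^sup>2" .
      have "(real \<sigma> + 1)\<^sup>2 * (cmod (a i) * ?X * (4 * 2 ^ i)) = cmod (a i) * ?X * ((real \<sigma> + 1)\<^sup>2 * (4 * 2 ^ i))"
        by (simp only: mult_ac)
      also have "\<dots> \<le> cmod (a i) * ?X * weight i" by (intro mult_left_mono large[OF bi]) simp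
      also note fin
      finally have "(real \<sigma> + 1)\<^sup>2 * (cmod (a i) * ?X * (4 * 2 ^ i)) \<le> (real \<sigma> + 1)\<^sup>2 * c"
        by (simp only: mult.commute)
      then have "cmod (a i) * ?X * (4 * 2 ^ i) \<le> c" by (rule mult_left_le_imp_le) simp
      then show ?thesis unfolding aa norm_mult by (simp add: field_simps)
    next
      case high: False
      then have "b' \<le> i" using False by (auto simp: region_def)
      then have "block_of b' \<le> block_of i" by (rule block_of_mono)
      then have "b' \<le> block_start (block_of i)"
        using block_ofI[of "Suc \<sigma>" b'] block_start_strict_mono block_start_mono[of "Suc \<sigma>" "block_of i"] by (auto simp: b'_def strict_mono_less)
      then have "(adj ^^ s) (\<lambda>j. g j * \<rho> k j) i = 0"
        using s high i0' by (intro level_drop_slow[of s i k]) (auto simp: zero_iff)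
      then have "(adj ^^ s) x i = 0" using adj_funpow_norm_le[of x "\<lambda>j. g j * \<rho> k j" s i] x(1) by simp
      then show ?thesis using c by simp
    qed
  qed
  have reg1: "cmod (a i) < 1" if "i \<in> region" for i
  proof -
    have bi: "b \<le> i" using that by (simp add: region_def)
    have w: "weight i \<le> g i * \<rho> (Suc k) i" using estimate[of i 1] that b by auto
    have "(real \<sigma> + 1)\<^sup>2 * 1 < (real \<sigma> + 1)\<^sup>2 * (4 * 2 ^ i)" by (intro mult_strict_left_mono) (auto intro: less_le_trans[of _ "4 * 1"])
    also note large[OF bi]
    finally have "(real \<sigma> + 1)\<^sup>2 < g i * \<rho> (Suc k) i" using w by simp
    then have p: "cmod (a i) * (g i * \<rho> (Suc k) i) < 1 * (g i * \<rho> (Suc k) i)" "0 \<le> g i * \<rho> (Suc k) i" using a[of i] by (auto intro: order.trans[of _ "(real \<sigma> + 1)\<^sup>2"])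
    then show ?thesis by (rule mult_right_less_imp_less)
  qed
  define x' where "x' = (\<lambda>j. if j < b' then x j else 0)"
  have "\<exists>s\<in>{1..2 * b'}. c \<le> cmod (\<Sum>i<b'. a' i * (adj ^^ s) x' i)"
  proof (rule uc[unfolded uniform_correlation_def, THEN conjunct2, rule_format, folded b'_def])
    show "cmod (x' i) \<le> (if i < b' then g i * \<rho> k i else 0)" for i using x(1) by (simp add: x'_def)
    show "x' i = 0" if "b' \<le> i" for i using that by (simp add: x'_def)
    show "1 / (real \<sigma> + 1) \<le> cmod (x' 0)" using x0 b by (simp add: x'_def)
    show "cmod (a' i) \<le> 1" for i using \<mu>le[of i] \<mu> by (simp add: a'_def a_def norm_divide)
    show "a' i = 0" if "b' \<le> i" for i using that by (simp add: a'_def)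
    show "a' i = 0" if "block_start \<sigma> \<le> i" "i < b'" "level i = Suc k" for i using that by (simp add: a'_def region_def b_def)
    have "cmod (a i1) = 1" using i1 \<mu> by (simp add: a_def norm_divide)
    then show "\<exists>i. cmod (a' i) = 1" using reg1[of i1] i1 by (intro exI[of _ i1]) (auto simp: a'_def)
  qed
  then obtain s where "s \<in> {1..2 * b'}" and low: "c \<le> cmod (\<Sum>i<b'. a' i * (adj ^^ s) x' i)" ..
  then have s: "0 < s" "s \<le> 2 * b'" by simp_all
  have eq: "(\<Sum>i<b'. a' i * (adj ^^ s) x' i) = (\<Sum>i<b'. a' i * (adj ^^ s) x i)"
    using s k \<rho>x unfolding x'_def b'_def by (intro sum.cong refl arg_cong2[where f = "(*)"] adj_funpow_truncate[where k = k]) auto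
  have sum_a': "(\<lambda>i. a' i * (adj ^^ s) x i) sums (\<Sum>i<b'. a' i * (adj ^^ s) x i)"
    by (rule sums_finite) (auto simp: a'_def)
  have sum_a: "(\<lambda>i. a i * (adj ^^ s) x i) sums 0"
    using sums_mult[OF sums[OF s(1)], of "1 / \<mu>"] by (simp add: a_def mult_ac)
  have diff: "(\<lambda>i. (a i - a' i) * (adj ^^ s) x i) sums - (\<Sum>i<b'. a' i * (adj ^^ s) x' i)"
    using sums_diff[OF sum_a sum_a'] by (simp add: left_diff_distrib eq)
  have geo: "(\<lambda>i. c / 4 * (1 / 2) ^ i) sums (c / 4 * 2)"
    using sums_mult[OF geometric_sums[of "1/2 :: real"], of "c / 4"] by simp
  have "cmod (\<Sum>i. (a i - a' i) * (adj ^^ s) x i) \<le> (\<Sum>i. c / 4 * (1 / 2) ^ i)"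
    by (rule norm_suminf_le[OF err[OF s]]) (use geo in \<open>simp add: sums_iff\<close>)
  then have "cmod (\<Sum>i<b'. a' i * (adj ^^ s) x' i) \<le> c / 2"
    using diff geo by (simp add: sums_iff)
  then show False using low c by simp
qed

end

section \<open>The operator without invariant subspaces\<close>

lemma adj_funpow_first_nonzero:
  "(\<And>j. j < \<beta> \<Longrightarrow> x j = 0) \<Longrightarrow> i + s \<le> \<beta> \<Longrightarrow> (adj ^^ s) x i = x (i + s)"
proof (induction s arbitrary: i)
  case (Suc s)
  have "(adj ^^ s) x (Suc i) = x (Suc i + s)" "(adj ^^ s) x 0 = x (0 + s)"
    using Suc.prems by (intro Suc.IH; simp)+
  then show ?case using Suc.prems by (simp add: adj_funpow_Suc del: funpow.simps(2))
qed simp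

text \<open>
  The case of a single step in the demands is the continuity estimate for \<open>T\<close>, from the \<open>k\<close>-th to the
  next seminorm.
\<close>

lemma (in leveled_weights) demand_step:
  assumes "demand g i (g i)" "0 < i" "k < block_of i"
  shows "2 ^ i * adj (\<lambda>j. g j * \<rho> k j) i \<le> g i * \<rho> (Suc k) i"
proof (cases "level i \<le> Suc k")
  case True
  let ?X = "adj (\<lambda>j. g j * \<rho> k j) i"
  have gp: "0 < g i" using assms(1) by (simp add: demand_def)
  have "(k, 1) \<in> demands i" using True assms by (auto simp: demands_def Suc_le_eq)
  then have "weight i * max 1 ?X \<le> margin g i * (g i * \<rho> (Suc k) i)" using assms(1) by (force simp: demand_def)
  also have "\<dots> \<le> 1 * (g i * \<rho> (Suc k) i)" using margin_le_1 gp nonneg[of "Suc k" i] by (intro mult_right_mono) auto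
  finally have d: "weight i * max 1 ?X \<le> g i * \<rho> (Suc k) i" by simp
  have "2 ^ i \<le> weight i"
  proof -
    have "1 * 1 \<le> 4 * (real i + 1)\<^sup>2" by (intro mult_mono) auto
    then have "2 ^ i * 1 \<le> 2 ^ i * (4 * (real i + 1)\<^sup>2)" by (intro mult_left_mono) auto
    then show ?thesis by (simp add: weight_def mult_ac)
  qed
  then have "2 ^ i * max 1 ?X \<le> weight i * max 1 ?X" by (intro mult_right_mono) auto
  moreover have "2 ^ i * ?X \<le> 2 ^ i * max 1 ?X" by (intro mult_left_mono) auto
  ultimately show ?thesis using d by linarith
next
  case False
  have "1 \<le> 2 * block_start (block_of i)" using block_start_pos[of "block_of i"] by linarith
  then have "(adj ^^ 1) (\<lambda>j. g j * \<rho> k j) i = 0"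
    using False assms(2) by (intro level_drop_slow[of 1 i k]) (auto simp: zero_iff)
  moreover have "0 \<le> g i * \<rho> (Suc k) i" using assms(1) nonneg[of "Suc k" i] by (simp add: demand_def)
  ultimately show ?thesis by simp
qed

context frechet_space
begin

lemma series_converges:
  assumes B: "\<And>j i. q j (u i) \<le> B j * (1 / 2) ^ i"
  obtains l where "\<And>j. (\<lambda>n. q j ((\<Sum>i<n. u i) - l)) \<longlonglongrightarrow> 0" "\<And>j. q j l \<le> 2 * B j"
proof -
  have tail: "q j ((\<Sum>i<m. u i) - (\<Sum>i<n. u i)) \<le> 2 * B j * (1 / 2) ^ n - 2 * B j * (1 / 2) ^ m" if "n \<le> m" for n m j
    using that
  proof (induction m rule: dec_induct)
    case (step m)
    have eq: "(\<Sum>i<Suc m. u i) - (\<Sum>i<n. u i) = ((\<Sum>i<m. u i) - (\<Sum>i<n. u i)) + u m" by simp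
    have "q j ((\<Sum>i<Suc m. u i) - (\<Sum>i<n. u i)) \<le> q j ((\<Sum>i<m. u i) - (\<Sum>i<n. u i)) + q j (u m)"
      unfolding eq by (rule q_triangle)
    also have "\<dots> \<le> (2 * B j * (1 / 2) ^ n - 2 * B j * (1 / 2) ^ m) + B j * (1 / 2) ^ m" by (intro add_mono step B)
    finally show ?case by simp
  qed simp
  have Bpos: "0 \<le> B j" for j using order.trans[OF q_nonneg B, of j 0] by simp
  have tail': "q j ((\<Sum>i<m. u i) - (\<Sum>i<n. u i)) \<le> 2 * B j * (1 / 2) ^ n" if "n \<le> m" for n m j
  proof -
    have "0 \<le> 2 * B j * (1 / 2) ^ m" using Bpos by simp
    then show ?thesis using tail[OF that, of j] by linarith
  qed
  have "\<exists>N. \<forall>m\<ge>N. \<forall>n\<ge>N. q j ((\<Sum>i<m. u i) - (\<Sum>i<n. u i)) < r" if r: "0 < r" for j r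
  proof -
    have "0 < r / (2 * B j + 1)" using r Bpos[of j] by simp
    then obtain N where N: "(1 / 2) ^ N < r / (2 * B j + 1)" using real_arch_pow_inv[of "r / (2 * B j + 1)" "1 / 2"] by auto
    have small: "2 * B j * (1 / 2) ^ n < r" if "n \<ge> N" for n
    proof -
      have "(1 / 2 :: real) ^ n \<le> (1 / 2) ^ N" using that by (intro power_decreasing) auto
      then have "2 * B j * (1 / 2) ^ n \<le> (2 * B j + 1) * (1 / 2) ^ N" using Bpos[of j] by (intro mult_mono) auto
      also have "\<dots> < r" using N Bpos[of j] by (simp add: pos_less_divide_eq mult.commute)
      finally show ?thesis .
    qed
    show ?thesis
    proof (intro exI[of _ N] allI impI)
      fix m n assume mn: "m \<ge> N" "n \<ge> N"
      show "q j ((\<Sum>i<m. u i) - (\<Sum>i<n. u i)) < r"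
      proof (cases "n \<le> m")
        case True
        then show ?thesis using tail'[OF True, of j] small[OF mn(2)] by linarith
      next
        case False
        then have "m \<le> n" by simp
        then show ?thesis using tail'[OF \<open>m \<le> n\<close>, of j] small[OF mn(1)] q_diff_commute[of j "\<Sum>i<m. u i" "\<Sum>i<n. u i"] by linarith
      qed
    qed
  qed
  then obtain l where l: "\<And>j. (\<lambda>n. q j ((\<Sum>i<n. u i) - l)) \<longlonglongrightarrow> 0" using Cauchy_limit[of "\<lambda>n. \<Sum>i<n. u i"] by blast
  have "q j (l - 0) \<le> 2 * B j" for j
  proof (rule q_limit_le[OF l])
    have "q j ((\<Sum>i<n. u i) - 0) \<le> 2 * B j" for n using tail'[of 0 n j] by simp
    then show "eventually (\<lambda>n. q j ((\<Sum>i<n. u i) - 0) \<le> 2 * B j) sequentially" by simp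
  qed
  then show ?thesis using l by (intro that[of l]) auto
qed

end

text \<open>
  The coordinates \<open>c x i\<close> with respect to the vectors \<open>v i\<close> are equicontinuous.  The expansion of a
  vector in the given order of the \<open>v i\<close> need not converge, so density of the span takes its place.
\<close>

locale leveled_basis = frechet_space smul q
  for smul :: "complex \<Rightarrow> 'a::ab_group_add \<Rightarrow> 'a" and q +
  fixes v :: "nat \<Rightarrow> 'a" and c :: "'a \<Rightarrow> nat \<Rightarrow> complex"
  assumes c_add: "c (x + y) i = c x i + c y i" and c_scale: "c (smul a x) i = a * c x i"
    and c_basis: "c (v n) i = (if i = n then 1 else 0)"
    and c_bound: "\<exists>k C. \<forall>x i. cmod (c x i) * q j (v i) \<le> C * q k x"
    and c_separates: "(\<And>i. c x i = 0) \<Longrightarrow> x = 0"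
    and dense: "0 < r \<Longrightarrow> \<exists>A b. q j (x - (\<Sum>i\<in>A. smul (b i) (v i))) < r"
    and level_v: "q j (v i) = 0 \<longleftrightarrow> j < level i"
begin

sublocale weights: leveled_weights "\<lambda>j i. q j (v i)"
  by unfold_locales (auto simp: level_v)

definition gauge :: "nat \<Rightarrow> real" where "gauge = (SOME g. \<forall>i. weights.demand g i (g i))"

lemma gauge: "weights.demand gauge i (gauge i)"
  unfolding gauge_def using someI_ex[OF weights.ex_scaling] by blast

lemma gauge_pos: "0 < gauge i"
  using gauge[of i] by (simp add: weights.demand_def)

definition f :: "nat \<Rightarrow> 'a" where "f i = smul (complex_of_real (gauge i)) (v i)"

text \<open>
  The intended value \<open>T f\<^sub>i\<close>.
\<close>

definition shift_f :: "nat \<Rightarrow> 'a" where "shift_f i = f (Suc i) + (if block_end i then f 0 else 0)"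

definition w :: "'a \<Rightarrow> nat \<Rightarrow> complex" where "w x i = c x i / complex_of_real (gauge i)"

lemma q_f: "q j (f i) = gauge i * q j (v i)"
  using gauge_pos[of i] by (simp add: f_def q_smul)

lemma q_shift_f_le: "q j (shift_f i) \<le> adj (\<lambda>n. gauge n * q j (v n)) i"
  using q_triangle[of j "f (Suc i)" "f 0"] by (simp add: shift_f_def adj_def q_f)

text \<open>
  From block \<open>j + 1\<close> on the choice of sizes gives the bound with constant \<open>1\<close>.  The finitely many
  earlier vectors have level at most \<open>j\<close>, so they are visible to the next seminorm and only affect
  the constant.
\<close>

lemma shift_f_bound: "\<exists>D\<ge>0. \<forall>i. q j (shift_f i) \<le> D * (1 / 2) ^ i * q (Suc j) (f i)"
proof -
  define d where "d i = q j (shift_f i) * 2 ^ i / q (Suc j) (f i)" for i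
  have d: "0 \<le> d i" for i by (simp add: d_def)
  define D where "D = 1 + (\<Sum>i<block_start (Suc j). d i)"
  have D: "1 \<le> D" using d by (simp add: D_def sum_nonneg)
  have "q j (shift_f i) \<le> D * (1 / 2) ^ i * q (Suc j) (f i)" for i
  proof (cases "j < block_of i")
    case True
    then have "0 < i" by (cases i) auto
    have "2 ^ i * q j (shift_f i) \<le> 2 ^ i * adj (\<lambda>n. gauge n * q j (v n)) i" using q_shift_f_le by (intro mult_left_mono) auto
    also have "\<dots> \<le> q (Suc j) (f i)" using weights.demand_step[OF gauge \<open>0 < i\<close> True] by (simp add: q_f)
    also have "\<dots> \<le> D * q (Suc j) (f i)" using mult_right_mono[OF D q_nonneg[of "Suc j" "f i"]] by simp
    finally show ?thesis by (simp add: field_simps power_one_over)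
  next
    case False
    then have le: "block_of i \<le> j" by simp
    have "i < block_start (Suc (block_of i))" by (rule block_of_less)
    also have "\<dots> \<le> block_start (Suc j)" using le by (intro block_start_mono) simp
    finally have "d i \<le> (\<Sum>i<block_start (Suc j). d i)" using d by (intro member_le_sum) auto
    then have "d i \<le> D" by (simp add: D_def)
    moreover have "0 < q (Suc j) (f i)"
    proof -
      have "\<not> Suc j < level i" using level_le_block[of i] le by simp
      then have "q (Suc j) (v i) \<noteq> 0" using level_v by simp
      then show ?thesis using gauge_pos[of i] by (simp add: q_f less_le)
    qed
    ultimately show ?thesis by (simp add: d_def field_simps power_one_over)
  qed
  then show ?thesis using D by (intro exI[of _ D]) auto
qed

lemma w_bound: "\<exists>k C. \<forall>x i. cmod (w x i) * q j (f i) \<le> C * q k x"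
proof -
  have "cmod (w x i) * q j (f i) = cmod (c x i) * q j (v i)" for x i
    using gauge_pos[of i] by (simp add: w_def q_f norm_divide)
  then show ?thesis using c_bound[of j] by simp
qed

lemma term_bound: "\<exists>k C. \<forall>x i. q j (smul (w x i) (shift_f i)) \<le> C * q k x * (1 / 2) ^ i"
proof -
  obtain D where D: "0 \<le> D" "\<And>i. q j (shift_f i) \<le> D * (1 / 2) ^ i * q (Suc j) (f i)" using shift_f_bound by blast
  obtain k C where C: "\<And>x i. cmod (w x i) * q (Suc j) (f i) \<le> C * q k x" using w_bound by blast
  have "q j (smul (w x i) (shift_f i)) \<le> (D * C) * q k x * (1 / 2) ^ i" for x i
  proof -
    have "q j (smul (w x i) (shift_f i)) \<le> cmod (w x i) * (D * (1 / 2) ^ i * q (Suc j) (f i))"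
      unfolding q_smul by (intro mult_left_mono D) auto
    also have "\<dots> = D * (1 / 2) ^ i * (cmod (w x i) * q (Suc j) (f i))" by simp
    also have "\<dots> \<le> D * (1 / 2) ^ i * (C * q k x)" using D(1) by (intro mult_left_mono C) auto
    finally show ?thesis by (simp add: mult_ac)
  qed
  then show ?thesis by blast
qed

lemma operator_exists:
  "\<exists>T. (\<forall>x j. (\<lambda>n. q j ((\<Sum>i<n. smul (w x i) (shift_f i)) - T x)) \<longlonglongrightarrow> 0) \<and> (\<forall>j. \<exists>k C. \<forall>x. q j (T x) \<le> C * q k x)"
proof -
  obtain k C where C: "\<And>j x i. q j (smul (w x i) (shift_f i)) \<le> C j * q (k j) x * (1 / 2) ^ i" using term_bound by metis
  have "\<exists>l. \<forall>j. (\<lambda>n. q j ((\<Sum>i<n. smul (w x i) (shift_f i)) - l)) \<longlonglongrightarrow> 0 \<and> q j l \<le> 2 * (C j * q (k j) x)" for x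
    by (rule series_converges[of "\<lambda>i. smul (w x i) (shift_f i)" "\<lambda>j. C j * q (k j) x", OF C]) blast
  then obtain T where T: "\<And>x j. (\<lambda>n. q j ((\<Sum>i<n. smul (w x i) (shift_f i)) - T x)) \<longlonglongrightarrow> 0"
    "\<And>x j. q j (T x) \<le> 2 * (C j * q (k j) x)" by metis
  have "\<exists>k C. \<forall>x. q j (T x) \<le> C * q k x" for j
    using T(2)[of j] by (intro exI[of _ "k j"] exI[of _ "2 * C j"]) (simp add: mult.assoc)
  then show ?thesis using T(1) by blast
qed

definition T :: "'a \<Rightarrow> 'a" where
  "T = (SOME T. (\<forall>x j. (\<lambda>n. q j ((\<Sum>i<n. smul (w x i) (shift_f i)) - T x)) \<longlonglongrightarrow> 0) \<and> (\<forall>j. \<exists>k C. \<forall>x. q j (T x) \<le> C * q k x))"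

lemma T_limit: "(\<lambda>n. q j ((\<Sum>i<n. smul (w x i) (shift_f i)) - T x)) \<longlonglongrightarrow> 0"
  and T_bound: "\<exists>k C. \<forall>x. q j (T x) \<le> C * q k x"
  using someI_ex[OF operator_exists, folded T_def] by blast+

lemma T_add: "T (x + y) = T x + T y"
proof (rule limit_unique[OF T_limit])
  fix j
  let ?s = "\<lambda>x n. \<Sum>i<n. smul (w x i) (shift_f i)"
  have lim: "(\<lambda>n. q j (?s x n - T x) + q j (?s y n - T y)) \<longlonglongrightarrow> 0"
    using tendsto_add[OF T_limit[of j x] T_limit[of j y]] by simp
  have eq: "?s (x + y) n - (T x + T y) = (?s x n - T x) + (?s y n - T y)" for n
    by (simp add: w_def c_add add_divide_distrib scale_left_distrib sum.distrib algebra_simps)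
  have le: "q j (?s (x + y) n - (T x + T y)) \<le> q j (?s x n - T x) + q j (?s y n - T y)" for n
    unfolding eq by (rule q_triangle)
  show "(\<lambda>n. q j (?s (x + y) n - (T x + T y))) \<longlonglongrightarrow> 0" by (rule tendsto_zero_le[OF lim q_nonneg le])
qed

lemma T_scale: "T (smul a x) = smul a (T x)"
proof (rule limit_unique[OF T_limit])
  fix j
  let ?s = "\<lambda>x n. \<Sum>i<n. smul (w x i) (shift_f i)"
  have lim: "(\<lambda>n. cmod a * q j (?s x n - T x)) \<longlonglongrightarrow> 0"
    using tendsto_mult[OF tendsto_const[of "cmod a"] T_limit[of j x]] by simp
  have "?s (smul a x) n - smul a (T x) = smul a (?s x n - T x)" for n
    by (simp add: w_def c_scale scale_sum_right scale_right_diff_distrib)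
  then show "(\<lambda>n. q j (?s (smul a x) n - smul a (T x))) \<longlonglongrightarrow> 0" using lim by (simp add: q_smul)
qed

lemma T_f: "T (f n) = shift_f n"
proof (rule limit_unique[OF T_limit])
  fix j
  have w: "w (f n) i = (if i = n then 1 else 0)" for i
    using gauge_pos[of n] by (simp add: w_def f_def c_scale c_basis)
  have "eventually (\<lambda>m. q j ((\<Sum>i<m. smul (w (f n) i) (shift_f i)) - shift_f n) = 0) sequentially"
    using eventually_gt_at_top[of n]
  proof eventually_elim
    case (elim m)
    have "(\<Sum>i<m. smul (w (f n) i) (shift_f i)) = (\<Sum>i\<in>{n}. smul (w (f n) i) (shift_f i))"
      by (rule sum.mono_neutral_right) (use elim in \<open>auto simp: w\<close>)
    then show ?case by (simp add: w)
  qed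
  then show "(\<lambda>m. q j ((\<Sum>i<m. smul (w (f n) i) (shift_f i)) - shift_f n)) \<longlonglongrightarrow> 0" by (rule tendsto_eventually)
qed

definition functional :: "('a \<Rightarrow> complex) \<Rightarrow> bool" where
  "functional \<xi> \<longleftrightarrow> (\<forall>x y. \<xi> (x + y) = \<xi> x + \<xi> y) \<and> (\<forall>a x. \<xi> (smul a x) = a * \<xi> x) \<and> (\<exists>k C. \<forall>x. cmod (\<xi> x) \<le> C * q k x)"

lemma functional_scale: "functional \<xi> \<Longrightarrow> \<xi> (smul a x) = a * \<xi> x"
  by (simp add: functional_def)

lemma functional_0: "functional \<xi> \<Longrightarrow> \<xi> 0 = 0"
  unfolding functional_def by (metis scale_zero_left mult_zero_left)

lemma functional_diff: "functional \<xi> \<Longrightarrow> \<xi> (x - y) = \<xi> x - \<xi> y"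
proof -
  assume \<xi>: "functional \<xi>"
  then have "\<xi> (x - y + y) = \<xi> (x - y) + \<xi> y" unfolding functional_def by blast
  then show ?thesis by (simp add: eq_diff_eq)
qed

lemma functional_sum: "functional \<xi> \<Longrightarrow> \<xi> (\<Sum>i\<in>A. h i) = (\<Sum>i\<in>A. \<xi> (h i))"
proof (induction A rule: infinite_finite_induct)
  case (insert a A)
  then show ?case unfolding functional_def by simp
qed (auto simp: functional_0)

lemma functional_T: "functional \<xi> \<Longrightarrow> functional (\<lambda>x. \<xi> (T x))"
proof -
  assume \<xi>: "functional \<xi>"
  then obtain k C where C: "\<And>x. cmod (\<xi> x) \<le> C * q k x" unfolding functional_def by blast
  obtain l D where D: "\<And>x. q k (T x) \<le> D * q l x" using T_bound by blast
  have "cmod (\<xi> (T x)) \<le> (\<bar>C\<bar> * D) * q l x" for x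
  proof -
    have "cmod (\<xi> (T x)) \<le> C * q k (T x)" by (rule C)
    also have "\<dots> \<le> \<bar>C\<bar> * q k (T x)" by (intro mult_right_mono) auto
    also have "\<dots> \<le> \<bar>C\<bar> * (D * q l x)" by (intro mult_left_mono D) auto
    finally show ?thesis by simp
  qed
  moreover have "\<xi> (T (x + y)) = \<xi> (T x) + \<xi> (T y)" "\<xi> (T (smul a x)) = a * \<xi> (T x)" for x y a
    using \<xi> unfolding functional_def T_add T_scale by blast+
  ultimately show ?thesis unfolding functional_def by blast
qed

lemma functional_funpow_T: "functional \<xi> \<Longrightarrow> functional (\<lambda>x. \<xi> ((T ^^ s) x))"
proof (induction s)
  case (Suc s)
  from functional_T[OF Suc.IH[OF Suc.prems]] show ?case by (simp add: funpow_swap1)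
qed simp

lemma functional_funpow_f: "functional \<xi> \<Longrightarrow> \<xi> ((T ^^ s) (f i)) = (adj ^^ s) (\<lambda>i. \<xi> (f i)) i"
proof (induction s arbitrary: i)
  case (Suc s)
  have "\<xi> ((T ^^ Suc s) (f i)) = \<xi> ((T ^^ s) (shift_f i))" by (simp add: funpow_swap1 T_f)
  also have "\<dots> = \<xi> ((T ^^ s) (f (Suc i))) + (if block_end i then \<xi> ((T ^^ s) (f 0)) else 0)"
  proof -
    have F: "functional (\<lambda>x. \<xi> ((T ^^ s) x))" by (rule functional_funpow_T[OF Suc.prems])
    then have "\<xi> ((T ^^ s) (x + y)) = \<xi> ((T ^^ s) x) + \<xi> ((T ^^ s) y)" for x y unfolding functional_def by blast
    then show ?thesis using functional_0[OF F] by (simp add: shift_f_def)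
  qed
  finally show ?case using Suc unfolding adj_funpow_Suc by simp
qed simp

lemma functional_tendsto:
  assumes "functional \<xi>" "\<And>j. (\<lambda>n. q j (u n - l)) \<longlonglongrightarrow> 0"
  shows "(\<lambda>n. \<xi> (u n)) \<longlonglongrightarrow> \<xi> l"
proof -
  obtain k C where C: "\<And>x. cmod (\<xi> x) \<le> C * q k x" using assms(1) unfolding functional_def by blast
  have lim: "(\<lambda>n. C * q k (u n - l)) \<longlonglongrightarrow> 0" using tendsto_mult[OF tendsto_const[of C] assms(2)[of k]] by simp
  have le: "cmod (\<xi> (u n) - \<xi> l) \<le> C * q k (u n - l)" for n
    using C[of "u n - l"] unfolding functional_diff[OF assms(1)] .
  have "(\<lambda>n. cmod (\<xi> (u n) - \<xi> l)) \<longlonglongrightarrow> 0"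
    by (rule tendsto_zero_le[OF lim norm_ge_zero le])
  then show ?thesis by (rule LIM_zero_cancel[OF tendsto_norm_zero_cancel])
qed

text \<open>
  Although vectors need not have convergent expansions, their images under \<open>T\<close> do, which is why only
  the powers \<open>T\<^sup>s\<close> with \<open>s > 0\<close> occur in \<open>no_annihilating_pair\<close>.
\<close>

lemma functional_T_sums: "functional \<xi> \<Longrightarrow> (\<lambda>i. w x i * \<xi> (shift_f i)) sums \<xi> (T x)"
proof -
  assume \<xi>: "functional \<xi>"
  have "\<xi> (\<Sum>i<n. smul (w x i) (shift_f i)) = (\<Sum>i<n. w x i * \<xi> (shift_f i))" for n
    by (simp add: functional_sum[OF \<xi>] functional_scale[OF \<xi>])
  then show ?thesis unfolding sums_def using functional_tendsto[OF \<xi> T_limit[of _ x]] by simp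
qed

lemma functional_eq_0: "functional \<xi> \<Longrightarrow> (\<And>i. \<xi> (f i) = 0) \<Longrightarrow> \<xi> x = 0"
proof -
  assume \<xi>: "functional \<xi>" and f0: "\<And>i. \<xi> (f i) = 0"
  have v: "\<xi> (v i) = 0" for i
    using f0[of i] gauge_pos[of i] by (simp add: f_def functional_scale[OF \<xi>])
  obtain k C where C: "\<And>x. cmod (\<xi> x) \<le> C * q k x" using \<xi> unfolding functional_def by blast
  have "cmod (\<xi> x) \<le> 0 + \<epsilon>" if "0 < \<epsilon>" for \<epsilon>
  proof -
    have pos: "0 < \<epsilon> / (\<bar>C\<bar> + 1)" using that by simp
    obtain A b where nb: "q k (x - (\<Sum>i\<in>A. smul (b i) (v i))) < \<epsilon> / (\<bar>C\<bar> + 1)" using dense[OF pos] by blast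
    have "\<xi> (\<Sum>i\<in>A. smul (b i) (v i)) = 0" by (simp add: functional_sum[OF \<xi>] functional_scale[OF \<xi>] v)
    then have "cmod (\<xi> x) = cmod (\<xi> (x - (\<Sum>i\<in>A. smul (b i) (v i))))" by (simp add: functional_diff[OF \<xi>])
    also have "\<dots> \<le> C * q k (x - (\<Sum>i\<in>A. smul (b i) (v i)))" by (rule C)
    also have "\<dots> \<le> (\<bar>C\<bar> + 1) * q k (x - (\<Sum>i\<in>A. smul (b i) (v i)))" by (intro mult_right_mono) auto
    also have "\<dots> \<le> \<epsilon>" using nb by (simp add: field_simps)
    finally show ?thesis by simp
  qed
  then have "cmod (\<xi> x) \<le> 0" by (rule field_le_epsilon)
  then show "\<xi> x = 0" by simp
qed

text \<open>
  If \<open>\<beta>\<close> is the first index at which \<open>\<xi>\<close> does not vanish, then \<open>\<eta> = \<xi> \<circ> T\<^sup>\<beta>\<close> still annihilates the orbit of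
  \<open>y\<close> and does not vanish at \<open>f\<^sub>0\<close>; after scaling, the coordinates of \<open>y\<close> and the values of \<open>\<eta>\<close> form an
  annihilating pair.
\<close>

lemma no_common_annihilator:
  assumes \<xi>: "functional \<xi>" and y: "y \<noteq> 0" and zero: "\<And>s. \<xi> ((T ^^ s) y) = 0"
  shows "\<xi> x = 0"
proof (rule ccontr)
  assume "\<xi> x \<noteq> 0"
  then have ex: "\<exists>i. \<xi> (f i) \<noteq> 0" using functional_eq_0[OF \<xi>] by blast
  \<comment> \<open>No return to \<open>0\<close> is felt during the first \<open>\<beta>\<close> steps from \<open>f 0\<close>, since the functional
      vanishes on all vectors before \<open>f \<beta>\<close>.\<close>
  define \<beta> where "\<beta> = (LEAST i. \<xi> (f i) \<noteq> 0)"
  have \<beta>: "\<xi> (f \<beta>) \<noteq> 0" unfolding \<beta>_def using LeastI_ex[OF ex] .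
  have below: "\<xi> (f i) = 0" if "i < \<beta>" for i using not_less_Least[of i "\<lambda>i. \<xi> (f i) \<noteq> 0"] that unfolding \<beta>_def by blast
  define \<eta> where "\<eta> x = \<xi> ((T ^^ \<beta>) x)" for x
  have \<eta>: "functional \<eta>" unfolding \<eta>_def by (rule functional_funpow_T[OF \<xi>])
  have \<eta>0: "\<eta> (f 0) \<noteq> 0"
    unfolding \<eta>_def functional_funpow_f[OF \<xi>] using adj_funpow_first_nonzero[of \<beta> "\<lambda>i. \<xi> (f i)" 0 \<beta>] below \<beta> by simp
  obtain k C where C: "\<And>x. cmod (\<eta> x) \<le> C * q k x" using \<eta> unfolding functional_def by blast
  have Cpos: "0 < C"
  proof (rule ccontr)
    assume "\<not> 0 < C"
    then have "C * q k (f 0) \<le> 0" by (simp add: mult_nonpos_nonneg)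
    moreover have "0 < cmod (\<eta> (f 0))" using \<eta>0 by simp
    ultimately show False using C[of "f 0"] by linarith
  qed
  define a where "a i = (1 / complex_of_real C) * \<eta> (f i)" for i
  obtain l B where B: "\<And>x i. cmod (w x i) * q (Suc k) (f i) \<le> B * q l x" using w_bound by blast
  have "w y = (\<lambda>i. 0)"
  proof (rule weights.no_annihilating_pair[OF gauge])
    show "cmod (a i) \<le> gauge i * q k (v i)" for i
      using C[of "f i"] Cpos by (simp add: a_def norm_mult norm_divide q_f field_simps)
    show "a 0 \<noteq> 0" using \<eta>0 Cpos by (simp add: a_def)
    show "cmod (w y i) * (gauge i * q (Suc k) (v i)) \<le> B * q l y" for i using B[of y i] by (simp add: q_f)
    fix s :: nat assume s: "0 < s"
    then obtain t where t: "s = Suc t" by (cases s) auto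
    have "(\<lambda>i. w y i * \<eta> ((T ^^ t) (shift_f i))) sums \<eta> ((T ^^ t) (T y))"
      by (rule functional_T_sums[OF functional_funpow_T[OF \<eta>]])
    moreover have "\<eta> ((T ^^ t) (T y)) = 0"
    proof -
      have "\<eta> ((T ^^ t) (T y)) = \<xi> ((T ^^ (\<beta> + s)) y)" unfolding \<eta>_def t by (simp add: funpow_add funpow_swap1)
      then show ?thesis by (simp add: zero)
    qed
    moreover have "\<eta> ((T ^^ t) (shift_f i)) = (adj ^^ s) (\<lambda>i. \<eta> (f i)) i" for i
    proof -
      have "\<eta> ((T ^^ t) (shift_f i)) = \<eta> ((T ^^ s) (f i))" unfolding t by (simp add: funpow_swap1 T_f)
      then show ?thesis by (simp add: functional_funpow_f[OF \<eta>])
    qed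
    ultimately have "(\<lambda>i. w y i * (adj ^^ s) (\<lambda>i. \<eta> (f i)) i) sums 0" by simp
    from sums_mult[OF this, of "1 / complex_of_real C"]
    show "(\<lambda>i. w y i * (adj ^^ s) a i) sums 0"
      unfolding a_def adj_funpow_cmult by (simp add: mult.left_commute)
  qed
  then have "c y i = 0" for i using gauge_pos[of i] by (simp add: w_def fun_eq_iff) (metis less_irrefl)
  then have "y = 0" by (rule c_separates)
  then show False using y by simp
qed

theorem not_invariant_subspace_property: "\<not> invariant_subspace_property smul q"
proof
  assume isp: "invariant_subspace_property smul q"
  have lin: "Vector_Spaces.linear smul smul T"
    unfolding Vector_Spaces.linear_iff using vector_space_axioms by (simp add: T_add T_scale)
  have "continuous_map (seminorm_topology q) (seminorm_topology q) T"
    unfolding continuous_linear_iff[OF seminormed_space_axioms seminormed_space_axioms lin] using T_bound by blast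
  with isp lin obtain M where M: "subspace M" "closedin (seminorm_topology q) M" "M \<noteq> {0}" "M \<noteq> UNIV" "T ` M \<subseteq> M"
    unfolding invariant_subspace_property_def by blast
  obtain y where y: "y \<in> M" "y \<noteq> 0" using M(3) subspace_0[OF M(1)] by blast
  obtain x0 where "x0 \<notin> M" using M(4) by blast
  then obtain k r where r: "0 < r" "\<And>m. m \<in> M \<Longrightarrow> r \<le> q k (m - x0)" using M(2) unfolding closedin_iff by (meson not_le)
  obtain \<xi> where \<xi>: "\<And>x y. \<xi> (x + y) = \<xi> x + \<xi> y" "\<And>c x. \<xi> (smul c x) = c * \<xi> x"
    "\<And>x. cmod (\<xi> x) \<le> q k x" "\<And>m. m \<in> M \<Longrightarrow> \<xi> m = 0" "\<xi> x0 \<noteq> 0"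
    using separating_functional[OF vector_space_axioms is_seminorm M(1) r] by blast
  have "functional \<xi>" unfolding functional_def using \<xi>(1,2,3) by (metis mult_1)
  moreover have "(T ^^ s) y \<in> M" for s using M(5) y(1) by (induction s) auto
  ultimately have "\<xi> x0 = 0" using no_common_annihilator[OF _ y(2)] \<xi>(4) by blast
  then show False using \<xi>(5) by simp
qed

end

section \<open>Sequence spaces over a space with one large seminorm\<close>

lemma infinite_level: "infinite {i. level i = l}"
proof -
  have "\<exists>i>n. level i = l" for n
  proof -
    define \<sigma> where "\<sigma> = max n l"
    define b b' where "b = block_start \<sigma>" and "b' = block_start (Suc \<sigma>)"
    have b': "b' = b + b * 3 ^ \<sigma>" by (simp add: b_def b'_def block_start.simps algebra_simps)
    have b: "0 < b" by (simp add: b_def)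
    have "b * 3 ^ l \<le> b * 3 ^ \<sigma>" by (intro mult_le_mono2 power_increasing) (auto simp: \<sigma>_def)
    define i where "i = b' - b * 3 ^ l"
    have i: "b \<le> i" "i + b * 3 ^ l = b'" using \<open>b * 3 ^ l \<le> b * 3 ^ \<sigma>\<close> unfolding i_def b' by linarith+
    have "0 < b * 3 ^ l" using b by simp
    then have "i < b'" using i(2) by linarith
    then have le: "level i \<le> k \<longleftrightarrow> b' \<le> i + b * 3 ^ k" for k
      using level_le_in_block[of \<sigma> i k] i(1) by (simp add: b_def b'_def)
    have "level i \<le> l" using le i(2) by simp
    moreover have "\<not> level i \<le> k" if "k < l" for k
    proof -
      have "b * 3 ^ k < b * 3 ^ l" using b that by simp
      then show ?thesis using le[of k] i(2) by linarith
    qed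
    ultimately have "level i = l" by (metis le_refl linorder_neqE_nat not_less)
    moreover have "n < i" using i(1) block_start_gt[of \<sigma>] by (simp add: b_def \<sigma>_def)
    ultimately show ?thesis by blast
  qed
  then show ?thesis by (auto simp: infinite_nat_iff_unbounded)
qed

text \<open>
  Both sides split into countably infinite sets according to the level, which are matched one by one.
\<close>

lemma exists_level_enumeration:
  fixes lv :: "nat \<times> nat \<Rightarrow> nat"
  assumes "\<And>l. infinite {p. lv p = l}"
  obtains \<phi> where "bij \<phi>" "\<And>i. lv (\<phi> i) = level i"
proof -
  have "\<exists>h. bij_betw h {i. level i = l} {p. lv p = l}" for l
  proof -
    have "bij_betw (to_nat_on {i. level i = l}) {i. level i = l} UNIV"
      by (rule to_nat_on_infinite[OF countableI_type infinite_level])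
    moreover have "bij_betw (from_nat_into {p. lv p = l}) UNIV {p. lv p = l}"
      by (rule bij_betw_from_nat_into[OF countableI_type assms])
    ultimately show ?thesis using bij_betw_trans by blast
  qed
  then obtain h where h: "\<And>l. bij_betw (h l) {i. level i = l} {p. lv p = l}" by metis
  define \<phi> where "\<phi> i = h (level i) i" for i
  have lv: "lv (\<phi> i) = level i" for i using bij_betwE[OF h[of "level i"]] by (auto simp: \<phi>_def)
  have "inj \<phi>"
  proof (rule injI)
    fix i j assume eq: "\<phi> i = \<phi> j"
    then have "level i = level j" using lv[of i] lv[of j] by simp
    then show "i = j" using eq bij_betw_imp_inj_on[OF h[of "level j"]] by (auto simp: \<phi>_def inj_on_def)
  qed
  moreover have "surj \<phi>"
  proof (rule surjI[of _ "\<lambda>p. inv_into {i. level i = lv p} (h (lv p)) p"])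
    fix p
    have im: "p \<in> h (lv p) ` {i. level i = lv p}" using bij_betw_imp_surj_on[OF h[of "lv p"]] by auto
    have "level (inv_into {i. level i = lv p} (h (lv p)) p) = lv p" using inv_into_into[OF im] by simp
    then show "\<phi> (inv_into {i. level i = lv p} (h (lv p)) p) = p" using f_inv_into_f[OF im] by (simp add: \<phi>_def)
  qed
  ultimately show ?thesis using lv that bijI by blast
qed

lemma frechet_space_tail:
  assumes "frechet_space smul q"
  shows "frechet_space smul (\<lambda>j. q (j0 + j))" and "seminorm_topology (\<lambda>j. q (j0 + j)) = seminorm_topology q"
proof -
  interpret X: frechet_space smul q by fact
  interpret Z: seminormed_space smul "\<lambda>j. q (j0 + j)"
    by unfold_locales (auto intro: X.seminorm X.increasing)
  show top: "seminorm_topology (\<lambda>j. q (j0 + j)) = seminorm_topology q"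
    unfolding topology_eq
  proof (intro allI iffI)
    fix U
    show "openin (seminorm_topology q) U" if "openin (seminorm_topology (\<lambda>j. q (j0 + j))) U"
      using that unfolding X.openin_iff Z.openin_iff by fast
    show "openin (seminorm_topology (\<lambda>j. q (j0 + j))) U" if U: "openin (seminorm_topology q) U"
      unfolding Z.openin_iff
    proof
      fix x assume "x \<in> U"
      then obtain j r where jr: "0 < r" "\<forall>y. q j (y - x) < r \<longrightarrow> y \<in> U" using U unfolding X.openin_iff by fast
      have "y \<in> U" if "q (j0 + j) (y - x) < r" for y
        using jr(2) that X.increasing[of j "j0 + j" "y - x"] by auto
      then show "\<exists>j r. 0 < r \<and> (\<forall>y. q (j0 + j) (y - x) < r \<longrightarrow> y \<in> U)" using jr(1) by blast
    qed
  qed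
  show "frechet_space smul (\<lambda>j. q (j0 + j))"
  proof
    show "seminorm smul (q (j0 + j))" for j by (rule X.seminorm)
    show "q (j0 + j) x \<le> q (j0 + k) x" if "j \<le> k" for j k x using that by (intro X.increasing) simp
    show "x = 0" if z: "\<And>j. q (j0 + j) x = 0" for x
    proof (rule X.separating)
      fix j
      have "q j x \<le> q (j0 + j) x" by (rule X.increasing) simp
      then show "q j x = 0" using z[of j] by (intro antisym) auto
    qed
    fix u assume C: "seminorm_Cauchy (\<lambda>j. q (j0 + j)) u"
    have "seminorm_Cauchy q u"
      unfolding seminorm_Cauchy_def
    proof (intro allI impI)
      fix j and r :: real assume "0 < r"
      then obtain L where L: "\<forall>m\<ge>L. \<forall>n\<ge>L. q (j0 + j) (u m - u n) < r" using C unfolding seminorm_Cauchy_def by fast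
      have "q j (u m - u n) < r" if "L \<le> m" "L \<le> n" for m n
        using L that X.increasing[of j "j0 + j" "u m - u n"] by (meson le_add2 le_less_trans)
      then show "\<exists>N. \<forall>m\<ge>N. \<forall>n\<ge>N. q j (u m - u n) < r" by blast
    qed
    then show "\<exists>l. limitin (seminorm_topology (\<lambda>j. q (j0 + j))) u l sequentially"
      unfolding top by (rule X.complete)
  qed
qed

definition single :: "nat \<Rightarrow> 'a::zero \<Rightarrow> nat \<Rightarrow> 'a" where
  "single n x = (\<lambda>m. if m = n then x else 0)"

lemma sum_fun_apply: "(\<Sum>i\<in>A. g i) m = (\<Sum>i\<in>A. g i m)"
  for g :: "'i \<Rightarrow> nat \<Rightarrow> 'a::comm_monoid_add"
  by (induction A rule: infinite_finite_induct) auto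

context schauder_space
begin

lemma seq_seminorm_single: "seq_seminorm q j (single n x) = (if n \<le> j then q j x else 0)"
proof (rule antisym)
  show "seq_seminorm q j (single n x) \<le> (if n \<le> j then q j x else 0)"
    unfolding seq_seminorm_le_iff by (auto simp: single_def)
  show "(if n \<le> j then q j x else 0) \<le> seq_seminorm q j (single n x)"
    using seq_seminorm_ge[of n j q "single n x"] seq_seminorm_ge[of 0 j q "single n x"]
    by (auto simp: single_def split: if_splits)
qed

text \<open>
  For each \<open>l\<close> the vectors \<open>e\<^sub>n\<close> with \<open>q\<^sub>j\<^sub>0 (e\<^sub>n) \<noteq> 0\<close>, put in place \<open>j\<^sub>0 + l\<close>, have level \<open>l\<close> for the seminorms
  counted from \<open>j\<^sub>0\<close> on: earlier seminorms do not look at that place.  Hence each level is attained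
  infinitely often, and the basis vectors can be arranged as \<open>leveled_basis\<close> asks.
\<close>

lemma not_invariant_subspace_property_seq:
  assumes N: "N = \<infinity>" and j0: "infinite {n. q j0 (e n) \<noteq> 0}"
  shows "\<not> invariant_subspace_property (seq_scale smul) (seq_seminorm q)"
proof -
  define P where "P j = seq_seminorm q (j0 + j)" for j
  have Y: "frechet_space (seq_scale smul) (seq_seminorm q)" by (rule frechet_space_seq[OF frechet_space_axioms])
  have P: "frechet_space (seq_scale smul) P" "seminorm_topology P = seminorm_topology (seq_seminorm q)"
    unfolding P_def by (rule frechet_space_tail[OF Y])+
  interpret P: frechet_space "seq_scale smul" P by (rule P(1))
  define ev where "ev p = single (snd p) (e (fst p))" for p
  have P_ev: "P j (ev p) = (if snd p \<le> j0 + j then q (j0 + j) (e (fst p)) else 0)" for j p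
    by (simp add: P_def ev_def seq_seminorm_single)
  define lv where "lv p = (LEAST j. P j (ev p) \<noteq> 0)" for p
  have ex: "\<exists>j. P j (ev p) \<noteq> 0" for p
  proof (rule ccontr)
    assume "\<nexists>j. P j (ev p) \<noteq> 0"
    then have "ev p = 0" by (intro P.separating) simp
    then have "ev p (snd p) = 0" by simp
    then show False using basis_nonzero[of "fst p"] N by (simp add: ev_def single_def)
  qed
  have lv_iff: "P j (ev p) = 0 \<longleftrightarrow> j < lv p" for j p
  proof
    assume z: "P j (ev p) = 0"
    show "j < lv p"
    proof (rule ccontr)
      assume "\<not> j < lv p"
      then have "P (lv p) (ev p) \<le> P j (ev p)" by (intro P.increasing) simp
      then have "P (lv p) (ev p) = 0" using z by (intro antisym) auto
      then show False using LeastI_ex[OF ex[of p]] by (simp add: lv_def)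
    qed
  next
    assume "j < lv p"
    then show "P j (ev p) = 0" using not_less_Least[of j "\<lambda>j. P j (ev p) \<noteq> 0"] by (simp add: lv_def)
  qed
  have "infinite {p. lv p = l}" for l
  proof -
    have "lv (n, j0 + l) = l" if "q j0 (e n) \<noteq> 0" for n
    proof -
      have "0 < q j0 (e n)" using that by (simp add: less_le)
      then have "q (j0 + l) (e n) \<noteq> 0" using increasing[of j0 "j0 + l" "e n"] by auto
      then have "\<not> l < lv (n, j0 + l)" unfolding lv_iff[symmetric] by (simp add: P_ev)
      moreover have "j < lv (n, j0 + l)" if "j < l" for j unfolding lv_iff[symmetric] using that by (simp add: P_ev)
      ultimately show ?thesis by (metis linorder_neqE_nat not_less_iff_gr_or_eq)
    qed
    then have "(\<lambda>n. (n, j0 + l)) ` {n. q j0 (e n) \<noteq> 0} \<subseteq> {p. lv p = l}" by auto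
    moreover have "infinite ((\<lambda>n. (n, j0 + l)) ` {n. q j0 (e n) \<noteq> 0})" using j0 by (subst finite_image_iff) (auto simp: inj_on_def)
    ultimately show ?thesis using finite_subset by blast
  qed
  then obtain \<phi> where \<phi>: "bij \<phi>" "\<And>i. lv (\<phi> i) = level i" using exists_level_enumeration by blast
  define c where "c y i = coef (y (snd (\<phi> i))) (fst (\<phi> i))" for y i
  have cb: "coef (e n) = (\<lambda>m. if m = n then 1 else 0)" for n by (rule coef_basis) (simp add: N)
  interpret leveled_basis "seq_scale smul" P "\<lambda>i. ev (\<phi> i)" c
  proof
    show "c (x + y) i = c x i + c y i" for x y i by (simp add: c_def coef_add)
    show "c (seq_scale smul a x) i = a * c x i" for a x i by (simp add: c_def seq_scale_def coef_scale)
    show "c (ev (\<phi> n)) i = (if i = n then 1 else 0)" for n i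
    proof -
      have "c (ev (\<phi> n)) i = (if \<phi> i = \<phi> n then 1 else 0)"
        by (auto simp: c_def ev_def single_def cb coef_0 prod_eq_iff)
      then show ?thesis using bij_is_inj[OF \<phi>(1)] by (simp add: inj_eq)
    qed
    show "\<exists>k C. \<forall>x i. cmod (c x i) * P j (ev (\<phi> i)) \<le> C * P k x" for j
    proof -
      obtain k C where C: "\<And>x n. cmod (coef x n) * q (j0 + j) (e n) \<le> C * q k x" using coef_equicontinuous by blast
      let ?k = "k + j"
      have "cmod (c y i) * P j (ev (\<phi> i)) \<le> \<bar>C\<bar> * P ?k y" for y i
      proof (cases "snd (\<phi> i) \<le> j0 + j")
        case True
        have "cmod (c y i) * P j (ev (\<phi> i)) \<le> C * q k (y (snd (\<phi> i)))" using C True by (simp add: P_ev c_def)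
        also have "\<dots> \<le> \<bar>C\<bar> * q (j0 + ?k) (y (snd (\<phi> i)))" by (intro mult_mono increasing) auto
        also have "\<dots> \<le> \<bar>C\<bar> * P ?k y" unfolding P_def using True by (intro mult_left_mono seq_seminorm_ge) auto
        finally show ?thesis .
      qed (simp add: P_ev)
      then show ?thesis by blast
    qed
    show "y = 0" if c0: "\<And>i. c y i = 0" for y
    proof
      fix n
      have "coef (y n) k = 0" for k
      proof -
        obtain i where "(k, n) = \<phi> i" using bij_is_surj[OF \<phi>(1)] by (metis surjD)
        then show ?thesis using c0[of i] by (metis c_def fst_conv snd_conv)
      qed
      then show "y n = 0 n" using eq_0_if_coef_0 by simp
    qed
    show "\<exists>A b. P j (y - (\<Sum>i\<in>A. seq_scale smul (b i) (ev (\<phi> i)))) < r" if r: "0 < r" for r j y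
    proof -
      let ?J = "j0 + j"
      have "eventually (\<lambda>m. \<forall>n\<in>{..?J}. dist (q ?J (partial m (y n) - y n)) 0 < r) sequentially"
        by (rule eventually_ball_finite) (use tendstoD[OF partial_tendsto r] in auto)
      then obtain M where "\<forall>n\<in>{..?J}. dist (q ?J (partial M (y n) - y n)) 0 < r" unfolding eventually_sequentially by blast
      then have M: "q ?J (y n - partial M (y n)) < r" if "n \<le> ?J" for n using that by (simp add: q_diff_commute)
      \<comment> \<open>Truncating the basis expansions of the finitely many coordinates that \<open>P j\<close> sees.\<close>
      define D where "D = {..<M} \<times> {..?J}"
      define A where "A = inv \<phi> ` D"
      have "(\<Sum>i\<in>A. seq_scale smul (c y i) (ev (\<phi> i))) = (\<Sum>p\<in>D. seq_scale smul (coef (y (snd p)) (fst p)) (ev p))"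
        unfolding A_def using bij_is_surj[OF \<phi>(1)] bij_imp_bij_inv[OF \<phi>(1)]
        by (subst sum.reindex) (auto intro: inj_on_subset[OF bij_is_inj] simp: c_def surj_f_inv_f)
      moreover have "(\<Sum>p\<in>D. seq_scale smul (coef (y (snd p)) (fst p)) (ev p)) n = partial M (y n)" if n: "n \<le> ?J" for n
      proof -
        have "(\<Sum>p\<in>D. seq_scale smul (coef (y (snd p)) (fst p)) (ev p)) n
          = (\<Sum>(k, l)\<in>{..<M} \<times> {..?J}. if l = n then smul (coef (y n) k) (e k) else 0)"
          unfolding sum_fun_apply D_def by (intro sum.cong) (auto simp: seq_scale_def ev_def single_def)
        also have "\<dots> = (\<Sum>k<M. \<Sum>l\<le>?J. if l = n then smul (coef (y n) k) (e k) else 0)"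
          by (rule sum.cartesian_product[symmetric])
        also have "\<dots> = partial M (y n)" unfolding partial_def using n by (intro sum.cong) (auto simp: sum.delta)
        finally show ?thesis .
      qed
      ultimately have "P j (y - (\<Sum>i\<in>A. seq_scale smul (c y i) (ev (\<phi> i)))) < r"
        unfolding P_def seq_seminorm_less_iff using M by simp
      then show ?thesis by blast
    qed
    show "P j (ev (\<phi> i)) = 0 \<longleftrightarrow> j < level i" for j i by (simp add: lv_iff \<phi>(2))
  qed
  show ?thesis using not_invariant_subspace_property unfolding invariant_subspace_property_def P(2) .
qed

end

section \<open>The characterization\<close>

theorem corollary1p2:
  fixes smul :: "complex \<Rightarrow> 'a::ab_group_add \<Rightarrow> 'a"
    and q :: "nat \<Rightarrow> 'a \<Rightarrow> real"
    and N :: enat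
    and e :: "nat \<Rightarrow> 'a"
  assumes "frechet_space smul q"
    and "schauder_basis smul q N e"
    and "\<exists>x::'a. x \<noteq> 0"
  shows "invariant_subspace_property (seq_scale smul) (seq_seminorm q) \<longleftrightarrow>
           (\<exists>B. finite_dimensional_vector_space smul B) \<or>
           isomorphic_spaces smul q omega_scale omega_seminorm"
proof -
  interpret schauder_space smul q N e
    using assms(1,2) by (simp add: schauder_space_def schauder_space_axioms_def)
  interpret Y: frechet_space "seq_scale smul" "seq_seminorm q"
    by (rule frechet_space_seq[OF assms(1)])
  interpret O: frechet_space omega_scale omega_seminorm
    by (rule frechet_space_omega)
  have isp: "invariant_subspace_property (seq_scale smul) (seq_seminorm q)"
    if "isomorphic_spaces (seq_scale smul) (seq_seminorm q) omega_scale omega_seminorm"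
    by (rule invariant_subspace_property_isomorphic[OF Y.seminormed_space_axioms
          O.seminormed_space_axioms that invariant_subspace_property_omega])
  show ?thesis
  proof
    assume inv: "invariant_subspace_property (seq_scale smul) (seq_seminorm q)"
    show "(\<exists>B. finite_dimensional_vector_space smul B) \<or>
        isomorphic_spaces smul q omega_scale omega_seminorm"
    proof (cases N)
      case (enat d)
      then show ?thesis using finite_dimensional_if_finite_basis by blast
    next
      case infinity
      then have "finite {n. q j (e n) \<noteq> 0}" for j
        using not_invariant_subspace_property_seq inv by blast
      then show ?thesis using isomorphic_omega_if_flat[OF infinity] by blast
    qed
  next
    assume "(\<exists>B. finite_dimensional_vector_space smul B) \<or>
        isomorphic_spaces smul q omega_scale omega_seminorm"
    then show "invariant_subspace_property (seq_scale smul) (seq_seminorm q)"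
    proof
      assume "\<exists>B. finite_dimensional_vector_space smul B"
      then obtain d where "N = enat d" using finite_basis_if_finite_dimensional by blast
      then show ?thesis by (intro isp seq_isomorphic_omega_if_finite_basis assms(3))
    next
      assume "isomorphic_spaces smul q omega_scale omega_seminorm"
      then show ?thesis by (intro isp seq_isomorphic_omega_if_omega assms(1))
    qed
  qed
qed

end
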